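(* Let $n$ be even and $d=d(n)\ge 3$ with $d=o(n^{1/7}/\log n)$. Then there exists a coupling $(P,P')$ such that $P\sim\mathcal P_*(n,d)+\mathcal M_1^+$, $P'\sim\mathcal P_*(n,d+1)$, and $\mathbb P(P=P')=1-O(\log d/d)$.
   Context: $\mathcal P_*(n,d)$ is the configuration model (uniform perfect matching of $nd$ points grouped into $n$ bins of $d$ points, one bin per vertex of $[n]$) conditioned on no pair lying within a single bin; $G[P]$ is the associated multigraph. $\mathcal M_1^+$ is a uniformly random perfect matching on $[n]$, regarded as a pairing with one point per vertex. The superposition $\mathcal P_*(n,d)+\mathcal M_1^+$ is formed from independent samples by taking the union of the points and of the matched pairs, giving a pairing with $d+1$ points per vertex; here $P=P'$ means the resulting multigraphs coincide. *)

theory Defs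
  imports "HOL-Probability.Probability" "HOL-Library.Landau_Symbols"
begin

text \<open>Points: vertex v in [n] = {..<n} has bin of points (v,i), i < k.
  A pairing is a perfect matching of the points: a set of 2-element sets of points
  partitioning the point set.\<close>

definition points :: "nat \<Rightarrow> nat \<Rightarrow> (nat \<times> nat) set" where
  "points n k = {..<n} \<times> {..<k}"

definition perfect_matchings :: "'a set \<Rightarrow> 'a set set set" where
  "perfect_matchings S =
     {M. (\<forall>e\<in>M. e \<subseteq> S \<and> card e = 2) \<and> (\<forall>x\<in>S. \<exists>!e. e \<in> M \<and> x \<in> e)}"

definition no_bin_pair :: "(nat \<times> nat) set set \<Rightarrow> bool" where
  "no_bin_pair P \<longleftrightarrow> (\<forall>e\<in>P. \<forall>x\<in>e. \<forall>y\<in>e. fst x = fst y \<longrightarrow> x = y)"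

text \<open>Configuration model P(n,k) conditioned on no pair within a bin:
  uniform on the pairings with that property.\<close>
definition Pstar :: "nat \<Rightarrow> nat \<Rightarrow> (nat \<times> nat) set set pmf" where
  "Pstar n k = pmf_of_set {P \<in> perfect_matchings (points n k). no_bin_pair P}"

definition M1 :: "nat \<Rightarrow> nat set set pmf" where
  "M1 n = pmf_of_set (perfect_matchings {..<n})"

text \<open>A matching on [n] regarded as a pairing with one point per vertex; the point
  of vertex v is labelled (v,k), so that it becomes the (k+1)-st point of bin v
  when superposed onto a pairing with k points per vertex.\<close>
definition lift_matching :: "nat \<Rightarrow> nat set set \<Rightarrow> (nat \<times> nat) set set" where
  "lift_matching k M = (\<lambda>e. (\<lambda>v. (v, k)) ` e) ` M"

definition Pstar_plus_M1 :: "nat \<Rightarrow> nat \<Rightarrow> (nat \<times> nat) set set pmf" where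
  "Pstar_plus_M1 n d =
     bind_pmf (Pstar n d) (\<lambda>P. map_pmf (\<lambda>M. P \<union> lift_matching d M) (M1 n))"

definition multigraph :: "(nat \<times> nat) set set \<Rightarrow> nat set multiset" where
  "multigraph P = image_mset (\<lambda>e. fst ` e) (mset_set P)"

definition is_coupling :: "('a \<times> 'b) pmf \<Rightarrow> 'a pmf \<Rightarrow> 'b pmf \<Rightarrow> bool" where
  "is_coupling \<mu> p q \<longleftrightarrow> map_pmf fst \<mu> = p \<and> map_pmf snd \<mu> = q"

end

theory Submission
  imports Defs "HOL-Combinatorics.Transposition"
begin

text \<open>Select one point in every bin. A pairing with \<^term>\<open>d + 1\<close> points per bin that maps the
  selected points to each other is a superposition of a pairing with \<^term>\<open>d\<close> points per bin and a
  perfect matching of the bins. Hence, after a uniformly random relabelling of the points inside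
  each bin, which does not affect the multigraph, the superposition model is the conditioned
  configuration model reweighted by the number X of selections that the pairing maps to itself.
  The total variation distance is therefore at most half the square root of
  E X^2 / (E X)^2 - 1.

  E X^2 counts pairs of selections, sorted by the number of bins in which they agree, and reduces
  to numbers of loopless pairings of bins of sizes d and d - 1. Exposing the bins one at a time,
  a switching shows that, given that the bins seen so far have no loop, a fixed pair inside the next
  bin is matched with the unconditional probability 1 / (m - 1) up to a factor 1 + O(d / m), where m
  is the number of points. So looplessness has probability exp(-B / m + O(d^2 / n)), B being the
  number of pairs of points inside bins. The remaining sum over the overlap is an expectation over
  a negative binomial law whose mean makes all exponential factors cancel, and
  E X^2 = (1 + O(1 / d^2)) (E X)^2.\<close>

section \<open>Perfect matchings and switchings\<close>

text \<open>The relabelling is what makes a coupling possible. X is the number of perfect matchings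
  of the multigraph, parallel edges kept apart, hence at most (d + 1)^(n/2). So under the target law
  a fixed selection is mapped to itself with probability at most (d + 1)^(-n/2), whereas in the
  superposition the points with index \<open>d\<close> always are. The two models hardly ever agree
  as pairings; only their multigraphs can. The difficulty is precision: a failure probability of
  order 1/d asks for a moment ratio of 1 + O(1/d^2), so even bounded factors must cancel. The errors
  d^2/n of the loop probabilities are harmless because the growth assumption gives d^4 \<le> n. Two
  independent selections agree in a bin with probability 1/(d + 1), which is the centre of the
  overlap fraction x. The loop probability of the residual points varies roughly like exp (- x/2)
  and is compensated by a ratio of central binomial coefficients, which varies like exp
  (x/2).\<close>

lemma perfect_matchingsD:
  assumes "M \<in> perfect_matchings S"
  shows "e \<in> M \<Longrightarrow> e \<subseteq> S" "e \<in> M \<Longrightarrow> card e = 2"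
    "x \<in> S \<Longrightarrow> \<exists>e\<in>M. x \<in> e" "e \<in> M \<Longrightarrow> f \<in> M \<Longrightarrow> x \<in> e \<Longrightarrow> x \<in> f \<Longrightarrow> e = f"
  using assms unfolding perfect_matchings_def by blast+

lemma perfect_matchingsI:
  assumes "\<And>e. e \<in> M \<Longrightarrow> e \<subseteq> S" "\<And>e. e \<in> M \<Longrightarrow> card e = 2"
    "\<And>x. x \<in> S \<Longrightarrow> \<exists>e\<in>M. x \<in> e"
    "\<And>e f x. e \<in> M \<Longrightarrow> f \<in> M \<Longrightarrow> x \<in> e \<Longrightarrow> x \<in> f \<Longrightarrow> e = f"
  shows "M \<in> perfect_matchings S"
  using assms unfolding perfect_matchings_def by blast

lemma finite_perfect_matchings: "finite S \<Longrightarrow> finite (perfect_matchings S)"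
  by (rule finite_subset[of _ "Pow (Pow S)"]) (auto simp: perfect_matchings_def)

lemma perfect_matchings_edge:
  assumes "M \<in> perfect_matchings S" "{x, y} \<in> M"
  shows "x \<noteq> y" "x \<in> S" "y \<in> S"
  using perfect_matchingsD(1,2)[OF assms] by (auto simp: card_insert_if split: if_splits)

lemma perfect_matchings_partner:
  assumes "M \<in> perfect_matchings S" "x \<in> S"
  shows "\<exists>!y. {x, y} \<in> M"
proof -
  from perfect_matchingsD(3)[OF assms] obtain e where e: "e \<in> M" "x \<in> e" by blast
  with perfect_matchingsD(2)[OF assms(1)] obtain y where y: "e = {x, y}" "x \<noteq> y"
    by (metis card_2_iff insert_commute insertE singletonD)
  have "z = y" if "{x, z} \<in> M" for z
  proof -
    have "{x, z} = {x, y}"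
      using perfect_matchingsD(4)[OF assms(1) that, of e x] e y by auto
    then show "z = y" by (auto simp: doubleton_eq_iff)
  qed
  then show ?thesis using e y by blast
qed

lemma perfect_matchings_unique:
  assumes "M \<in> perfect_matchings S" "{x, y} \<in> M" "{x, z} \<in> M"
  shows "y = z"
  using perfect_matchings_partner[OF assms(1), of x] perfect_matchings_edge[OF assms(1,2)] assms
  by blast

lemma perfect_matchings_Un:
  assumes "A \<inter> B = {}" "M \<in> perfect_matchings A" "N \<in> perfect_matchings B"
  shows "M \<union> N \<in> perfect_matchings (A \<union> B)"
proof (rule perfect_matchingsI)
  note M = perfect_matchingsD[OF assms(2)] and N = perfect_matchingsD[OF assms(3)]
  show "e \<subseteq> A \<union> B" if "e \<in> M \<union> N" for e using that M(1) N(1) by blast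
  show "card e = 2" if "e \<in> M \<union> N" for e using that M(2) N(2) by blast
  show "\<exists>e\<in>M \<union> N. x \<in> e" if "x \<in> A \<union> B" for x using that M(3) N(3) by blast
  show "e = f" if "e \<in> M \<union> N" "f \<in> M \<union> N" "x \<in> e" "x \<in> f" for e f x
  proof -
    have "False" if "a \<in> M" "b \<in> N" "x \<in> a" "x \<in> b" for a b
      using M(1)[OF that(1)] N(1)[OF that(2)] that(3,4) assms(1) by blast
    then show ?thesis using that M(4)[of e f x] N(4)[of e f x] by blast
  qed
qed

text \<open>For a perfect matching this says that no edge crosses the boundary of \<open>T\<close>,
  so the matching splits into its parts inside and outside \<open>T\<close>.\<close>

definition closed_in :: "'a set \<Rightarrow> 'a set set \<Rightarrow> bool" where
  "closed_in T M \<longleftrightarrow> (\<forall>e\<in>M. e \<inter> T = {} \<or> e \<subseteq> T)"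

lemma perfect_matchings_restrict:
  assumes "M \<in> perfect_matchings S" "T \<subseteq> S" "closed_in T M"
  shows "M \<inter> Pow T \<in> perfect_matchings T"
proof (rule perfect_matchingsI)
  note M = perfect_matchingsD[OF assms(1)]
  show "\<exists>e\<in>M \<inter> Pow T. x \<in> e" if "x \<in> T" for x
    using that M(3)[of x] assms(2,3) unfolding closed_in_def by blast
qed (use perfect_matchingsD[OF assms(1)] in blast)+

lemma closed_in_Diff:
  "M \<in> perfect_matchings S \<Longrightarrow> closed_in T M \<Longrightarrow> closed_in U M \<Longrightarrow> closed_in (T - U) M"
  unfolding closed_in_def by blast

lemma closed_in_Int: "closed_in T M \<Longrightarrow> closed_in U M \<Longrightarrow> closed_in (T \<inter> U) M"
  unfolding closed_in_def by blast

lemma closed_in_UNIV: "M \<in> perfect_matchings S \<Longrightarrow> closed_in S M"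
  unfolding closed_in_def using perfect_matchingsD(1) by blast

lemma perfect_matchings_insert:
  assumes "M \<in> perfect_matchings (S - {x, y})" "x \<in> S" "y \<in> S" "x \<noteq> y"
  shows "insert {x, y} M \<in> perfect_matchings S"
proof -
  have "{{x, y}} \<in> perfect_matchings {x, y}"
    using assms(4) by (intro perfect_matchingsI) auto
  from perfect_matchings_Un[OF _ this assms(1)]
  have "{{x, y}} \<union> M \<in> perfect_matchings ({x, y} \<union> (S - {x, y}))" by blast
  also have "{x, y} \<union> (S - {x, y}) = S" using assms by blast
  finally show ?thesis by simp
qed

lemma perfect_matchings_remove:
  assumes "M \<in> perfect_matchings S" "{x, y} \<in> M"
  shows "M - {{x, y}} \<in> perfect_matchings (S - {x, y})"
proof -
  note M = perfect_matchingsD[OF assms(1)]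
  have cl: "closed_in (S - {x, y}) M"
    unfolding closed_in_def
  proof
    fix e assume e: "e \<in> M"
    show "e \<inter> (S - {x, y}) = {} \<or> e \<subseteq> S - {x, y}"
      using M(1)[OF e] M(4)[OF e assms(2), of x] M(4)[OF e assms(2), of y] by blast
  qed
  have "M \<inter> Pow (S - {x, y}) = M - {{x, y}}"
  proof (intro equalityI subsetI)
    fix e assume e: "e \<in> M - {{x, y}}"
    then show "e \<in> M \<inter> Pow (S - {x, y})"
      using M(1)[of e] M(4)[OF _ assms(2), of e x] M(4)[OF _ assms(2), of e y] by blast
  qed auto
  then show ?thesis
    using perfect_matchings_restrict[OF assms(1) _ cl] by simp
qed

section \<open>Matchings that avoid a set of forbidden edges\<close>

definition matchings_avoiding :: "'a set \<Rightarrow> 'a set set \<Rightarrow> 'a set set set" where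
  "matchings_avoiding S F = {M \<in> perfect_matchings S. M \<inter> F = {}}"

lemma finite_matchings_avoiding: "finite S \<Longrightarrow> finite (matchings_avoiding S F)"
  by (simp add: matchings_avoiding_def finite_perfect_matchings)

lemma card_matchings_avoiding_edge:
  assumes "x \<in> S" "y \<in> S" "x \<noteq> y" "{x, y} \<notin> F"
  shows "card {M \<in> matchings_avoiding S F. {x, y} \<in> M} = card (matchings_avoiding (S - {x, y}) F)"
proof (rule bij_betw_same_card)
  show "bij_betw (\<lambda>M. M - {{x, y}}) {M \<in> matchings_avoiding S F. {x, y} \<in> M}
          (matchings_avoiding (S - {x, y}) F)"
  proof (rule bij_betw_byWitness[where f' = "insert {x, y}"])
    show "(\<lambda>M. M - {{x, y}}) ` {M \<in> matchings_avoiding S F. {x, y} \<in> M}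
            \<subseteq> matchings_avoiding (S - {x, y}) F"
      by (auto simp: matchings_avoiding_def perfect_matchings_remove)
    show "insert {x, y} ` matchings_avoiding (S - {x, y}) F
            \<subseteq> {M \<in> matchings_avoiding S F. {x, y} \<in> M}"
      using assms by (auto simp: matchings_avoiding_def perfect_matchings_insert)
    show "\<forall>M\<in>matchings_avoiding (S - {x, y}) F. insert {x, y} M - {{x, y}} = M"
      using perfect_matchingsD(1) by (fastforce simp: matchings_avoiding_def)
  qed auto
qed

lemma card_matchings_avoiding_two_edges:
  assumes "x \<in> S" "y \<in> S" "u \<in> S" "v \<in> S" "distinct [x, y, u, v]" "{x, u} \<notin> F" "{y, v} \<notin> F"
  shows "card {M \<in> matchings_avoiding S F. {x, u} \<in> M \<and> {y, v} \<in> M} =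
         card (matchings_avoiding (S - {x, y} - {u, v}) F)"
proof -
  have "bij_betw (\<lambda>M. M - {{x, u}}) {M \<in> matchings_avoiding S F. {x, u} \<in> M \<and> {y, v} \<in> M}
          {M \<in> matchings_avoiding (S - {x, u}) F. {y, v} \<in> M}"
  proof (rule bij_betw_byWitness[where f' = "insert {x, u}"])
    show "(\<lambda>M. M - {{x, u}}) ` {M \<in> matchings_avoiding S F. {x, u} \<in> M \<and> {y, v} \<in> M}
            \<subseteq> {M \<in> matchings_avoiding (S - {x, u}) F. {y, v} \<in> M}"
      using assms(5) by (auto simp: matchings_avoiding_def perfect_matchings_remove doubleton_eq_iff)
    show "insert {x, u} ` {M \<in> matchings_avoiding (S - {x, u}) F. {y, v} \<in> M}
            \<subseteq> {M \<in> matchings_avoiding S F. {x, u} \<in> M \<and> {y, v} \<in> M}"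
      using assms by (auto simp: matchings_avoiding_def perfect_matchings_insert)
    show "\<forall>M\<in>{M \<in> matchings_avoiding (S - {x, u}) F. {y, v} \<in> M}. insert {x, u} M - {{x, u}} = M"
      using perfect_matchingsD(1) by (fastforce simp: matchings_avoiding_def)
  qed auto
  then have "card {M \<in> matchings_avoiding S F. {x, u} \<in> M \<and> {y, v} \<in> M} =
             card {M \<in> matchings_avoiding (S - {x, u}) F. {y, v} \<in> M}"
    by (rule bij_betw_same_card)
  also have "\<dots> = card (matchings_avoiding (S - {x, u} - {y, v}) F)"
    using assms by (intro card_matchings_avoiding_edge) auto
  also have "S - {x, u} - {y, v} = S - {x, y} - {u, v}" by blast
  finally show ?thesis .
qed

lemma sum_card_swap:
  assumes "finite A" "finite B"
  shows "(\<Sum>i\<in>A. card {j \<in> B. R i j}) = (\<Sum>j\<in>B. card {i \<in> A. R i j})"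
  by (rule sum_multicount_gen) (use assms in auto)

text \<open>Each edge occurs in both orientations, so taking the first point of an ordered edge is a
  bijection onto \<open>S\<close>.\<close>

lemma card_ordered_edges:
  assumes "M \<in> perfect_matchings S" "finite S"
  shows "card {p \<in> S \<times> S. {fst p, snd p} \<in> M} = card S"
proof (rule bij_betw_same_card)
  show "bij_betw fst {p \<in> S \<times> S. {fst p, snd p} \<in> M} S"
    unfolding bij_betw_def
  proof (intro conjI equalityI subsetI)
    show "inj_on fst {p \<in> S \<times> S. {fst p, snd p} \<in> M}"
      using perfect_matchings_unique[OF assms(1)] by (fastforce simp: inj_on_def prod_eq_iff)
    fix x assume x: "x \<in> S"
    then obtain y where "{x, y} \<in> M" using perfect_matchings_partner[OF assms(1)] by blast
    with perfect_matchings_edge[OF assms(1) this] show "x \<in> fst ` {p \<in> S \<times> S. {fst p, snd p} \<in> M}"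
      by (intro image_eqI[of _ _ "(x, y)"]) auto
  qed auto
qed

text \<open>A point of \<open>B\<close> spoils at most two ordered edges, one in which it comes
  first and one in which it comes second.\<close>

lemma card_ordered_edges_avoiding:
  assumes M: "M \<in> perfect_matchings S" and S: "finite S" and B: "B \<subseteq> S"
  shows "card S \<le> card {p \<in> (S - B) \<times> (S - B). {fst p, snd p} \<in> M} + 2 * card B"
proof -
  let ?E = "{p \<in> S \<times> S. {fst p, snd p} \<in> M}"
  have fin: "finite ?E" using S by auto
  have 1: "card {p \<in> ?E. fst p \<in> B} \<le> card B"
  proof (rule card_inj_on_le)
    show "inj_on fst {p \<in> ?E. fst p \<in> B}"
    proof (rule inj_onI)
      fix p q assume "p \<in> {p \<in> ?E. fst p \<in> B}" "q \<in> {p \<in> ?E. fst p \<in> B}" "fst p = fst q"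
      then have "{fst p, snd p} \<in> M" "{fst p, snd q} \<in> M" by auto
      with perfect_matchings_unique[OF M this] \<open>fst p = fst q\<close> show "p = q"
        by (simp add: prod_eq_iff)
    qed
  qed (use B S finite_subset in auto)
  have 2: "card {p \<in> ?E. snd p \<in> B} \<le> card B"
  proof (rule card_inj_on_le)
    show "inj_on snd {p \<in> ?E. snd p \<in> B}"
    proof (rule inj_onI)
      fix p q assume "p \<in> {p \<in> ?E. snd p \<in> B}" "q \<in> {p \<in> ?E. snd p \<in> B}" "snd p = snd q"
      then have "{snd p, fst p} \<in> M" "{snd p, fst q} \<in> M" by (auto simp: insert_commute)
      with perfect_matchings_unique[OF M this] \<open>snd p = snd q\<close> show "p = q"
        by (simp add: prod_eq_iff)
    qed
  qed (use B S finite_subset in auto)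
  have "?E \<subseteq> {p \<in> (S - B) \<times> (S - B). {fst p, snd p} \<in> M} \<union>
              ({p \<in> ?E. fst p \<in> B} \<union> {p \<in> ?E. snd p \<in> B})" by auto
  then have "card ?E \<le> card ({p \<in> (S - B) \<times> (S - B). {fst p, snd p} \<in> M} \<union>
              ({p \<in> ?E. fst p \<in> B} \<union> {p \<in> ?E. snd p \<in> B}))"
    by (intro card_mono) (use S in auto)
  also have "\<dots> \<le> card {p \<in> (S - B) \<times> (S - B). {fst p, snd p} \<in> M} +
              (card {p \<in> ?E. fst p \<in> B} + card {p \<in> ?E. snd p \<in> B})"
    by (meson card_Un_le add_left_mono le_trans)
  finally show ?thesis using 1 2 card_ordered_edges[OF M S] by linarith
qed

text \<open>If \<open>x\<close> and \<open>y\<close> are not matched to each other, they have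
  distinct partners u and v, and deleting both edges leaves a matching of
  \<open>S' - {u, v}\<close>. Deleting an edge between u and v from a matching of \<open>S'\<close>
  leaves the same kind of object, which is how the two switching bounds compare the counts.\<close>

lemma card_matchings_avoiding_not_edge:
  assumes S: "finite S" and xy: "x \<in> S" "y \<in> S" "x \<noteq> y"
  defines "S' \<equiv> S - {x, y}"
  shows "card {M \<in> matchings_avoiding S F. {x, y} \<notin> M} =
         (\<Sum>p\<in>{p \<in> S' \<times> S'. fst p \<noteq> snd p \<and> {x, fst p} \<notin> F \<and> {y, snd p} \<notin> F}.
            card (matchings_avoiding (S' - {fst p, snd p}) F))"
proof -
  let ?I = "{p \<in> S' \<times> S'. fst p \<noteq> snd p \<and> {x, fst p} \<notin> F \<and> {y, snd p} \<notin> F}"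
  let ?A = "{M \<in> matchings_avoiding S F. {x, y} \<notin> M}"
  have finA: "finite ?A" using finite_matchings_avoiding[OF S] by auto
  have finI: "finite ?I" using S by (auto simp: S'_def)
  have one: "card {p \<in> ?I. {x, fst p} \<in> M \<and> {y, snd p} \<in> M} = 1" if "M \<in> ?A" for M
  proof -
    have M: "M \<in> perfect_matchings S" and MF: "M \<inter> F = {}" and nxy: "{x, y} \<notin> M"
      using that by (auto simp: matchings_avoiding_def)
    from perfect_matchings_partner[OF M xy(1)] obtain u where u: "{x, u} \<in> M" by blast
    from perfect_matchings_partner[OF M xy(2)] obtain v where v: "{y, v} \<in> M" by blast
    have "u \<noteq> y" using u nxy by auto
    moreover have "v \<noteq> x" using v nxy by (auto simp: insert_commute)
    moreover have "u \<noteq> v"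
      using perfect_matchingsD(4)[OF M u v, of u] xy by (auto simp: doubleton_eq_iff)
    ultimately have mem: "(u, v) \<in> ?I"
      using perfect_matchings_edge[OF M u] perfect_matchings_edge[OF M v] u v MF
      by (auto simp: S'_def)
    have uniq: "p = (u, v)" if "{x, fst p} \<in> M" "{y, snd p} \<in> M" for p
      using perfect_matchings_unique[OF M that(1) u] perfect_matchings_unique[OF M that(2) v]
      by (simp add: prod_eq_iff)
    have "{p \<in> ?I. {x, fst p} \<in> M \<and> {y, snd p} \<in> M} = {(u, v)}"
    proof (rule equalityI)
      show "{(u, v)} \<subseteq> {p \<in> ?I. {x, fst p} \<in> M \<and> {y, snd p} \<in> M}"
        using mem u v by simp
    qed (use uniq in blast)
    then show ?thesis by simp
  qed
  have "card ?A = (\<Sum>M\<in>?A. card {p \<in> ?I. {x, fst p} \<in> M \<and> {y, snd p} \<in> M})"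
    using one by simp
  also have "\<dots> = (\<Sum>p\<in>?I. card {M \<in> ?A. {x, fst p} \<in> M \<and> {y, snd p} \<in> M})"
    by (rule sum_card_swap[OF finA finI])
  also have "\<dots> = (\<Sum>p\<in>?I. card (matchings_avoiding (S' - {fst p, snd p}) F))"
  proof (rule sum.cong[OF refl])
    fix p assume p: "p \<in> ?I"
    have eq: "{M \<in> ?A. {x, fst p} \<in> M \<and> {y, snd p} \<in> M} =
          {M \<in> matchings_avoiding S F. {x, fst p} \<in> M \<and> {y, snd p} \<in> M}"
    proof (intro equalityI subsetI; clarsimp)
      fix M assume M: "M \<in> matchings_avoiding S F" "{x, fst p} \<in> M" "{x, y} \<in> M"
      then have "fst p = y"
        using perfect_matchings_unique[of M S x] by (auto simp: matchings_avoiding_def)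
      with p show False by (auto simp: S'_def)
    qed
    have "fst p \<in> S" "snd p \<in> S" "distinct [x, y, fst p, snd p]" "{x, fst p} \<notin> F" "{y, snd p} \<notin> F"
      using p xy by (auto simp: S'_def)
    from card_matchings_avoiding_two_edges[OF xy(1,2) this]
    show "card {M \<in> ?A. {x, fst p} \<in> M \<and> {y, snd p} \<in> M} =
          card (matchings_avoiding (S' - {fst p, snd p}) F)"
      unfolding eq S'_def .
  qed
  finally show ?thesis .
qed

text \<open>The switching replaces the edge between x and y and another edge between u and v by edges
  from x to u and from y to v. The set B contains all u for which this may create an edge in F.\<close>

lemma card_matchings_avoiding_ge:
  assumes S: "finite S" and xy: "x \<in> S" "y \<in> S" "x \<noteq> y"
    and B: "B \<subseteq> S - {x, y}" "\<And>u. u \<in> S - {x, y} \<Longrightarrow> {x, u} \<in> F \<or> {y, u} \<in> F \<Longrightarrow> u \<in> B"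
  defines "S' \<equiv> S - {x, y}"
  shows "card S' * card (matchings_avoiding S' F) \<le>
         card {M \<in> matchings_avoiding S F. {x, y} \<notin> M} + 2 * card B * card (matchings_avoiding S' F)"
proof -
  let ?I = "{p \<in> S' \<times> S'. fst p \<noteq> snd p \<and> {x, fst p} \<notin> F \<and> {y, snd p} \<notin> F}"
  let ?J = "{p \<in> (S' - B) \<times> (S' - B). fst p \<noteq> snd p \<and> {fst p, snd p} \<notin> F}"
  let ?A = "matchings_avoiding S' F"
  have S': "finite S'" using S by (simp add: S'_def)
  have fin: "finite ?A" "finite ?J" "finite ?I" using finite_matchings_avoiding[OF S'] S' by auto
  have "card S' * card ?A = (\<Sum>M\<in>?A. card S')" by simp
  also have "\<dots> \<le> (\<Sum>M\<in>?A. card {p \<in> ?J. {fst p, snd p} \<in> M} + 2 * card B)"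
  proof (rule sum_mono)
    fix M assume M: "M \<in> ?A"
    have eq: "{p \<in> ?J. {fst p, snd p} \<in> M} = {p \<in> (S' - B) \<times> (S' - B). {fst p, snd p} \<in> M}"
      using M perfect_matchings_edge[of M S'] by (auto simp: matchings_avoiding_def)
    show "card S' \<le> card {p \<in> ?J. {fst p, snd p} \<in> M} + 2 * card B"
      unfolding eq using card_ordered_edges_avoiding[of M S' B] M B(1) S'
      by (auto simp: matchings_avoiding_def S'_def)
  qed
  also have "\<dots> = (\<Sum>M\<in>?A. card {p \<in> ?J. {fst p, snd p} \<in> M}) + 2 * card B * card ?A"
    by (simp add: sum.distrib)
  also have "(\<Sum>M\<in>?A. card {p \<in> ?J. {fst p, snd p} \<in> M}) =
             (\<Sum>p\<in>?J. card {M \<in> ?A. {fst p, snd p} \<in> M})"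
    by (rule sum_card_swap) (use fin in auto)
  also have "\<dots> = (\<Sum>p\<in>?J. card (matchings_avoiding (S' - {fst p, snd p}) F))"
    by (intro sum.cong card_matchings_avoiding_edge refl) auto
  also have "\<dots> \<le> (\<Sum>p\<in>?I. card (matchings_avoiding (S' - {fst p, snd p}) F))"
    by (rule sum_mono2[OF fin(3)]) (use B(2) in \<open>auto simp: S'_def\<close>)
  also have "\<dots> = card {M \<in> matchings_avoiding S F. {x, y} \<notin> M}"
    unfolding S'_def by (rule card_matchings_avoiding_not_edge[symmetric]) fact+
  finally show ?thesis by simp
qed

text \<open>The switching in reverse: edges from x to u and from y to v become one between x and y
  and one between u and v. It fails if the latter is forbidden; such pairs are collected in the last
  sum as an error term.\<close>

lemma card_matchings_avoiding_le:
  assumes S: "finite S" and xy: "x \<in> S" "y \<in> S" "x \<noteq> y"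
  defines "S' \<equiv> S - {x, y}"
  shows "card {M \<in> matchings_avoiding S F. {x, y} \<notin> M} \<le>
         card S' * card (matchings_avoiding S' F) +
         (\<Sum>p\<in>{p \<in> S' \<times> S'. fst p \<noteq> snd p \<and> {fst p, snd p} \<in> F}.
            card (matchings_avoiding (S' - {fst p, snd p}) F))"
proof -
  let ?I = "{p \<in> S' \<times> S'. fst p \<noteq> snd p \<and> {x, fst p} \<notin> F \<and> {y, snd p} \<notin> F}"
  let ?J = "{p \<in> S' \<times> S'. fst p \<noteq> snd p \<and> {fst p, snd p} \<notin> F}"
  let ?K = "{p \<in> S' \<times> S'. fst p \<noteq> snd p \<and> {fst p, snd p} \<in> F}"
  let ?A = "matchings_avoiding S' F"
  let ?f = "\<lambda>p. card (matchings_avoiding (S' - {fst p, snd p}) F)"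
  have S': "finite S'" using S by (simp add: S'_def)
  have fin: "finite ?A" "finite ?J" "finite ?K" "finite ?I"
    using finite_matchings_avoiding[OF S'] S' by auto
  have "card {M \<in> matchings_avoiding S F. {x, y} \<notin> M} = sum ?f ?I"
    unfolding S'_def by (rule card_matchings_avoiding_not_edge) fact+
  also have "\<dots> \<le> sum ?f (?J \<union> ?K)"
    by (rule sum_mono2) (use fin in auto)
  also have "\<dots> = sum ?f ?J + sum ?f ?K"
    by (rule sum.union_disjoint) (use fin in auto)
  also have "sum ?f ?J = (\<Sum>p\<in>?J. card {M \<in> ?A. {fst p, snd p} \<in> M})"
    by (intro sum.cong card_matchings_avoiding_edge[symmetric] refl) auto
  also have "\<dots> = (\<Sum>M\<in>?A. card {p \<in> ?J. {fst p, snd p} \<in> M})"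
    by (rule sum_card_swap) (use fin in auto)
  also have "\<dots> \<le> (\<Sum>M\<in>?A. card S')"
  proof (rule sum_mono)
    fix M assume M: "M \<in> ?A"
    have "card {p \<in> ?J. {fst p, snd p} \<in> M} \<le> card {p \<in> S' \<times> S'. {fst p, snd p} \<in> M}"
      by (rule card_mono) (use S' in auto)
    also have "\<dots> = card S'"
      by (rule card_ordered_edges) (use M S' in \<open>auto simp: matchings_avoiding_def\<close>)
    finally show "card {p \<in> ?J. {fst p, snd p} \<in> M} \<le> card S'" .
  qed
  also have "\<dots> = card S' * card ?A" by simp
  finally show ?thesis by simp
qed

lemma card_matchings_avoiding_split:
  assumes "finite S"
  shows "card (matchings_avoiding S F) =
         card {M \<in> matchings_avoiding S F. e \<in> M} + card {M \<in> matchings_avoiding S F. e \<notin> M}"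
proof -
  have "matchings_avoiding S F =
        {M \<in> matchings_avoiding S F. e \<in> M} \<union> {M \<in> matchings_avoiding S F. e \<notin> M}" by blast
  then show ?thesis
    using finite_matchings_avoiding[OF assms, of F]
    by (metis (no_types, lifting) card_Un_disjoint disjoint_iff finite_Un mem_Collect_eq)
qed

section \<open>The probability of having no loops\<close>

definition loops :: "'b set \<Rightarrow> ('b \<times> 'c) set set" where
  "loops W = {{x, y} |x y. x \<noteq> y \<and> fst x = fst y \<and> fst x \<in> W}"

lemma doubleton_in_loops: "{x, y} \<in> loops W \<longleftrightarrow> x \<noteq> y \<and> fst x = fst y \<and> fst x \<in> W"
  unfolding loops_def mem_Collect_eq doubleton_eq_iff by metis

definition bin :: "('b \<times> 'c) set \<Rightarrow> 'b \<Rightarrow> ('b \<times> 'c) set" where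
  "bin S v = {x \<in> S. fst x = v}"

lemma finite_bin: "finite S \<Longrightarrow> finite (bin S v)"
  by (simp add: bin_def)

lemma card_bin_mono: "finite T \<Longrightarrow> S \<subseteq> T \<Longrightarrow> card (bin S v) \<le> card (bin T v)"
  by (rule card_mono) (auto simp: bin_def)

text \<open>Only the bins in W are required to be free of loops, so that bins can be exposed one by one.\<close>

abbreviation loopless :: "('b \<times> 'c) set \<Rightarrow> 'b set \<Rightarrow> ('b \<times> 'c) set set set" where
  "loopless S W \<equiv> matchings_avoiding S (loops W)"

lemma card_minus_doubleton:
  assumes "finite S" "x \<in> S" "y \<in> S" "x \<noteq> y"
  shows "real (card (S - {x, y})) = real (card S) - 2"
proof -
  have "card {x, y} \<le> card S" by (rule card_mono) (use assms in auto)
  then show ?thesis using assms by (subst card_Diff_subset) auto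
qed

text \<open>No edge at \<open>x\<close> or \<open>y\<close> can be a forbidden loop, since their bin
  lies outside \<open>W\<close>, so the switching works with an empty bad set. It contributes m - 2,
  where m is \<open>card S\<close>, and the matchings that contain the edge contribute 1. Thus the
  edge has conditional probability at most 1 / (m - 1), its probability in a uniform
  matching.\<close>

lemma card_loopless_remove_outside:
  fixes S :: "('b \<times> 'c) set"
  assumes S: "finite S" and xy: "x \<in> S" "y \<in> S" "x \<noteq> y" and W: "fst x = fst y" "fst x \<notin> W"
  shows "(real (card S) - 1) * real (card (loopless (S - {x, y}) W)) \<le> real (card (loopless S W))"
proof -
  have n: "{x, y} \<notin> loops W" using W by (simp add: doubleton_in_loops)
  have "card (S - {x, y}) * card (loopless (S - {x, y}) W)
          \<le> card {M \<in> loopless S W. {x, y} \<notin> M} + 2 * card ({} :: ('b \<times> 'c) set) * card (loopless (S - {x, y}) W)"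
    by (rule card_matchings_avoiding_ge[OF S xy]) (use W in \<open>auto simp: doubleton_in_loops\<close>)
  then have "real (card (S - {x, y}) * card (loopless (S - {x, y}) W)) \<le>
      real (card {M \<in> loopless S W. {x, y} \<notin> M})" by (subst of_nat_le_iff) simp
  then show ?thesis
    using card_matchings_avoiding_split[OF S, of "loops W" "{x, y}"]
      card_matchings_avoiding_edge[OF xy n] card_minus_doubleton[OF S xy]
    by (simp add: algebra_simps)
qed

text \<open>Now the bin may belong to \<open>W\<close>: its at most \<open>D\<close> points are bad
  for the switching, and matchings that contain the edge are dropped. This cruder bound serves for
  the error term of \<open>card_loopless_le_remove\<close>.\<close>

lemma card_loopless_remove_inside:
  assumes S: "finite S" and xy: "x \<in> S" "y \<in> S" "x \<noteq> y" and W: "fst x = fst y"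
    and D: "\<And>v. card (bin S v) \<le> D"
  shows "(real (card S) - 2 - 2 * real D) * real (card (loopless (S - {x, y}) W))
           \<le> real (card (loopless S W))"
proof -
  let ?B = "bin (S - {x, y}) (fst x)"
  have "card (S - {x, y}) * card (loopless (S - {x, y}) W)
          \<le> card {M \<in> loopless S W. {x, y} \<notin> M} + 2 * card ?B * card (loopless (S - {x, y}) W)"
    by (rule card_matchings_avoiding_ge[OF S xy])
       (use W in \<open>auto simp: doubleton_in_loops bin_def\<close>)
  also have "card ?B \<le> D"
    using D[of "fst x"] card_bin_mono[OF S, of "S - {x, y}" "fst x"] by auto
  also have "card {M \<in> loopless S W. {x, y} \<notin> M} \<le> card (loopless S W)"
    by (rule card_mono) (use finite_matchings_avoiding[OF S] in auto)
  finally have "card (S - {x, y}) * card (loopless (S - {x, y}) W)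
          \<le> card (loopless S W) + 2 * D * card (loopless (S - {x, y}) W)" by simp
  then have "real (card (S - {x, y}) * card (loopless (S - {x, y}) W)) \<le>
      real (card (loopless S W) + 2 * D * card (loopless (S - {x, y}) W))"
    by (rule of_nat_mono)
  then show ?thesis
    using card_minus_doubleton[OF S xy] by (simp add: algebra_simps)
qed

text \<open>The reverse switching fails at pairs that form a loop, and each of these is controlled
  by \<open>card_loopless_remove_inside\<close>. Hence the edge has conditional probability at least
  1 / (m - 1 + 2 D), with m for \<open>card S\<close>.\<close>

lemma card_loopless_le_remove:
  assumes S: "finite S" and xy: "x \<in> S" "y \<in> S" "x \<noteq> y" and W: "fst x = fst y" "fst x \<notin> W"
    and D: "\<And>v. card (bin S v) \<le> D" and m: "8 + 4 * D \<le> card S"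
  shows "real (card (loopless S W)) \<le>
           (real (card S) - 1 + 2 * real D) * real (card (loopless (S - {x, y}) W))"
proof -
  let ?S' = "S - {x, y}" and ?m = "real (card S)" and ?D = "real D"
  let ?K = "{p \<in> ?S' \<times> ?S'. fst p \<noteq> snd p \<and> {fst p, snd p} \<in> loops W}"
  let ?a = "real (card (loopless ?S' W))"
  have S': "finite ?S'" using S by simp
  have m': "real (card ?S') = ?m - 2" by (rule card_minus_doubleton[OF S xy])
  have mD: "8 + 4 * ?D \<le> ?m" using m by (simp flip: of_nat_add of_nat_mult add: of_nat_mono)
  have D': "card (bin ?S' v) \<le> D" for v
    using D[of v] card_bin_mono[OF S, of ?S' v] by auto
  have n: "{x, y} \<notin> loops W" using W by (simp add: doubleton_in_loops)
  have each: "real (card (loopless (?S' - {fst p, snd p}) W)) \<le> ?a / (?m - 4 - 2 * ?D)"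
    if p: "p \<in> ?K" for p
  proof -
    have "(real (card ?S') - 2 - 2 * ?D) * real (card (loopless (?S' - {fst p, snd p}) W)) \<le> ?a"
      by (rule card_loopless_remove_inside[OF S' _ _ _ _ D'])
         (use p in \<open>auto simp: doubleton_in_loops\<close>)
    then show ?thesis using mD by (simp add: m' field_simps)
  qed
  \<comment> \<open>An ordered loop consists of a point and a point of its own bin, so there are at
    most (m - 2) D of them.\<close>
  have "?K \<subseteq> Sigma ?S' (\<lambda>u. bin ?S' (fst u))"
    by (auto simp: doubleton_in_loops bin_def)
  then have "card ?K \<le> card (Sigma ?S' (\<lambda>u. bin ?S' (fst u)))"
    by (intro card_mono finite_SigmaI finite_bin S')
  also have "\<dots> = (\<Sum>u\<in>?S'. card (bin ?S' (fst u)))"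
    by (rule card_SigmaI[OF S']) (blast intro: finite_bin[OF S'])
  also have "\<dots> \<le> (\<Sum>u\<in>?S'. D)" by (rule sum_mono) (rule D')
  finally have "card ?K \<le> card ?S' * D" by simp
  then have "real (card ?K) \<le> real (card ?S' * D)" by (rule of_nat_mono)
  then have K: "real (card ?K) \<le> (?m - 2) * ?D" by (simp add: m')
  have "real (card {M \<in> loopless S W. {x, y} \<notin> M}) \<le>
        real (card ?S' * card (loopless ?S' W) + (\<Sum>p\<in>?K. card (loopless (?S' - {fst p, snd p}) W)))"
    by (intro of_nat_mono card_matchings_avoiding_le[OF S xy])
  also have "\<dots> = (?m - 2) * ?a + (\<Sum>p\<in>?K. real (card (loopless (?S' - {fst p, snd p}) W)))"
    by (simp add: m')
  also have "(\<Sum>p\<in>?K. real (card (loopless (?S' - {fst p, snd p}) W))) \<le>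
             (\<Sum>p\<in>?K. ?a / (?m - 4 - 2 * ?D))"
    by (rule sum_mono) (rule each)
  also have "\<dots> = real (card ?K) * (?a / (?m - 4 - 2 * ?D))" by simp
  also have "\<dots> \<le> ((?m - 2) * ?D) * (?a / (?m - 4 - 2 * ?D))"
    by (rule mult_right_mono[OF K]) (use mD in auto)
  \<comment> \<open>The lower bound on \<open>card S\<close> makes (m - 2) / (m - 4 - 2 D) at most
    2; this is the 2 D of the statement.\<close>
  also have "\<dots> \<le> 2 * ?D * ?a"
  proof -
    have "((?m - 2) * ?D) * (?a / (?m - 4 - 2 * ?D)) = ((?m - 2) / (?m - 4 - 2 * ?D)) * (?D * ?a)"
      by simp
    also have "\<dots> \<le> 2 * (?D * ?a)"
      by (rule mult_right_mono) (use mD in \<open>auto simp: field_simps\<close>)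
    finally show ?thesis by simp
  qed
  finally show ?thesis
    using card_matchings_avoiding_split[OF S, of "loops W" "{x, y}"]
      card_matchings_avoiding_edge[OF xy n] by (simp add: algebra_simps)
qed

lemma card_offdiagonal:
  assumes "finite K"
  shows "card {p \<in> K \<times> K. fst p \<noteq> snd p} + card K = card K * card K"
proof -
  have "K \<times> K = {p \<in> K \<times> K. fst p \<noteq> snd p} \<union> (\<lambda>e. (e, e)) ` K" by auto
  then have "card (K \<times> K) = card ({p \<in> K \<times> K. fst p \<noteq> snd p} \<union> (\<lambda>e. (e, e)) ` K)"
    by (rule arg_cong)
  also have "\<dots> = card {p \<in> K \<times> K. fst p \<noteq> snd p} + card ((\<lambda>e. (e, e)) ` K)"
    by (rule card_Un_disjoint) (use assms in auto)
  also have "card ((\<lambda>e. (e, e)) ` K) = card K"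
    by (rule card_image) (auto simp: inj_on_def)
  finally show ?thesis by (simp add: card_cartesian_product)
qed

text \<open>With k the number of elements of \<open>L\<close> in a member of \<open>A\<close>, both
  claims hold pointwise: 1 \<le> [k = 0] + k and [k = 0] + k \<le> 1 + k (k - 1). The pairs are
  ordered, so the quadratic term is twice that of the usual inequality.\<close>

lemma Bonferroni:
  fixes A :: "'a set set"
  assumes A: "finite A" and L: "finite L"
  shows "card A \<le> card {M \<in> A. M \<inter> L = {}} + (\<Sum>e\<in>L. card {M \<in> A. e \<in> M})" (is ?th1)
    and "card {M \<in> A. M \<inter> L = {}} + (\<Sum>e\<in>L. card {M \<in> A. e \<in> M}) \<le>
         card A + (\<Sum>p\<in>{p \<in> L \<times> L. fst p \<noteq> snd p}. card {M \<in> A. fst p \<in> M \<and> snd p \<in> M})" (is ?th2)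
proof -
  let ?k = "\<lambda>M. card {e \<in> L. e \<in> M}" and ?P = "{p \<in> L \<times> L. fst p \<noteq> snd p}"
  have s: "(\<Sum>e\<in>L. card {M \<in> A. e \<in> M}) = (\<Sum>M\<in>A. ?k M)"
    by (rule sum_card_swap[OF L A])
  have "{M \<in> A. M \<inter> L = {}} = {M \<in> A. ?k M = 0}" using L by auto
  then have z: "card {M \<in> A. M \<inter> L = {}} = (\<Sum>M\<in>A. if ?k M = 0 then 1 else 0)"
    using A by (simp only: sum.inter_filter[symmetric]) simp
  have "(\<Sum>p\<in>?P. card {M \<in> A. fst p \<in> M \<and> snd p \<in> M}) =
        (\<Sum>M\<in>A. card {p \<in> ?P. fst p \<in> M \<and> snd p \<in> M})"
    by (rule sum_card_swap) (use A L in auto)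
  also have "\<dots> = (\<Sum>M\<in>A. ?k M * ?k M - ?k M)"
  proof (rule sum.cong[OF refl])
    fix M
    have "{p \<in> ?P. fst p \<in> M \<and> snd p \<in> M} =
          {p \<in> {e \<in> L. e \<in> M} \<times> {e \<in> L. e \<in> M}. fst p \<noteq> snd p}" by auto
    then show "card {p \<in> ?P. fst p \<in> M \<and> snd p \<in> M} = ?k M * ?k M - ?k M"
      using card_offdiagonal[of "{e \<in> L. e \<in> M}"] L by simp
  qed
  finally have q: "(\<Sum>p\<in>?P. card {M \<in> A. fst p \<in> M \<and> snd p \<in> M}) = (\<Sum>M\<in>A. ?k M * ?k M - ?k M)" .
  have c: "card A = (\<Sum>M\<in>A. 1)" by simp
  show ?th1
    unfolding s z c sum.distrib[symmetric] by (rule sum_mono) auto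
  have "(if k = 0 then 1 else 0) + k \<le> 1 + (k * k - k)" for k :: nat
  proof (cases "k \<le> 1")
    case True
    then show ?thesis by (cases k) auto
  next
    case False
    then have "2 * k \<le> k * k" by (intro mult_right_mono) auto
    then have "k \<le> k * k - k" by linarith
    then show ?thesis using False by simp
  qed
  then show ?th2
    unfolding s z c q sum.distrib[symmetric] by (intro sum_mono)
qed

text \<open>\<open>loops\<close> is not confined to the points of \<open>S\<close>. Within
  \<open>S\<close> the new condition concerns a finite set of edges, the form to which
  \<open>Bonferroni\<close> applies.\<close>

lemma loopless_insert:
  "loopless S (insert i W) = {M \<in> loopless S W. M \<inter> {e. e \<subseteq> bin S i \<and> card e = 2} = {}}"
proof -
  have "M \<inter> loops (insert i W) = {} \<longleftrightarrow>
        M \<inter> loops W = {} \<and> M \<inter> {e. e \<subseteq> bin S i \<and> card e = 2} = {}"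
    if M: "M \<in> perfect_matchings S" for M
  proof -
    have "e \<in> loops (insert i W) \<longleftrightarrow> e \<in> loops W \<or> e \<subseteq> bin S i \<and> card e = 2" if e: "e \<in> M" for e
    proof -
      from perfect_matchingsD(2)[OF M e] obtain x y where xy: "e = {x, y}" "x \<noteq> y"
        by (meson card_2_iff)
      show ?thesis using perfect_matchingsD(1)[OF M e] xy
        by (auto simp: doubleton_in_loops bin_def)
    qed
    then show ?thesis by blast
  qed
  then show ?thesis by (auto simp: matchings_avoiding_def)
qed

lemma doubleton_in_binE:
  assumes "e \<subseteq> bin S i" "card e = 2"
  obtains x y where "e = {x, y}" "x \<noteq> y" "x \<in> S" "y \<in> S" "fst x = i" "fst y = i"
proof -
  from assms(2) obtain x y where xy: "e = {x, y}" "x \<noteq> y" by (meson card_2_iff)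
  with assms(1) have "x \<in> bin S i" "y \<in> bin S i" by auto
  then show ?thesis using xy by (intro that[of x y]) (auto simp: bin_def)
qed

text \<open>A union bound over the pairs inside bin \<open>i\<close>, each of conditional
  probability at most 1 / (m - 1) by \<open>card_loopless_remove_outside\<close>.\<close>

lemma card_loopless_insert_ge:
  assumes S: "finite S" and i: "i \<notin> W" and m: "card S \<ge> 2"
  shows "real (card (loopless S W)) * (1 - real (card (bin S i) choose 2) / (real (card S) - 1))
           \<le> real (card (loopless S (insert i W)))"
proof -
  let ?L = "{e. e \<subseteq> bin S i \<and> card e = 2}" and ?m = "real (card S)"
  let ?a = "real (card (loopless S W))"
  have L: "finite ?L" by (rule finite_subset[of _ "Pow (bin S i)"]) (use finite_bin[OF S] in auto)
  have cL: "card ?L = card (bin S i) choose 2" by (rule n_subsets) (rule finite_bin[OF S])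
  have each: "real (card {M \<in> loopless S W. e \<in> M}) \<le> ?a / (?m - 1)" if "e \<in> ?L" for e
  proof -
    from that obtain x y where xy: "e = {x, y}" "x \<noteq> y" "x \<in> S" "y \<in> S" "fst x = i" "fst y = i"
      by (elim CollectE conjE doubleton_in_binE)
    have "card {M \<in> loopless S W. e \<in> M} = card (loopless (S - {x, y}) W)"
      unfolding xy(1) by (rule card_matchings_avoiding_edge) (use xy i in \<open>auto simp: doubleton_in_loops\<close>)
    moreover have "(?m - 1) * real (card (loopless (S - {x, y}) W)) \<le> ?a"
      by (rule card_loopless_remove_outside) (use xy i S in auto)
    ultimately show ?thesis using m by (simp add: field_simps)
  qed
  have "?a \<le> real (card {M \<in> loopless S W. M \<inter> ?L = {}} + (\<Sum>e\<in>?L. card {M \<in> loopless S W. e \<in> M}))"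
    by (intro of_nat_mono Bonferroni(1) finite_matchings_avoiding S L)
  also have "\<dots> = real (card (loopless S (insert i W))) +
      (\<Sum>e\<in>?L. real (card {M \<in> loopless S W. e \<in> M}))"
    by (simp add: loopless_insert)
  also have "(\<Sum>e\<in>?L. real (card {M \<in> loopless S W. e \<in> M})) \<le> (\<Sum>e\<in>?L. ?a / (?m - 1))"
    by (rule sum_mono) (rule each)
  finally show ?thesis by (simp add: cL algebra_simps)
qed

text \<open>The second Bonferroni inequality. Single pairs are bounded below by
  \<open>card_loopless_le_remove\<close>; two disjoint pairs are bounded above by applying
  \<open>card_loopless_remove_outside\<close> twice, the second time with m - 2 points.\<close>

lemma card_loopless_insert_le:
  assumes S: "finite S" and i: "i \<notin> W"
    and D: "\<And>v. card (bin S v) \<le> D" and m: "8 + 4 * D \<le> card S"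
  defines "b \<equiv> real (card (bin S i) choose 2)"
  shows "real (card (loopless S (insert i W))) \<le> real (card (loopless S W)) *
     (1 - b / (real (card S) - 1 + 2 * real D) + b\<^sup>2 / ((real (card S) - 1) * (real (card S) - 3)))"
proof -
  let ?L = "{e. e \<subseteq> bin S i \<and> card e = 2}" and ?m = "real (card S)" and ?D = "real D"
  let ?a = "real (card (loopless S W))"
  let ?P = "{p \<in> ?L \<times> ?L. fst p \<noteq> snd p}"
  have L: "finite ?L" by (rule finite_subset[of _ "Pow (bin S i)"]) (use finite_bin[OF S] in auto)
  have cL: "card ?L = card (bin S i) choose 2" by (rule n_subsets) (rule finite_bin[OF S])
  have mD: "8 + 4 * ?D \<le> ?m" using m by (simp flip: of_nat_add of_nat_mult add: of_nat_mono)
  have one: "real (card {M \<in> loopless S W. e \<in> M}) \<ge> ?a / (?m - 1 + 2 * ?D)" if "e \<in> ?L" for e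
  proof -
    from that obtain x y where xy: "e = {x, y}" "x \<noteq> y" "x \<in> S" "y \<in> S" "fst x = i" "fst y = i"
      by (elim CollectE conjE doubleton_in_binE)
    have "card {M \<in> loopless S W. e \<in> M} = card (loopless (S - {x, y}) W)"
      unfolding xy(1) by (rule card_matchings_avoiding_edge) (use xy i in \<open>auto simp: doubleton_in_loops\<close>)
    moreover have "?a \<le> (?m - 1 + 2 * ?D) * real (card (loopless (S - {x, y}) W))"
      by (rule card_loopless_le_remove) (use xy i S D m in auto)
    ultimately show ?thesis using mD by (simp add: field_simps)
  qed
  have two: "real (card {M \<in> loopless S W. fst p \<in> M \<and> snd p \<in> M}) \<le> ?a / ((?m - 1) * (?m - 3))"
    if "p \<in> ?P" for p
  proof (cases "fst p \<inter> snd p = {}")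
    \<comment> \<open>Two different pairs that share a point cannot both lie in a matching.\<close>
    case False
    have "{M \<in> loopless S W. fst p \<in> M \<and> snd p \<in> M} = {}"
    proof (rule ccontr)
      assume "{M \<in> loopless S W. fst p \<in> M \<and> snd p \<in> M} \<noteq> {}"
      then obtain M where "M \<in> perfect_matchings S" "fst p \<in> M" "snd p \<in> M"
        by (auto simp: matchings_avoiding_def)
      with False perfect_matchingsD(4)[OF this] that show False by auto
    qed
    then show ?thesis using mD by (simp only:) simp
  next
    case True
    from that have "fst p \<in> ?L" "snd p \<in> ?L" by auto
    then obtain x u y v where xu: "fst p = {x, u}" "x \<noteq> u" "x \<in> S" "u \<in> S" "fst x = i" "fst u = i"
      and yv: "snd p = {y, v}" "y \<noteq> v" "y \<in> S" "v \<in> S" "fst y = i" "fst v = i"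
      by (elim CollectE conjE doubleton_in_binE)
    have dist: "distinct [x, y, u, v]" using True xu yv by auto
    have "card {M \<in> loopless S W. fst p \<in> M \<and> snd p \<in> M} = card (loopless (S - {x, y} - {u, v}) W)"
      unfolding xu(1) yv(1)
      by (rule card_matchings_avoiding_two_edges) (use xu yv i dist in \<open>auto simp: doubleton_in_loops\<close>)
    also have "S - {x, y} - {u, v} = S - {x, u} - {y, v}" by blast
    finally have c: "card {M \<in> loopless S W. fst p \<in> M \<and> snd p \<in> M} =
      card (loopless (S - {x, u} - {y, v}) W)" .
    have "(?m - 1) * real (card (loopless (S - {x, u}) W)) \<le> ?a"
      by (rule card_loopless_remove_outside) (use xu i S in auto)
    moreover have "(real (card (S - {x, u})) - 1) * real (card (loopless (S - {x, u} - {y, v}) W))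
        \<le> real (card (loopless (S - {x, u}) W))"
      by (rule card_loopless_remove_outside) (use xu yv i S dist in auto)
    then have "(?m - 1) * ((?m - 3) * real (card (loopless (S - {x, u} - {y, v}) W))) \<le>
      (?m - 1) * real (card (loopless (S - {x, u}) W))"
      using card_minus_doubleton[OF S xu(3,4,2)] mD by (intro mult_left_mono) auto
    ultimately have "real (card (loopless (S - {x, u} - {y, v}) W)) * ((?m - 1) * (?m - 3)) \<le> ?a"
      by (simp add: mult.assoc mult.commute)
    then show ?thesis unfolding c by (subst pos_le_divide_eq) (use mD in auto)
  qed
  have "card ?P \<le> card ?L * card ?L"
    using card_offdiagonal[OF L] by linarith
  then have "real (card ?P) \<le> real (card ?L * card ?L)" by (rule of_nat_mono)
  then have P: "real (card ?P) \<le> b\<^sup>2" unfolding cL b_def by (simp add: power2_eq_square)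
  have "real (card (loopless S (insert i W))) + b * (?a / (?m - 1 + 2 * ?D)) =
        real (card (loopless S (insert i W))) + (\<Sum>e\<in>?L. ?a / (?m - 1 + 2 * ?D))"
    by (simp add: cL b_def)
  also have "\<dots> \<le> real (card (loopless S (insert i W))) +
      (\<Sum>e\<in>?L. real (card {M \<in> loopless S W. e \<in> M}))"
    by (intro add_left_mono sum_mono one)
  also have "\<dots> = real (card {M \<in> loopless S W. M \<inter> ?L = {}} + (\<Sum>e\<in>?L. card {M \<in> loopless S W. e \<in> M}))"
    by (simp add: loopless_insert)
  also have "\<dots> \<le> real (card (loopless S W) + (\<Sum>p\<in>?P. card {M \<in> loopless S W. fst p \<in> M \<and> snd p \<in> M}))"
    by (intro of_nat_mono Bonferroni(2) finite_matchings_avoiding S L)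
  also have "\<dots> = ?a + (\<Sum>p\<in>?P. real (card {M \<in> loopless S W. fst p \<in> M \<and> snd p \<in> M}))" by simp
  also have "(\<Sum>p\<in>?P. real (card {M \<in> loopless S W. fst p \<in> M \<and> snd p \<in> M})) \<le>
      (\<Sum>p\<in>?P. ?a / ((?m - 1) * (?m - 3)))"
    by (rule sum_mono) (rule two)
  also have "\<dots> = real (card ?P) * (?a / ((?m - 1) * (?m - 3)))" by simp
  also have "\<dots> \<le> b\<^sup>2 * (?a / ((?m - 1) * (?m - 3)))"
    by (rule mult_right_mono[OF P]) (use mD in auto)
  finally show ?thesis by (simp add: algebra_simps)
qed

section \<open>The number of perfect matchings, and all bins together\<close>

text \<open>This is the double factorial (k - 1)!! for even k, and 0 for odd k.\<close>

fun matching_count :: "nat \<Rightarrow> nat" where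
  "matching_count 0 = 1"
| "matching_count (Suc 0) = 0"
| "matching_count (Suc (Suc k)) = Suc k * matching_count k"

lemma card_perfect_matchings:
  "finite S \<Longrightarrow> card (perfect_matchings S) = matching_count (card S)"
proof (induction "card S" arbitrary: S rule: less_induct)
  case less
  show ?case
  proof (cases "S = {}")
    case True
    have "perfect_matchings S = {{}}"
      unfolding True perfect_matchings_def by (auto simp: card_2_iff)
    then show ?thesis using True by simp
  next
    case False
    then obtain x where x: "x \<in> S" by blast
    have MA: "perfect_matchings S = matchings_avoiding S {}" for S :: "'a set"
      by (simp add: matchings_avoiding_def)
    have fin: "finite (perfect_matchings S)" using less.prems by (rule finite_perfect_matchings)
    have "card {y \<in> S - {x}. {x, y} \<in> M} = 1" if M: "M \<in> perfect_matchings S" for M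
    proof -
      from perfect_matchings_partner[OF M x] obtain y where y: "{x, y} \<in> M" by blast
      have "{y \<in> S - {x}. {x, y} \<in> M} = {y}"
        using perfect_matchings_unique[OF M y] perfect_matchings_edge[OF M y] y by blast
      then show ?thesis by simp
    qed
    then have "card (perfect_matchings S) = (\<Sum>M\<in>perfect_matchings S. card {y \<in> S - {x}. {x, y} \<in> M})"
      by simp
    also have "\<dots> = (\<Sum>y\<in>S - {x}. card {M \<in> perfect_matchings S. {x, y} \<in> M})"
      by (rule sum_card_swap) (use less.prems fin in auto)
    also have "\<dots> = (\<Sum>y\<in>S - {x}. matching_count (card S - 2))"
    proof (rule sum.cong[OF refl])
      fix y assume y: "y \<in> S - {x}"
      have "card {M \<in> perfect_matchings S. {x, y} \<in> M} = card (perfect_matchings (S - {x, y}))"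
        unfolding MA by (rule card_matchings_avoiding_edge) (use x y in auto)
      also have "\<dots> = matching_count (card (S - {x, y}))"
        by (rule less.hyps) (use less.prems x y in \<open>auto intro!: psubset_card_mono\<close>)
      also have "card (S - {x, y}) = card S - 2"
        using x y less.prems by (subst card_Diff_subset) auto
      finally show "card {M \<in> perfect_matchings S. {x, y} \<in> M} = matching_count (card S - 2)" .
    qed
    also have "\<dots> = (card S - 1) * matching_count (card S - 2)"
      using less.prems x by simp
    also have "\<dots> = matching_count (card S)"
      using less.prems x by (cases "card S" rule: matching_count.cases) auto
    finally show ?thesis .
  qed
qed

lemma loops_empty [simp]: "loops {} = {}" by (auto simp: loops_def)

lemma card_matchings_avoiding_empty:
  "finite S \<Longrightarrow> card (matchings_avoiding S {}) = matching_count (card S)"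
  by (simp add: matchings_avoiding_def card_perfect_matchings)

text \<open>The bounds for single bins are multiplied. The condition on the binomial coefficients
  keeps the factors nonnegative, so that the induction hypothesis can be multiplied by them.\<close>

lemma card_loopless_ge:
  assumes S: "finite S" and m: "card S \<ge> 2" and "finite W"
    and "\<And>v. v \<in> W \<Longrightarrow> real (card (bin S v) choose 2) \<le> real (card S) - 1"
  shows "real (matching_count (card S)) *
           (\<Prod>v\<in>W. 1 - real (card (bin S v) choose 2) / (real (card S) - 1)) \<le> real (card (loopless S W))"
  using assms(3,4)
proof (induction W rule: finite_induct)
  case empty
  then show ?case using S by (simp add: card_matchings_avoiding_empty)
next
  case (insert i W)
  let ?c = "\<lambda>v. 1 - real (card (bin S v) choose 2) / (real (card S) - 1)"
  have "real (matching_count (card S)) * prod ?c (insert i W) =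
        (real (matching_count (card S)) * prod ?c W) * ?c i"
    using insert.hyps by simp
  also have "\<dots> \<le> real (card (loopless S W)) * ?c i"
    by (rule mult_right_mono[OF insert.IH]) (use insert.prems[of i] insert.prems m in auto)
  also have "\<dots> \<le> real (card (loopless S (insert i W)))"
    by (rule card_loopless_insert_ge[OF S insert.hyps(2) m])
  finally show ?case .
qed

text \<open>Each factor 1 + c is replaced by exp c, which is positive for either sign of c, so the
  induction hypothesis can be multiplied by it.\<close>

lemma card_loopless_le:
  assumes S: "finite S" and D: "\<And>v. card (bin S v) \<le> D" and m: "8 + 4 * D \<le> card S" and "finite W"
  shows "real (card (loopless S W)) \<le> real (matching_count (card S)) *
     exp (\<Sum>v\<in>W. (real (card (bin S v) choose 2))\<^sup>2 / ((real (card S) - 1) * (real (card S) - 3)) -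
        real (card (bin S v) choose 2) / (real (card S) - 1 + 2 * real D))"
  using assms(4)
proof (induction W rule: finite_induct)
  case empty
  then show ?case using S by (simp add: card_matchings_avoiding_empty)
next
  case (insert i W)
  let ?c = "\<lambda>v. (real (card (bin S v) choose 2))\<^sup>2 / ((real (card S) - 1) * (real (card S) - 3)) -
        real (card (bin S v) choose 2) / (real (card S) - 1 + 2 * real D)"
  have "real (card (loopless S (insert i W))) \<le> real (card (loopless S W)) * (1 + ?c i)"
    using card_loopless_insert_le[OF S insert.hyps(2) D m] by (simp add: algebra_simps)
  also have "\<dots> \<le> real (card (loopless S W)) * exp (?c i)"
    by (intro mult_left_mono exp_ge_add_one_self) auto
  also have "\<dots> \<le> (real (matching_count (card S)) * exp (sum ?c W)) * exp (?c i)"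
    by (intro mult_right_mono insert.IH) auto
  also have "\<dots> = real (matching_count (card S)) * exp (sum ?c (insert i W))"
    using insert.hyps by (simp add: exp_add[symmetric])
  finally show ?case .
qed

section \<open>Couplings\<close>

lemma pmf_of_weights:
  fixes w :: "'b \<Rightarrow> real"
  assumes "finite \<Omega>" "\<And>y. y \<in> \<Omega> \<Longrightarrow> 0 \<le> w y" "sum w \<Omega> = 1"
  shows "\<exists>r. \<forall>y. pmf r y = (if y \<in> \<Omega> then w y else 0)"
proof -
  let ?f = "\<lambda>y. if y \<in> \<Omega> then w y else 0"
  have "(\<integral>\<^sup>+y. ennreal (?f y) \<partial>count_space UNIV) = (\<Sum>y\<in>\<Omega>. ennreal (?f y))"
    by (rule nn_integral_count_space') (use assms in auto)
  also have "\<dots> = ennreal (\<Sum>y\<in>\<Omega>. ?f y)"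
    by (rule sum_ennreal) (use assms in auto)
  also have "\<dots> = 1" using assms(3) by simp
  finally have "pmf (embed_pmf ?f) y = ?f y" for y
    by (intro pmf_embed_pmf) (use assms in auto)
  then show ?thesis by blast
qed

text \<open>Given z drawn from \<^term>\<open>\<kappa>\<close>, a maximal coupling keeps \<^term>\<open>snd z\<close> with probability
  \<^term>\<open>a (snd z)\<close> and otherwise draws from the normalised excess of q over the law of
  \<^term>\<open>snd z\<close>.\<close>

lemma coupling_of_matched_sample:
  fixes \<kappa> :: "('a \<times> 'b) pmf" and q :: "'b pmf"
  assumes fin: "finite \<Omega>" and k\<Omega>: "set_pmf (map_pmf snd \<kappa>) \<subseteq> \<Omega>" and q\<Omega>: "set_pmf q \<subseteq> \<Omega>"
    and fg: "\<And>z. z \<in> set_pmf \<kappa> \<Longrightarrow> f (fst z) = g (snd z)"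
  shows "\<exists>\<mu>. is_coupling \<mu> (map_pmf fst \<kappa>) q \<and>
     1 - (\<Sum>y\<in>\<Omega>. \<bar>pmf (map_pmf snd \<kappa>) y - pmf q y\<bar>) / 2 \<le> measure_pmf.prob \<mu> {(x, y). f x = g y}"
proof -
  define p where "p = map_pmf snd \<kappa>"
  define m where "m = (\<lambda>y. min (pmf p y) (pmf q y))"
  define s where "s = sum m \<Omega>"
  have p1: "sum (pmf p) \<Omega> = 1" and q1: "sum (pmf q) \<Omega> = 1"
    using fin k\<Omega> q\<Omega> by (auto intro!: sum_pmf_eq_1 simp: p_def)
  have "s = (\<Sum>y\<in>\<Omega>. (pmf p y + pmf q y - \<bar>pmf p y - pmf q y\<bar>) / 2)"
    unfolding s_def m_def by (intro sum.cong refl) (simp add: min_def abs_if)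
  also have "\<dots> = (sum (pmf p) \<Omega> + sum (pmf q) \<Omega> - (\<Sum>y\<in>\<Omega>. \<bar>pmf p y - pmf q y\<bar>)) / 2"
    by (simp add: sum_subtractf sum.distrib sum_divide_distrib[symmetric])
  finally have s: "s = 1 - (\<Sum>y\<in>\<Omega>. \<bar>pmf p y - pmf q y\<bar>) / 2"
    using p1 q1 by (simp add: field_simps)
  have m_le: "m y \<le> pmf p y" "m y \<le> pmf q y" "0 \<le> m y" for y by (auto simp: m_def)
  have s_le: "s \<le> 1" using sum_mono[of \<Omega> m "pmf q"] m_le q1 by (simp add: s_def)
  have out: "pmf p y = 0" "pmf q y = 0" if "y \<notin> \<Omega>" for y
    using that k\<Omega> q\<Omega> unfolding p_def[symmetric] by (meson set_pmf_iff subsetD)+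
  obtain r where r: "(1 - s) * pmf r y = pmf q y - m y" for y
  \<comment> \<open>For s = 1 the excess of \<open>q\<close> vanishes and cannot be normalised; any
    law may then stand for \<open>r\<close>.\<close>
  proof (cases "s = 1")
    case True
    have "(\<Sum>y\<in>\<Omega>. pmf q y - m y) = 0" using True q1 by (simp add: sum_subtractf s_def)
    then have "\<forall>y\<in>\<Omega>. pmf q y - m y = 0"
      using m_le by (subst (asm) sum_nonneg_eq_0_iff[OF fin]) auto
    then have "pmf q y - m y = 0" for y
      using out[of y] by (cases "y \<in> \<Omega>") (auto simp: m_def)
    then show ?thesis using True by (intro that[of q]) simp
  next
    case False
    have "\<exists>r. \<forall>y. pmf r y = (if y \<in> \<Omega> then (pmf q y - m y) / (1 - s) else 0)"
    proof (rule pmf_of_weights[OF fin])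
      show "(\<Sum>y\<in>\<Omega>. (pmf q y - m y) / (1 - s)) = 1"
        using False q1 by (simp add: sum_divide_distrib[symmetric] sum_subtractf s_def)
    qed (use s_le m_le in auto)
    then obtain r where "\<And>y. pmf r y = (if y \<in> \<Omega> then (pmf q y - m y) / (1 - s) else 0)" by blast
    then show ?thesis using False out by (intro that[of r]) (auto simp: m_def)
  qed
  \<comment> \<open>Where \<open>pmf p y\<close> is 0, division yields 0, so \<open>a y\<close> is a
    probability for every y.\<close>
  define a where "a = (\<lambda>y. m y / pmf p y)"
  have a: "0 \<le> a y" "a y \<le> 1" for y
    using m_le[of y] pmf_nonneg[of p y] by (auto simp: a_def divide_le_eq_1)
  have pa: "pmf p y * a y = m y" for y
    using m_le[of y] by (cases "pmf p y = 0") (auto simp: a_def)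
  define K where "K = (\<lambda>y. bind_pmf (bernoulli_pmf (a y)) (\<lambda>b. if b then return_pmf y else r))"
  define \<mu> where "\<mu> = bind_pmf \<kappa> (\<lambda>z. map_pmf (Pair (fst z)) (K (snd z)))"
  have pmfK: "pmf (K y) x = a y * indicator {x} y + (1 - a y) * pmf r x" for x y
    using a[of y] by (simp add: K_def pmf_bind indicator_def mult.commute)
  have "map_pmf fst \<mu> = map_pmf fst \<kappa>"
    by (simp add: \<mu>_def map_bind_pmf pmf.map_comp o_def map_pmf_def[symmetric])
  moreover have "map_pmf snd \<mu> = q"
  proof (rule pmf_eqI)
    fix x
    have "map_pmf snd \<mu> = bind_pmf p K"
      by (simp add: \<mu>_def map_bind_pmf pmf.map_comp o_def p_def bind_map_pmf)
    then have "pmf (map_pmf snd \<mu>) x = (\<integral>y. pmf (K y) x \<partial>measure_pmf p)"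
      by (simp add: pmf_bind)
    also have "\<dots> = (\<Sum>y\<in>\<Omega>. pmf (K y) x * pmf p y)"
      by (rule integral_measure_pmf_real[OF fin]) (use k\<Omega> in \<open>auto simp: p_def\<close>)
    also have "\<dots> = (\<Sum>y\<in>\<Omega>. m y * indicator {x} y + (pmf p y - m y) * pmf r x)"
    proof (rule sum.cong[OF refl])
      fix y
      have "pmf (K y) x * pmf p y =
          (pmf p y * a y) * indicator {x} y + (pmf p y - pmf p y * a y) * pmf r x"
        unfolding pmfK by (simp add: algebra_simps)
      then show "pmf (K y) x * pmf p y = m y * indicator {x} y + (pmf p y - m y) * pmf r x"
        by (simp only: pa)
    qed
    also have "\<dots> = (\<Sum>y\<in>\<Omega>. m y * indicator {x} y) + (1 - s) * pmf r x"
      by (simp add: sum.distrib sum_distrib_right[symmetric] sum_subtractf p1 s_def)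
    also have "(\<Sum>y\<in>\<Omega>. m y * indicator {x} y) = m x"
      using out[of x] fin by (cases "x \<in> \<Omega>") (auto simp: indicator_def m_def if_distrib cong: if_cong)
    finally show "pmf (map_pmf snd \<mu>) x = pmf q x" using r by simp
  qed
  moreover have "s \<le> measure_pmf.prob \<mu> {(x, y). f x = g y}"
  proof -
    let ?t = "\<lambda>z. f (fst z) = g (snd z)"
    have "s = (\<Sum>y\<in>\<Omega>. a y * pmf p y)" unfolding s_def
      by (intro sum.cong refl) (simp add: pa[symmetric])
    also have "\<dots> = (\<integral>y. a y \<partial>measure_pmf p)"
      by (rule integral_measure_pmf_real[symmetric, OF fin]) (use k\<Omega> in \<open>auto simp: p_def\<close>)
    also have "\<dots> = (\<integral>z. a (snd z) \<partial>measure_pmf \<kappa>)" by (simp add: p_def)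
    \<comment> \<open>If \<open>snd z\<close> is kept, then f and g agree by \<open>fg\<close>;
      agreement after a redraw can only increase the probability.\<close>
    also have "\<dots> \<le> (\<integral>z. pmf (map_pmf (\<lambda>y. f (fst z) = g y) (K (snd z))) True \<partial>measure_pmf \<kappa>)"
    proof (rule integral_mono_AE)
      show "AE z in measure_pmf \<kappa>. a (snd z) \<le> pmf (map_pmf (\<lambda>y. f (fst z) = g y) (K (snd z))) True"
      proof (rule AE_pmfI)
        fix z assume z: "z \<in> set_pmf \<kappa>"
        have "a (snd z) \<le> pmf (K (snd z)) (snd z)"
          using a[of "snd z"] by (simp add: pmfK)
        also have "\<dots> = measure_pmf.prob (K (snd z)) {snd z}"
          by (simp add: measure_pmf_single)
        also have "\<dots> \<le> pmf (map_pmf (\<lambda>y. f (fst z) = g y) (K (snd z))) True"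
          unfolding pmf_map by (rule measure_pmf.finite_measure_mono) (use fg[OF z] in auto)
        finally show "a (snd z) \<le> pmf (map_pmf (\<lambda>y. f (fst z) = g y) (K (snd z))) True" .
      qed
    qed (auto intro!: measure_pmf.integrable_const_bound[where B = 1] simp: a pmf_le_1)
    also have "\<dots> = pmf (map_pmf ?t \<mu>) True"
      by (simp add: \<mu>_def map_bind_pmf pmf.map_comp o_def pmf_bind)
    also have "\<dots> = measure_pmf.prob \<mu> {(x, y). f x = g y}"
      by (simp add: pmf_map vimage_def case_prod_unfold)
    finally show ?thesis .
  qed
  ultimately show ?thesis unfolding is_coupling_def s p_def by blast
qed

section \<open>The superposition model as a reweighted configuration model\<close>

lemma perfect_matchings_image:
  assumes g: "inj_on g S" and M: "M \<in> perfect_matchings S"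
  shows "(`) g ` M \<in> perfect_matchings (g ` S)"
proof (rule perfect_matchingsI)
  note D = perfect_matchingsD[OF M]
  fix e assume "e \<in> (`) g ` M"
  then obtain e' where e': "e' \<in> M" "e = g ` e'" by blast
  then show "e \<subseteq> g ` S" using D(1) by blast
  show "card e = 2"
    using e' D(1,2)[of e'] card_image[of g e'] inj_on_subset[OF g] by simp
next
  fix x assume "x \<in> g ` S"
  then obtain y e where "y \<in> e" "e \<in> M" "x = g y"
    using perfect_matchingsD(3)[OF M] by (meson imageE)
  then show "\<exists>e\<in>(`) g ` M. x \<in> e" by (intro bexI[of _ "g ` e"]) auto
next
  note D = perfect_matchingsD[OF M]
  fix e f x assume "e \<in> (`) g ` M" "f \<in> (`) g ` M" and x: "x \<in> e" "x \<in> f"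
  then obtain e' f' where e': "e' \<in> M" "e = g ` e'" and f': "f' \<in> M" "f = g ` f'" by blast
  from x(1) obtain y where y: "y \<in> e'" "g y = x" unfolding e'(2) by blast
  from x(2) obtain z where z: "z \<in> f'" "g z = x" unfolding f'(2) by blast
  note yz = y(1) z(1) y(2) z(2)
  then have "y = z" using g D(1)[OF e'(1)] D(1)[OF f'(1)] by (auto dest: inj_onD)
  then show "e = f" using D(4)[OF e'(1) f'(1), of y] yz e' f' by simp
qed

lemma perfect_matchings_image_eq:
  assumes "inj_on g S"
  shows "perfect_matchings (g ` S) = (\<lambda>M. (`) g ` M) ` perfect_matchings S"
proof (intro equalityI subsetI)
  fix N assume N: "N \<in> perfect_matchings (g ` S)"
  let ?h = "inv_into S g"
  have "(`) ?h ` N \<in> perfect_matchings (?h ` g ` S)"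
    by (rule perfect_matchings_image[OF inj_on_inv_into N]) simp
  moreover have "?h ` g ` S = S" using assms by (rule inv_into_image_cancel) simp
  moreover have "(`) g ` (`) ?h ` N = N"
  proof -
    have "g ` ?h ` e = e" if "e \<in> N" for e
      using perfect_matchingsD(1)[OF N that] by (rule image_inv_into_cancel[OF refl])
    then show ?thesis by (simp add: image_image)
  qed
  ultimately show "N \<in> (\<lambda>M. (`) g ` M) ` perfect_matchings S"
    by (metis imageI)
qed (use perfect_matchings_image[OF assms] in blast)

lemma inj_on_image_perfect_matchings:
  assumes "inj_on g S"
  shows "inj_on (\<lambda>M. (`) g ` M) (perfect_matchings S)"
proof (rule inj_onI)
  fix M N assume M: "M \<in> perfect_matchings S" and N: "N \<in> perfect_matchings S"
    and eq: "(`) g ` M = (`) g ` N"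
  have "inj_on ((`) g) (Pow S)" by (rule inj_on_image_Pow[OF assms])
  moreover have "M \<subseteq> Pow S" "N \<subseteq> Pow S"
    using perfect_matchingsD(1)[OF M] perfect_matchingsD(1)[OF N] by auto
  ultimately show "M = N" using eq by (simp add: inj_on_image_eq_iff)
qed

abbreviation pairings :: "nat \<Rightarrow> nat \<Rightarrow> (nat \<times> nat) set set set" where
  "pairings n k \<equiv> loopless (points n k) {..<n}"

lemma finite_points [simp]: "finite (points n k)" and card_points [simp]: "card (points n k) = n * k"
  by (auto simp: points_def card_cartesian_product)

lemma finite_pairings [simp]: "finite (pairings n k)"
  by (simp add: finite_matchings_avoiding)

lemma no_bin_pair_iff:
  assumes P: "P \<in> perfect_matchings (points n k)"
  shows "no_bin_pair P \<longleftrightarrow> P \<inter> loops {..<n} = {}"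
proof
  assume *: "no_bin_pair P"
  show "P \<inter> loops {..<n} = {}"
  proof (rule ccontr)
    assume "P \<inter> loops {..<n} \<noteq> {}"
    then obtain x y where xy: "{x, y} \<in> P" "x \<noteq> y" "fst x = fst y" unfolding loops_def by blast
    then show False using *[unfolded no_bin_pair_def, rule_format, OF xy(1), of x y] by simp
  qed
next
  assume *: "P \<inter> loops {..<n} = {}"
  show "no_bin_pair P"
    unfolding no_bin_pair_def
  proof (intro ballI impI, rule ccontr)
    fix e x y assume e: "e \<in> P" "x \<in> e" "y \<in> e" "fst x = fst y" "x \<noteq> y"
    then have "e = {x, y}"
      using perfect_matchingsD(2)[OF P e(1)] by (auto simp: card_2_iff)
    moreover have "fst x \<in> {..<n}"
      using perfect_matchingsD(1)[OF P e(1)] e(2) by (auto simp: points_def)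
    ultimately have "e \<in> loops {..<n}" using e by (simp add: doubleton_in_loops)
    then show False using * e(1) by blast
  qed
qed

lemma Pstar_eq: "Pstar n k = pmf_of_set (pairings n k)"
  unfolding Pstar_def matchings_avoiding_def using no_bin_pair_iff
  by (intro arg_cong[of _ _ pmf_of_set]) blast

definition transversal :: "nat \<Rightarrow> (nat \<Rightarrow> nat) \<Rightarrow> (nat \<times> nat) set" where
  "transversal n c = (\<lambda>v. (v, c v)) ` {..<n}"

lemma mem_transversal: "x \<in> transversal n c \<longleftrightarrow> fst x < n \<and> snd x = c (fst x)"
  by (cases x) (auto simp: transversal_def)

lemma finite_transversal [simp]: "finite (transversal n c)"
  by (simp add: transversal_def)

lemma card_transversal [simp]: "card (transversal n c) = n"
  unfolding transversal_def by (subst card_image) (auto simp: inj_on_def)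

lemma inj_on_fst_transversal: "inj_on fst (transversal n c)"
  by (auto simp: inj_on_def transversal_def)

text \<open>A selection of one point per bin is encoded by the index \<^term>\<open>c v\<close> of the point selected in
  bin v.\<close>

definition colourings :: "nat \<Rightarrow> nat \<Rightarrow> (nat \<Rightarrow> nat) set" where
  "colourings n k = {..<n} \<rightarrow>\<^sub>E {..<k}"

lemma finite_colourings [simp]: "finite (colourings n k)"
  by (simp add: colourings_def finite_PiE)

lemma card_colourings [simp]: "card (colourings n k) = k ^ n"
  by (simp add: colourings_def card_PiE)

lemma colouringsD: "c \<in> colourings n k \<Longrightarrow> v < n \<Longrightarrow> c v < k"
  by (auto simp: colourings_def)

lemma transversal_subset: "c \<in> colourings n k \<Longrightarrow> transversal n c \<subseteq> points n k"
  by (auto simp: transversal_def points_def colouringsD)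

definition matched :: "nat \<Rightarrow> nat \<Rightarrow> (nat \<Rightarrow> nat) \<Rightarrow> (nat \<times> nat) set set set" where
  "matched n k c = {Q \<in> pairings n k. closed_in (transversal n c) Q}"

lemma perfect_matchings_Int_Pow:
  assumes "A \<in> perfect_matchings U" "U \<inter> T = {}"
  shows "A \<inter> Pow U = A" "A \<inter> Pow T = {}"
proof -
  note D = perfect_matchingsD[OF assms(1)]
  show "A \<inter> Pow U = A" using D(1) by blast
  have "e \<noteq> {}" if "e \<in> A" for e using D(2)[OF that] by auto
  then show "A \<inter> Pow T = {}" using D(1) assms(2) by blast
qed

text \<open>A matching that does not cross the boundary of \<open>T\<close> is the union of its
  traces on \<open>U\<close> and \<open>T\<close>. The trace on \<open>T\<close> is automatically
  loopless because \<open>T\<close> has at most one point per bin.\<close>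

lemma bij_betw_matchings_Un:
  assumes UT: "U \<inter> T = {}" and T: "inj_on fst T"
  shows "bij_betw (\<lambda>p. fst p \<union> snd p) (loopless U W \<times> perfect_matchings T)
           {Q \<in> loopless (U \<union> T) W. closed_in T Q}"
proof (rule bij_betw_byWitness[where f' = "\<lambda>Q. (Q \<inter> Pow U, Q \<inter> Pow T)"])
  have TU: "T \<inter> U = {}" using UT by blast
  show "\<forall>p\<in>loopless U W \<times> perfect_matchings T.
          ((fst p \<union> snd p) \<inter> Pow U, (fst p \<union> snd p) \<inter> Pow T) = p"
    using perfect_matchings_Int_Pow[OF _ UT] perfect_matchings_Int_Pow[OF _ TU]
    by (simp add: matchings_avoiding_def Int_Un_distrib2 prod_eq_iff mem_Times_iff)
  show "\<forall>Q\<in>{Q \<in> loopless (U \<union> T) W. closed_in T Q}.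
          fst (Q \<inter> Pow U, Q \<inter> Pow T) \<union> snd (Q \<inter> Pow U, Q \<inter> Pow T) = Q"
  proof
    fix Q assume Q: "Q \<in> {Q \<in> loopless (U \<union> T) W. closed_in T Q}"
    have "e \<subseteq> U \<or> e \<subseteq> T" if "e \<in> Q" for e
      using Q that perfect_matchingsD(1)[of Q "U \<union> T" e]
      unfolding closed_in_def matchings_avoiding_def by blast
    then show "fst (Q \<inter> Pow U, Q \<inter> Pow T) \<union> snd (Q \<inter> Pow U, Q \<inter> Pow T) = Q" by auto
  qed
  show "(\<lambda>p. fst p \<union> snd p) ` (loopless U W \<times> perfect_matchings T)
          \<subseteq> {Q \<in> loopless (U \<union> T) W. closed_in T Q}"
  proof (rule image_subsetI)
    fix p assume "p \<in> loopless U W \<times> perfect_matchings T"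
    then have A: "fst p \<in> perfect_matchings U" "fst p \<inter> loops W = {}"
      and B: "snd p \<in> perfect_matchings T"
      by (auto simp: matchings_avoiding_def)
    have "snd p \<inter> loops W = {}"
    proof (rule ccontr)
      assume "snd p \<inter> loops W \<noteq> {}"
      then obtain x y where xy: "{x, y} \<in> snd p" "x \<noteq> y" "fst x = fst y" unfolding loops_def by blast
      then show False using perfect_matchings_edge[OF B xy(1)] T by (auto dest: inj_onD)
    qed
    moreover have "closed_in T (fst p \<union> snd p)"
      unfolding closed_in_def using perfect_matchingsD(1)[OF A(1)] perfect_matchingsD(1)[OF B] UT
      by blast
    ultimately show "fst p \<union> snd p \<in> {Q \<in> loopless (U \<union> T) W. closed_in T Q}"
      using perfect_matchings_Un[OF UT A(1) B] A(2)
      by (simp add: matchings_avoiding_def Int_Un_distrib2)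
  qed
  show "(\<lambda>Q. (Q \<inter> Pow U, Q \<inter> Pow T)) ` {Q \<in> loopless (U \<union> T) W. closed_in T Q}
          \<subseteq> loopless U W \<times> perfect_matchings T"
  proof (rule image_subsetI)
    fix Q assume Q: "Q \<in> {Q \<in> loopless (U \<union> T) W. closed_in T Q}"
    then have M: "Q \<in> perfect_matchings (U \<union> T)" and Ql: "Q \<inter> loops W = {}" and cl: "closed_in T Q"
      by (auto simp: matchings_avoiding_def)
    have "closed_in ((U \<union> T) - T) Q"
      by (rule closed_in_Diff[OF M closed_in_UNIV[OF M] cl])
    moreover have "(U \<union> T) - T = U" using UT by blast
    ultimately have "Q \<inter> Pow U \<in> perfect_matchings U"
      by (intro perfect_matchings_restrict[OF M]) auto
    moreover have "Q \<inter> Pow T \<in> perfect_matchings T"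
      by (rule perfect_matchings_restrict[OF M _ cl]) auto
    ultimately show "(Q \<inter> Pow U, Q \<inter> Pow T) \<in> loopless U W \<times> perfect_matchings T"
      using Ql by (auto simp: matchings_avoiding_def)
  qed
qed

lemma lift_matching_bij:
  "bij_betw (lift_matching d) (perfect_matchings {..<n}) (perfect_matchings (transversal n (\<lambda>_. d)))"
proof -
  have inj: "inj_on (\<lambda>v. (v, d)) {..<n}" by (auto simp: inj_on_def)
  have "lift_matching d = (\<lambda>M. (`) (\<lambda>v. (v, d)) ` M)" by (simp add: lift_matching_def fun_eq_iff)
  then show ?thesis
    using inj_on_image_perfect_matchings[OF inj] perfect_matchings_image_eq[OF inj]
    by (simp add: bij_betw_def transversal_def)
qed

lemma points_Suc: "points n (Suc d) = points n d \<union> transversal n (\<lambda>_. d)"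
  by (auto simp: points_def transversal_def)

lemma bij_betw_superpose:
  "bij_betw (\<lambda>p. fst p \<union> lift_matching d (snd p)) (pairings n d \<times> perfect_matchings {..<n})
     (matched n (Suc d) (\<lambda>_. d))"
proof -
  have "bij_betw (map_prod id (lift_matching d)) (pairings n d \<times> perfect_matchings {..<n})
          (pairings n d \<times> perfect_matchings (transversal n (\<lambda>_. d)))"
    by (rule bij_betw_map_prod) (auto simp: lift_matching_bij)
  moreover have "bij_betw (\<lambda>p. fst p \<union> snd p)
     (pairings n d \<times> perfect_matchings (transversal n (\<lambda>_. d))) (matched n (Suc d) (\<lambda>_. d))"
    unfolding matched_def points_Suc
    by (rule bij_betw_matchings_Un[OF _ inj_on_fst_transversal]) (auto simp: points_def transversal_def)
  ultimately have "bij_betw ((\<lambda>p. fst p \<union> snd p) \<circ> map_prod id (lift_matching d))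
     (pairings n d \<times> perfect_matchings {..<n}) (matched n (Suc d) (\<lambda>_. d))"
    by (rule bij_betw_trans)
  then show ?thesis by (simp add: o_def)
qed

lemma pmf_of_set_Times:
  assumes "finite A" "A \<noteq> {}" "finite B" "B \<noteq> {}"
  shows "pair_pmf (pmf_of_set A) (pmf_of_set B) = pmf_of_set (A \<times> B)"
proof (rule pmf_eqI)
  fix z
  have "A \<times> B \<noteq> {}" "finite (A \<times> B)" using assms by auto
  then show "pmf (pair_pmf (pmf_of_set A) (pmf_of_set B)) z = pmf (pmf_of_set (A \<times> B)) z"
    using assms by (cases z) (simp add: pmf_pair indicator_times card_cartesian_product)
qed

text \<open>Two independent uniform samples are uniform on the product, and superposition is a
  bijection from it. Nonemptiness matters because \<open>pmf_of_set\<close> is unspecified on the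
  empty set.\<close>

lemma Pstar_plus_M1_eq:
  assumes "pairings n d \<noteq> {}" "perfect_matchings {..<n} \<noteq> {}"
  shows "Pstar_plus_M1 n d = pmf_of_set (matched n (Suc d) (\<lambda>_. d))"
proof -
  have "Pstar_plus_M1 n d =
        map_pmf (\<lambda>p. fst p \<union> lift_matching d (snd p)) (pair_pmf (Pstar n d) (M1 n))"
    by (simp add: Pstar_plus_M1_def pair_pmf_def map_bind_pmf map_pmf_def bind_assoc_pmf bind_return_pmf)
  also have "pair_pmf (Pstar n d) (M1 n) = pmf_of_set (pairings n d \<times> perfect_matchings {..<n})"
    unfolding Pstar_eq M1_def using assms by (intro pmf_of_set_Times) (auto simp: finite_perfect_matchings)
  also have "map_pmf (\<lambda>p. fst p \<union> lift_matching d (snd p)) \<dots> = pmf_of_set (matched n (Suc d) (\<lambda>_. d))"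
    by (rule map_pmf_of_set_bij_betw[OF bij_betw_superpose])
       (use assms in \<open>auto simp: finite_perfect_matchings\<close>)
  finally show ?thesis .
qed

section \<open>Relabelling the points within the bins\<close>

text \<open>In bin v the index \<open>d\<close> of the added point is exchanged with
  \<open>c v\<close>. Being built from transpositions, the map is its own inverse and exchanges the
  transversal of the added points with that of \<open>c\<close>.\<close>

definition relabel :: "nat \<Rightarrow> (nat \<Rightarrow> nat) \<Rightarrow> nat \<times> nat \<Rightarrow> nat \<times> nat" where
  "relabel d c x = (fst x, Transposition.transpose d (c (fst x)) (snd x))"

lemma fst_relabel [simp]: "fst (relabel d c x) = fst x"
  by (simp add: relabel_def)

lemma relabel_relabel [simp]: "relabel d c (relabel d c x) = x"
  by (simp add: relabel_def)

lemma inj_relabel: "inj (relabel d c)"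
  by (rule inj_on_inverseI[where g = "relabel d c"]) simp

lemma relabel_points:
  assumes "c \<in> colourings n (Suc d)"
  shows "relabel d c ` points n (Suc d) = points n (Suc d)"
proof -
  have *: "relabel d c x \<in> points n (Suc d)" if "x \<in> points n (Suc d)" for x
    using that colouringsD[OF assms, of "fst x"]
    by (cases x) (auto simp: relabel_def points_def Transposition.transpose_def)
  show ?thesis
  proof (intro equalityI subsetI)
    fix x assume "x \<in> points n (Suc d)"
    then show "x \<in> relabel d c ` points n (Suc d)"
      using * by (intro image_eqI[of _ _ "relabel d c x"]) simp_all
  qed (use * in blast)
qed

lemma relabel_transversal:
  "relabel d c ` transversal n (\<lambda>_. d) = transversal n c"
  "relabel d c ` transversal n c = transversal n (\<lambda>_. d)"
  by (auto simp: transversal_def image_image relabel_def)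

text \<open>With \<open>b\<close> and \<open>b'\<close> left general, both directions of
  \<open>bij_betw_relabel\<close> are instances.\<close>

lemma image_relabel_matched:
  assumes c: "c \<in> colourings n (Suc d)" and Q: "Q \<in> matched n (Suc d) b"
    and b: "relabel d c ` transversal n b = transversal n b'"
  shows "(`) (relabel d c) ` Q \<in> matched n (Suc d) b'"
proof -
  let ?g = "relabel d c"
  from Q have Q: "Q \<in> perfect_matchings (points n (Suc d))" "Q \<inter> loops {..<n} = {}"
      "closed_in (transversal n b) Q"
    by (auto simp: matched_def matchings_avoiding_def)
  have "inj_on ?g (points n (Suc d))" by (rule inj_on_subset[OF inj_relabel]) simp
  from perfect_matchings_image[OF this Q(1)]
  have "(`) ?g ` Q \<in> perfect_matchings (points n (Suc d))"
    unfolding relabel_points[OF c] .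
  moreover have "(`) ?g ` Q \<inter> loops {..<n} = {}"
  proof (rule ccontr)
    assume "(`) ?g ` Q \<inter> loops {..<n} \<noteq> {}"
    then obtain e where "e \<in> Q" "?g ` e \<in> loops {..<n}" by blast
    then obtain x y where e: "e \<in> Q" "?g ` e = {x, y}" "x \<noteq> y" "fst x = fst y" "fst x \<in> {..<n}"
      unfolding loops_def by blast
    have "e = ?g ` ?g ` e" by (simp add: image_image)
    then have "e = {?g x, ?g y}" using e(2) by simp
    moreover have "?g x \<noteq> ?g y" using e(3) inj_relabel by (metis relabel_relabel)
    ultimately have "e \<in> loops {..<n}" using e(4,5) by (simp add: doubleton_in_loops)
    then show False using Q(2) e(1) by blast
  qed
  moreover have "closed_in (transversal n b') ((`) ?g ` Q)"
    unfolding closed_in_def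
  proof
    fix e' assume "e' \<in> (`) ?g ` Q"
    then obtain e where e: "e \<in> Q" "e' = ?g ` e" by blast
    from Q(3) e(1) have "e \<inter> transversal n b = {} \<or> e \<subseteq> transversal n b"
      unfolding closed_in_def by blast
    then have "?g ` (e \<inter> transversal n b) = {} \<or> ?g ` e \<subseteq> ?g ` transversal n b" by blast
    then show "e' \<inter> transversal n b' = {} \<or> e' \<subseteq> transversal n b'"
      unfolding image_Int[OF inj_relabel] b e(2) .
  qed
  ultimately show ?thesis by (simp add: matched_def matchings_avoiding_def)
qed

lemma bij_betw_relabel:
  assumes c: "c \<in> colourings n (Suc d)"
  shows "bij_betw ((`) ((`) (relabel d c))) (matched n (Suc d) (\<lambda>_. d)) (matched n (Suc d) c)"
proof (rule bij_betw_byWitness[where f' = "(`) ((`) (relabel d c))"])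
  show "(`) ((`) (relabel d c)) ` matched n (Suc d) (\<lambda>_. d) \<subseteq> matched n (Suc d) c"
    by (rule image_subsetI) (rule image_relabel_matched[OF c _ relabel_transversal(1)])
  show "(`) ((`) (relabel d c)) ` matched n (Suc d) c \<subseteq> matched n (Suc d) (\<lambda>_. d)"
    by (rule image_subsetI) (rule image_relabel_matched[OF c _ relabel_transversal(2)])
qed (simp_all add: image_image)

lemma multigraph_relabel: "multigraph ((`) (relabel d c) ` Q) = multigraph Q"
proof -
  have "inj ((`) (relabel d c))" by (rule inj_on_inverseI[where g = "(`) (relabel d c)"]) (simp add: image_image)
  then have "inj_on ((`) (relabel d c)) Q" by (rule inj_on_subset) simp
  from image_mset_mset_set[OF this, symmetric] show ?thesis
    by (simp add: multigraph_def image_mset.compositionality o_def image_image)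
qed


lemma card_matched:
  assumes "c \<in> colourings n (Suc d)"
  shows "card (matched n (Suc d) c) = card (pairings n d) * matching_count n"
proof -
  have "card (matched n (Suc d) c) = card (matched n (Suc d) (\<lambda>_. d))"
    by (rule bij_betw_same_card[symmetric, OF bij_betw_relabel[OF assms]])
  also have "\<dots> = card (pairings n d \<times> perfect_matchings {..<n})"
    by (rule bij_betw_same_card[symmetric, OF bij_betw_superpose])
  finally show ?thesis by (simp add: card_cartesian_product card_perfect_matchings)
qed

lemma finite_matched [simp]: "finite (matched n k c)"
  by (simp add: matched_def)

lemma sum_sqrt_card:
  fixes w :: "'a \<Rightarrow> real"
  assumes "finite \<Omega>"
  shows "(\<Sum>y\<in>\<Omega>. \<bar>w y\<bar>) \<le> sqrt (real (card \<Omega>) * (\<Sum>y\<in>\<Omega>. (w y)\<^sup>2))"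
proof (rule real_le_rsqrt)
  have "(\<Sum>y\<in>\<Omega>. \<bar>w y\<bar> * 1)\<^sup>2 \<le> (\<Sum>y\<in>\<Omega>. \<bar>w y\<bar>\<^sup>2) * (\<Sum>y\<in>\<Omega>. 1\<^sup>2)"
    by (rule Cauchy_Schwarz_ineq_sum)
  then show "(\<Sum>y\<in>\<Omega>. \<bar>w y\<bar>)\<^sup>2 \<le> real (card \<Omega>) * (\<Sum>y\<in>\<Omega>. (w y)\<^sup>2)"
    by (simp add: mult.commute)
qed

text \<open>Let X(P) be the number of selections under which P is closed. The relabelled
  superposition gives P the weight X(P) / A, where A is the sum of all X(P), and \<open>Z\<close> is
  the sum of X(P)^2. By Cauchy-Schwarz the l1 distance to the uniform law on N pairings is at most
  the root of the chi-square distance N Z / A^2 - 1.\<close>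

lemma coupling_second_moment:
  fixes n d :: nat
  defines "C \<equiv> colourings n (Suc d)"
  defines "Z \<equiv> \<Sum>c\<in>C. \<Sum>c'\<in>C. card (matched n (Suc d) c \<inter> matched n (Suc d) c')"
  assumes ne: "pairings n d \<noteq> {}" "perfect_matchings {..<n} \<noteq> {}"
  shows "\<exists>\<mu>. is_coupling \<mu> (Pstar_plus_M1 n d) (Pstar n (Suc d)) \<and>
     1 - sqrt (real (card (pairings n (Suc d))) * real Z /
           (real (Suc d ^ n) * real (card (pairings n d)) * real (matching_count n))\<^sup>2 - 1) / 2
       \<le> measure_pmf.prob \<mu> {(P, P'). multigraph P = multigraph P'}"
proof -
  let ?\<Omega> = "pairings n (Suc d)" and ?m = "matched n (Suc d)"
  define L where "L = real (card (pairings n d)) * real (matching_count n)"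
  define N where "N = real (card ?\<Omega>)"
  define A where "A = real (Suc d ^ n) * L"
  \<comment> \<open>The second component is a relabelling of the first by a uniformly random
    \<open>c\<close>, so the two have the same multigraph.\<close>
  define \<kappa> where "\<kappa> = bind_pmf (pmf_of_set C)
     (\<lambda>c. map_pmf (\<lambda>Q. (Q, (`) (relabel d c) ` Q)) (Pstar_plus_M1 n d))"
  have finC: "finite C" and cC: "card C = Suc d ^ n" by (simp_all add: C_def)
  have neC: "C \<noteq> {}" using cC by fastforce
  have "card (pairings n d) > 0" "matching_count n > 0"
    using ne card_perfect_matchings[of "{..<n}"] finite_perfect_matchings[of "{..<n}"]
    by (auto simp: card_gt_0_iff)
  then have L: "L > 0" by (simp add: L_def)
  then have A: "A > 0" unfolding A_def by (intro mult_pos_pos) simp_all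
  have cm: "real (card (?m c)) = L" if "c \<in> C" for c
    using card_matched[of c n d] that by (simp add: L_def C_def)
  have nem: "?m c \<noteq> {}" if "c \<in> C" for c
    using cm[OF that] L by auto
  have sub: "?m c \<subseteq> ?\<Omega>" for c by (auto simp: matched_def)
  have N: "N > 0"
  proof -
    obtain c where "c \<in> C" using neC by blast
    then have "?\<Omega> \<noteq> {}" using nem sub by blast
    then show ?thesis by (simp add: N_def card_gt_0_iff)
  qed
  have fst\<kappa>: "map_pmf fst \<kappa> = Pstar_plus_M1 n d"
    by (simp add: \<kappa>_def map_bind_pmf pmf.map_comp o_def)
  have snd\<kappa>: "map_pmf snd \<kappa> = bind_pmf (pmf_of_set C) (\<lambda>c. pmf_of_set (?m c))"
  proof -
    have "map_pmf snd \<kappa> =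
          bind_pmf (pmf_of_set C) (\<lambda>c. map_pmf ((`) ((`) (relabel d c))) (Pstar_plus_M1 n d))"
      by (simp add: \<kappa>_def map_bind_pmf pmf.map_comp o_def)
    also have "\<dots> = bind_pmf (pmf_of_set C) (\<lambda>c. pmf_of_set (?m c))"
    proof (rule bind_pmf_cong[OF refl])
      fix c assume "c \<in> set_pmf (pmf_of_set C)"
      then have c: "c \<in> C" using finC neC by simp
      have "?m (\<lambda>_. d) \<noteq> {}"
        using nem[OF c] bij_betw_relabel[of c n d] c by (auto simp: C_def bij_betw_def)
      then show "map_pmf ((`) ((`) (relabel d c))) (Pstar_plus_M1 n d) = pmf_of_set (?m c)"
        unfolding Pstar_plus_M1_eq[OF ne]
        by (intro map_pmf_of_set_bij_betw bij_betw_relabel) (use c in \<open>auto simp: C_def\<close>)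
    qed
    finally show ?thesis .
  qed
  have pmf\<kappa>: "pmf (map_pmf snd \<kappa>) P = real (card {c \<in> C. P \<in> ?m c}) / A" for P
  proof -
    have "pmf (map_pmf snd \<kappa>) P = (\<Sum>c\<in>C. pmf (pmf_of_set (?m c)) P) / real (card C)"
      unfolding snd\<kappa> pmf_bind by (rule integral_pmf_of_set[OF neC finC])
    also have "(\<Sum>c\<in>C. pmf (pmf_of_set (?m c)) P) = (\<Sum>c\<in>C. indicator (?m c) P / L)"
      by (intro sum.cong refl) (simp add: nem cm)
    also have "\<dots> = (\<Sum>c\<in>C. if P \<in> ?m c then 1 else 0) / L"
      unfolding sum_divide_distrib by (intro sum.cong refl) (simp add: indicator_def)
    also have "(\<Sum>c\<in>C. if P \<in> ?m c then 1 else (0::real)) = real (card {c \<in> C. P \<in> ?m c})"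
      using finC by (simp flip: sum.inter_filter)
    finally show ?thesis by (simp add: A_def cC mult.commute)
  qed
  have qP: "pmf (Pstar n (Suc d)) P = 1 / N" if "P \<in> ?\<Omega>" for P
    unfolding Pstar_eq using that by (subst pmf_of_set) (auto simp: N_def)
  have sub\<kappa>: "set_pmf (map_pmf snd \<kappa>) \<subseteq> ?\<Omega>"
    unfolding snd\<kappa> using finC neC nem sub by auto
  have subq: "set_pmf (Pstar n (Suc d)) \<subseteq> ?\<Omega>"
  proof -
    have "?\<Omega> \<noteq> {}" using N by (auto simp: N_def)
    then show ?thesis unfolding Pstar_eq by (subst set_pmf_of_set) auto
  qed
  have same: "multigraph (fst z) = multigraph (snd z)" if "z \<in> set_pmf \<kappa>" for z
    using that by (auto simp: \<kappa>_def multigraph_relabel)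
  let ?w = "\<lambda>P. pmf (map_pmf snd \<kappa>) P - pmf (Pstar n (Suc d)) P"
  have sum1: "sum (pmf (map_pmf snd \<kappa>)) ?\<Omega> = 1"
    by (rule sum_pmf_eq_1[OF finite_pairings sub\<kappa>])
  have Zeq: "real Z = (\<Sum>P\<in>?\<Omega>. (real (card {c \<in> C. P \<in> ?m c}))\<^sup>2)"
  proof -
    have "Z = (\<Sum>p\<in>C \<times> C. card (?m (fst p) \<inter> ?m (snd p)))"
      by (simp add: Z_def sum.cartesian_product case_prod_unfold)
    also have "\<dots> = (\<Sum>p\<in>C \<times> C. card {P \<in> ?\<Omega>. P \<in> ?m (fst p) \<and> P \<in> ?m (snd p)})"
      using sub by (intro sum.cong refl arg_cong[of _ _ card]) blast
    also have "\<dots> = (\<Sum>P\<in>?\<Omega>. card {p \<in> C \<times> C. P \<in> ?m (fst p) \<and> P \<in> ?m (snd p)})"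
      by (rule sum_card_swap) (use finC in auto)
    also have "\<dots> = (\<Sum>P\<in>?\<Omega>. (card {c \<in> C. P \<in> ?m c})\<^sup>2)"
    proof (rule sum.cong[OF refl])
      fix P
      have "{p \<in> C \<times> C. P \<in> ?m (fst p) \<and> P \<in> ?m (snd p)} = {c \<in> C. P \<in> ?m c} \<times> {c \<in> C. P \<in> ?m c}"
        by auto
      then show "card {p \<in> C \<times> C. P \<in> ?m (fst p) \<and> P \<in> ?m (snd p)} = (card {c \<in> C. P \<in> ?m c})\<^sup>2"
        by (simp add: card_cartesian_product power2_eq_square)
    qed
    finally show ?thesis by simp
  qed
  have "(\<Sum>P\<in>?\<Omega>. (?w P)\<^sup>2) =
        (\<Sum>P\<in>?\<Omega>. (pmf (map_pmf snd \<kappa>) P)\<^sup>2 - 2 / N * pmf (map_pmf snd \<kappa>) P + 1 / N\<^sup>2)"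
    by (intro sum.cong refl) (simp add: qP power2_diff power_divide)
  also have "\<dots> = (\<Sum>P\<in>?\<Omega>. (pmf (map_pmf snd \<kappa>) P)\<^sup>2) - 2 / N + real (card ?\<Omega>) * (1 / N\<^sup>2)"
    by (simp only: sum.distrib sum_subtractf sum_distrib_left[symmetric] sum1) simp
  also have "real (card ?\<Omega>) * (1 / N\<^sup>2) = 1 / N"
    using N by (simp add: N_def power2_eq_square)
  also have "(\<Sum>P\<in>?\<Omega>. (pmf (map_pmf snd \<kappa>) P)\<^sup>2) = real Z / A\<^sup>2"
    by (simp add: pmf\<kappa> Zeq power_divide sum_divide_distrib)
  finally have "N * (\<Sum>P\<in>?\<Omega>. (?w P)\<^sup>2) = N * real Z / A\<^sup>2 - 1"
    using N by (simp add: field_simps)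
  then have tv: "(\<Sum>P\<in>?\<Omega>. \<bar>?w P\<bar>) \<le> sqrt (N * real Z / A\<^sup>2 - 1)"
    using sum_sqrt_card[of ?\<Omega> ?w] by (simp add: N_def)
  from coupling_of_matched_sample[where f = multigraph and g = multigraph, OF finite_pairings sub\<kappa> subq same]
  obtain \<mu> where "is_coupling \<mu> (map_pmf fst \<kappa>) (Pstar n (Suc d))"
    "1 - (\<Sum>P\<in>?\<Omega>. \<bar>?w P\<bar>) / 2 \<le> measure_pmf.prob \<mu> {(P, P'). multigraph P = multigraph P'}"
    by blast
  then show ?thesis
    using tv unfolding fst\<kappa> N_def A_def L_def mult.assoc by (intro exI[of _ \<mu>]) auto
qed

section \<open>The second moment\<close>

text \<open>A pairing closed under two selections splits into matchings of their common points, of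
  the points of each one alone, and of the residual points. The second moment is only bounded from
  above, so it is enough that this splitting is injective.\<close>

lemma card_matched_Int_le:
  assumes c: "c \<in> colourings n (Suc d)" "c' \<in> colourings n (Suc d)"
  defines "T \<equiv> transversal n c" and "T' \<equiv> transversal n c'"
  defines "k \<equiv> card {v\<in>{..<n}. c v = c' v}"
  shows "card (matched n (Suc d) c \<inter> matched n (Suc d) c') \<le>
     matching_count k * (matching_count (n - k))\<^sup>2 * card (loopless (points n (Suc d) - T - T') {..<n})"
proof -
  let ?S = "points n (Suc d)"
  let ?B = "perfect_matchings (T \<inter> T') \<times> perfect_matchings (T - T') \<times> perfect_matchings (T' - T)
     \<times> loopless (?S - T - T') {..<n}"
  let ?f = "\<lambda>Q. (Q \<inter> Pow (T \<inter> T'), Q \<inter> Pow (T - T'), Q \<inter> Pow (T' - T), Q \<inter> Pow (?S - T - T'))"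
  let ?A = "matched n (Suc d) c \<inter> matched n (Suc d) c'"
  have TS: "T \<subseteq> ?S" "T' \<subseteq> ?S" using c by (simp_all add: T_def T'_def transversal_subset)
  have fin: "finite T" "finite T'" by (simp_all add: T_def T'_def)
  have TT: "T \<inter> T' = (\<lambda>v. (v, c v)) ` {v\<in>{..<n}. c v = c' v}"
    by (auto simp: T_def T'_def transversal_def)
  have k: "card (T \<inter> T') = k"
    unfolding TT k_def by (rule card_image) (auto simp: inj_on_def)
  have "card (T - T') = n - k"
    using card_Diff_subset_Int[of T T'] fin k by (simp add: T_def)
  moreover have "card (T' - T) = n - k"
    using card_Diff_subset_Int[of T' T] fin k by (simp add: T'_def Int_commute)
  ultimately have cB: "card ?B = matching_count k * (matching_count (n - k))\<^sup>2 *
      card (loopless (?S - T - T') {..<n})"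
    using fin k by (simp add: card_cartesian_product card_perfect_matchings power2_eq_square)
  have finB: "finite ?B"
    using fin by (intro finite_cartesian_product finite_perfect_matchings finite_matchings_avoiding) auto
  have Q: "Q \<in> perfect_matchings ?S" "Q \<inter> loops {..<n} = {}" "closed_in T Q" "closed_in T' Q"
    if "Q \<in> ?A" for Q
    using that by (auto simp: matched_def matchings_avoiding_def T_def T'_def)
  have "?f ` ?A \<subseteq> ?B"
  proof (rule image_subsetI)
    fix Q assume "Q \<in> ?A"
    note Q = Q[OF this]
    note R = perfect_matchings_restrict[OF Q(1)]
    have cl: "closed_in (T \<inter> T') Q" "closed_in (T - T') Q" "closed_in (T' - T) Q" "closed_in (?S - T - T') Q"
      using closed_in_Int[OF Q(3,4)] closed_in_Diff[OF Q(1) Q(3,4)] closed_in_Diff[OF Q(1) Q(4,3)]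
        closed_in_Diff[OF Q(1) closed_in_Diff[OF Q(1) closed_in_UNIV[OF Q(1)] Q(3)] Q(4)]
      by auto
    show "?f Q \<in> ?B"
      using R[OF _ cl(1)] R[OF _ cl(2)] R[OF _ cl(3)] R[OF _ cl(4)] TS Q(2)
      by (auto simp: matchings_avoiding_def)
  qed
  moreover have "inj_on ?f ?A"
  proof (rule inj_on_inverseI[where g = "\<lambda>(a, b, x, y). a \<union> b \<union> x \<union> y"])
    fix Q assume "Q \<in> ?A"
    note Q = Q[OF this]
    have "e \<subseteq> T \<inter> T' \<or> e \<subseteq> T - T' \<or> e \<subseteq> T' - T \<or> e \<subseteq> ?S - T - T'" if e: "e \<in> Q" for e
    proof -
      have "e \<inter> T = {} \<or> e \<subseteq> T" "e \<inter> T' = {} \<or> e \<subseteq> T'" "e \<subseteq> ?S"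
        using Q(3,4) e perfect_matchingsD(1)[OF Q(1) e] by (auto simp: closed_in_def)
      then show ?thesis by blast
    qed
    then show "(\<lambda>(a, b, x, y). a \<union> b \<union> x \<union> y) (?f Q) = Q" by auto
  qed
  ultimately show ?thesis
    using card_inj_on_le[of ?f ?A ?B] finB cB by simp
qed

lemma sum_Pow_card:
  fixes \<psi> :: "nat \<Rightarrow> real"
  assumes "finite V"
  shows "(\<Sum>J\<in>Pow V. \<psi> (card J)) = (\<Sum>k\<le>card V. real (card V choose k) * \<psi> k)"
proof -
  have "(\<Sum>J\<in>Pow V. \<psi> (card J)) = (\<Sum>k\<le>card V. \<Sum>J\<in>{J \<in> Pow V. card J = k}. \<psi> (card J))"
    by (rule sum.group[symmetric]) (use assms in \<open>auto intro: card_mono\<close>)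
  also have "\<dots> = (\<Sum>k\<le>card V. real (card V choose k) * \<psi> k)"
  proof (rule sum.cong[OF refl])
    fix k
    have "{J \<in> Pow V. card J = k} = {J. J \<subseteq> V \<and> card J = k}" by auto
    then show "(\<Sum>J\<in>{J \<in> Pow V. card J = k}. \<psi> (card J)) = real (card V choose k) * \<psi> k"
      using n_subsets[OF assms, of k] by simp
  qed
  finally show ?thesis .
qed

text \<open>Group the \<open>c'\<close> by the set of bins where they agree with \<open>c\<close>;
  every other bin leaves \<open>d\<close> choices. The result is the same for all
  \<open>c\<close>.\<close>

lemma sum_colourings_agreement:
  fixes \<phi> :: "nat \<Rightarrow> real"
  assumes c: "c \<in> colourings n (Suc d)"
  shows "(\<Sum>c'\<in>colourings n (Suc d). \<phi> (card {v\<in>{..<n}. c v = c' v})) =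
     (\<Sum>k\<le>n. real (n choose k) * (real d ^ (n - k) * \<phi> k))"
proof -
  let ?C = "colourings n (Suc d)" and ?J = "\<lambda>c'. {v\<in>{..<n}. c v = c' v}"
  have "(\<Sum>c'\<in>?C. \<phi> (card (?J c'))) = (\<Sum>J\<in>Pow {..<n}. \<Sum>c'\<in>{c' \<in> ?C. ?J c' = J}. \<phi> (card (?J c')))"
    by (rule sum.group[symmetric]) auto
  also have "\<dots> = (\<Sum>J\<in>Pow {..<n}. real d ^ (n - card J) * \<phi> (card J))"
  proof (rule sum.cong[OF refl])
    fix J assume J: "J \<in> Pow {..<n}"
    let ?E = "\<lambda>v. if v \<in> J then {c v} else {..<Suc d} - {c v}"
    have "{c' \<in> ?C. ?J c' = J} = (\<Pi>\<^sub>E v\<in>{..<n}. ?E v)"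
    proof (intro equalityI subsetI)
      fix c' assume "c' \<in> {c' \<in> ?C. ?J c' = J}"
      then show "c' \<in> (\<Pi>\<^sub>E v\<in>{..<n}. ?E v)"
        by (auto simp: colourings_def PiE_def Pi_def)
    next
      fix c' assume c': "c' \<in> (\<Pi>\<^sub>E v\<in>{..<n}. ?E v)"
      then have E: "c' v \<in> ?E v" if "v < n" for v
        using PiE_mem[OF c', of v] that by simp
      have "c' v < Suc d" if "v < n" for v
        using E[OF that] colouringsD[OF c that] by (auto split: if_splits)
      moreover have "c v = c' v \<longleftrightarrow> v \<in> J" if "v < n" for v
        using E[OF that] by (auto split: if_splits)
      ultimately show "c' \<in> {c' \<in> ?C. ?J c' = J}"
        using c' J by (auto simp: colourings_def PiE_def)
    qed
    then have "card {c' \<in> ?C. ?J c' = J} = (\<Prod>v\<in>{..<n}. card (?E v))"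
      by (simp add: card_PiE)
    also have "\<dots> = (\<Prod>v\<in>{..<n}. if v \<in> J then 1 else d)"
      by (rule prod.cong[OF refl]) (use colouringsD[OF c] in auto)
    also have "\<dots> = d ^ card ({..<n} - J)"
      by (subst prod.If_cases) (simp_all add: Diff_eq Compl_eq)
    also have "card ({..<n} - J) = n - card J"
      using J finite_subset[of J "{..<n}"] by (subst card_Diff_subset) auto
    finally have "card {c' \<in> ?C. ?J c' = J} = d ^ (n - card J)" .
    then show "(\<Sum>c'\<in>{c' \<in> ?C. ?J c' = J}. \<phi> (card (?J c'))) = real d ^ (n - card J) * \<phi> (card J)"
      by simp
  qed
  also have "\<dots> = (\<Sum>k\<le>n. real (n choose k) * (real d ^ (n - k) * \<phi> k))"
    using sum_Pow_card[of "{..<n}" "\<lambda>k. real d ^ (n - k) * \<phi> k"] by simp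
  finally show ?thesis .
qed

text \<open>A bound \<open>N\<close> that depends on the overlap alone turns the double sum over
  selections into a single sum over overlap sizes, repeated once for each \<open>c\<close>.\<close>

lemma second_moment_le:
  fixes n d :: nat and N :: "nat \<Rightarrow> real"
  defines "C \<equiv> colourings n (Suc d)"
  assumes N: "\<And>c c'. c \<in> C \<Longrightarrow> c' \<in> C \<Longrightarrow>
    real (card (loopless (points n (Suc d) - transversal n c - transversal n c') {..<n}))
       \<le> N (card {v\<in>{..<n}. c v = c' v})"
  shows "real (\<Sum>c\<in>C. \<Sum>c'\<in>C. card (matched n (Suc d) c \<inter> matched n (Suc d) c')) \<le>
    real (Suc d) ^ n * (\<Sum>k\<le>n. real (n choose k) * (real d ^ (n - k) *
      (real (matching_count k) * (real (matching_count (n - k)))\<^sup>2 * N k)))"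
proof -
  let ?\<phi> = "\<lambda>k. real (matching_count k) * (real (matching_count (n - k)))\<^sup>2 * N k"
  have "real (\<Sum>c\<in>C. \<Sum>c'\<in>C. card (matched n (Suc d) c \<inter> matched n (Suc d) c')) =
        (\<Sum>c\<in>C. \<Sum>c'\<in>C. real (card (matched n (Suc d) c \<inter> matched n (Suc d) c')))" by simp
  also have "\<dots> \<le> (\<Sum>c\<in>C. \<Sum>c'\<in>C. ?\<phi> (card {v\<in>{..<n}. c v = c' v}))"
  proof (intro sum_mono)
    fix c c' assume c: "c \<in> C" "c' \<in> C"
    let ?k = "card {v\<in>{..<n}. c v = c' v}"
    have "real (card (matched n (Suc d) c \<inter> matched n (Suc d) c')) \<le>
        real (matching_count ?k * (matching_count (n - ?k))\<^sup>2 *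
          card (loopless (points n (Suc d) - transversal n c - transversal n c') {..<n}))"
      by (intro of_nat_mono card_matched_Int_le) (use c in \<open>auto simp: C_def\<close>)
    also have "\<dots> = real (matching_count ?k) * (real (matching_count (n - ?k)))\<^sup>2 *
          real (card (loopless (points n (Suc d) - transversal n c - transversal n c') {..<n}))"
      by simp
    also have "\<dots> \<le> ?\<phi> ?k"
      by (intro mult_left_mono N c) simp
    finally show "real (card (matched n (Suc d) c \<inter> matched n (Suc d) c')) \<le> ?\<phi> ?k" .
  qed
  also have "\<dots> = (\<Sum>c\<in>C. \<Sum>k\<le>n. real (n choose k) * (real d ^ (n - k) * ?\<phi> k))"
    by (rule sum.cong[OF refl]) (use sum_colourings_agreement[of _ n d ?\<phi>] in \<open>simp add: C_def\<close>)
  also have "\<dots> = real (card C) * (\<Sum>k\<le>n. real (n choose k) * (real d ^ (n - k) * ?\<phi> k))" by simp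
  finally show ?thesis by (simp add: C_def)
qed

lemma bin_points: "bin (points n k) v = (if v < n then {v} \<times> {..<k} else {})"
  by (auto simp: bin_def points_def)

lemma card_bin_points: "card (bin (points n k) v) = (if v < n then k else 0)"
  by (simp add: bin_points card_cartesian_product)

lemma card_bin_residual:
  assumes c: "c \<in> colourings n (Suc d)" "c' \<in> colourings n (Suc d)"
  shows "card (bin (points n (Suc d) - transversal n c - transversal n c') v) =
     (if v < n then if c v = c' v then d else d - 1 else 0)"
proof (cases "v < n")
  case True
  have "bin (points n (Suc d) - transversal n c - transversal n c') v = {v} \<times> ({..<Suc d} - {c v, c' v})"
    using True by (auto simp: bin_def points_def mem_transversal)
  moreover have "card ({..<Suc d} - {c v, c' v}) = Suc d - card {c v, c' v}"
    using colouringsD[OF c(1) True] colouringsD[OF c(2) True] by (subst card_Diff_subset) auto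
  ultimately show ?thesis using True by (auto simp: card_cartesian_product)
next
  case False
  then have "bin (points n (Suc d) - transversal n c - transversal n c') v = {}"
    by (auto simp: bin_def points_def)
  then show ?thesis using False by simp
qed

lemma card_residual:
  assumes c: "c \<in> colourings n (Suc d)" "c' \<in> colourings n (Suc d)" and d: "d \<ge> 1"
  shows "card (points n (Suc d) - transversal n c - transversal n c') =
     n * (d - 1) + card {v\<in>{..<n}. c v = c' v}"
proof -
  let ?S = "points n (Suc d) - transversal n c - transversal n c'"
  let ?J = "{v\<in>{..<n}. c v = c' v}"
  have "?S = (\<Union>v\<in>{..<n}. bin ?S v)" by (auto simp: bin_def points_def)
  then have "card ?S = card (\<Union>v\<in>{..<n}. bin ?S v)" by (rule arg_cong)
  also have "\<dots> = (\<Sum>v<n. card (bin ?S v))"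
    by (rule card_UN_disjoint) (auto simp: bin_def)
  also have "\<dots> = (\<Sum>v<n. (d - 1) + (if c v = c' v then 1 else 0))"
    by (rule sum.cong[OF refl]) (use d in \<open>simp add: card_bin_residual[OF c]\<close>)
  also have "\<dots> = n * (d - 1) + card ?J"
    by (simp add: sum.distrib sum.inter_filter[symmetric])
  finally show ?thesis .
qed

section \<open>Estimates\<close>

lemma matching_count_odd: "odd k \<Longrightarrow> matching_count k = 0"
  by (induction k rule: matching_count.induct) auto

lemma matching_count_even: "real (matching_count (2 * k)) = 2 ^ k * pochhammer (1 / 2) k"
proof (induction k)
  case (Suc k)
  have "matching_count (2 * Suc k) = Suc (2 * k) * matching_count (2 * k)" by simp
  then have "real (matching_count (2 * Suc k)) = (2 * real k + 1) * (2 ^ k * pochhammer (1 / 2) k)"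
    by (simp only: of_nat_mult Suc) simp
  then show ?case by (simp add: pochhammer_rec' field_simps)
qed simp

lemma sum_even_terms:
  fixes f :: "nat \<Rightarrow> real"
  assumes "\<And>k. odd k \<Longrightarrow> f k = 0"
  shows "(\<Sum>k\<le>2 * h. f k) = (\<Sum>j\<le>h. f (2 * j))"
proof (induction h)
  case (Suc h)
  have "(\<Sum>k\<le>2 * Suc h. f k) = (\<Sum>k\<le>2 * h. f k) + f (2 * h + 1) + f (2 * Suc h)"
    by simp
  then show ?case using Suc assms[of "2 * h + 1"] by simp
qed simp

text \<open>Both sides count the perfect matchings of 2 h points with j marked edges. The proof
  computes with (2 k)! = 2^k k! (2 k - 1)!!.\<close>

lemma binomial_matching_count:
  assumes "j \<le> h"
  shows "real (2 * h choose (2 * j)) * real (matching_count (2 * j)) * real (matching_count (2 * (h - j))) =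
         real (matching_count (2 * h)) * real (h choose j)"
proof -
  have f: "(fact (2 * k) :: real) = 2 ^ k * fact k * real (matching_count (2 * k))" for k
    unfolding matching_count_even
    by (simp add: fact_double power_mult power2_eq_square power_mult_distrib[symmetric])
  have "2 * h - 2 * j = 2 * (h - j)" by simp
  then have "real (2 * h choose (2 * j)) = fact (2 * h) / (fact (2 * j) * fact (2 * (h - j)))"
    using binomial_fact[of "2 * j" "2 * h", where 'a = real] assms by simp
  also have "\<dots> = real (matching_count (2 * h)) * (2 ^ h * fact h) /
      (real (matching_count (2 * j)) * real (matching_count (2 * (h - j))) *
        (2 ^ j * 2 ^ (h - j) * (fact j * fact (h - j))))"
    unfolding f by (simp add: mult_ac)
  also have "(2 :: real) ^ j * 2 ^ (h - j) = 2 ^ h" using assms by (simp flip: power_add)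
  finally have c: "real (2 * h choose (2 * j)) = real (matching_count (2 * h)) /
      (real (matching_count (2 * j)) * real (matching_count (2 * (h - j)))) *
      (fact h / (fact j * fact (h - j)))"
    by (simp add: field_simps)
  have "real (matching_count (2 * k)) \<noteq> 0" for k
    unfolding matching_count_even using pochhammer_pos[of "1 / 2 :: real" k] by simp
  then have nz: "matching_count (2 * k) \<noteq> 0" for k by (simp only: of_nat_eq_0_iff not_False_eq_True)
  show ?thesis
    unfolding c binomial_fact[OF assms, where 'a = real] by (simp add: nz)
qed

section \<open>A Stirling-type comparison\<close>

lemma ln_add_one_ge_quadratic:
  fixes x :: real
  assumes "0 \<le> x"
  shows "x - x\<^sup>2 / 2 \<le> ln (1 + x)"
proof -
  have "ln (1 + 0) - 0 + 0\<^sup>2 / 2 \<le> ln (1 + x) - x + x\<^sup>2 / 2"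
  proof (rule DERIV_nonneg_imp_nondecreasing[OF assms])
    fix y :: real assume y: "0 \<le> y" "y \<le> x"
    have "((\<lambda>y. ln (1 + y) - y + y\<^sup>2 / 2) has_real_derivative (1 / (1 + y) - 1 + y)) (at y)"
      by (rule derivative_eq_intros refl | use y in simp)+
    moreover have "0 \<le> 1 / (1 + y) - 1 + y"
      using y by (simp add: field_simps)
    ultimately show "\<exists>z. ((\<lambda>y. ln (1 + y) - y + y\<^sup>2 / 2) has_real_derivative z) (at y) \<and> 0 \<le> z"
      by blast
  qed
  then show ?thesis by simp
qed

lemma ln_add_one_le_cubic:
  fixes x :: real
  assumes "0 \<le> x"
  shows "ln (1 + x) \<le> x - x\<^sup>2 / 2 + x ^ 3 / 3"
proof -
  have "0 - 0\<^sup>2 / 2 + 0 ^ 3 / 3 - ln (1 + 0) \<le> x - x\<^sup>2 / 2 + x ^ 3 / 3 - ln (1 + x)"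
  proof (rule DERIV_nonneg_imp_nondecreasing[OF assms])
    fix y :: real assume y: "0 \<le> y" "y \<le> x"
    have "((\<lambda>y. y - y\<^sup>2 / 2 + y ^ 3 / 3 - ln (1 + y)) has_real_derivative (1 - y + y\<^sup>2 - 1 / (1 + y))) (at y)"
      by (rule derivative_eq_intros refl | use y in \<open>simp add: power2_eq_square\<close>)+
    moreover have "1 - y + y\<^sup>2 - 1 / (1 + y) = y ^ 3 / (1 + y)"
      using y by (simp add: field_simps power2_eq_square power3_eq_cube)
    ultimately show "\<exists>z. ((\<lambda>y. y - y\<^sup>2 / 2 + y ^ 3 / 3 - ln (1 + y)) has_real_derivative z) (at y) \<and> 0 \<le> z"
      using y by (intro exI[of _ "1 - y + y\<^sup>2 - 1 / (1 + y)"]) simp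
  qed
  then show ?thesis by simp
qed

text \<open>The quotient of \<open>pochhammer (1 / 2) k\<close> and (k / e)^k. By Stirling's formula
  it tends to sqrt 2, since the shift by 1/2 absorbs the usual factor sqrt k. What the proof
  exploits is its slow variation.\<close>

definition stirling_ratio :: "nat \<Rightarrow> real" where
  "stirling_ratio k = pochhammer (1 / 2) k * exp (real k) / real k ^ k"

lemma stirling_ratio_pos: "0 < stirling_ratio k"
  unfolding stirling_ratio_def by (cases "k = 0") (auto intro!: mult_pos_pos divide_pos_pos pochhammer_pos)

text \<open>With u = 1 / k the increment is ln (1 + u/2) + 1 - (k + 1) ln (1 + u), in which the
  terms of order 1 and u cancel.\<close>

lemma stirling_ratio_Suc:
  assumes k: "k \<ge> 1"
  shows "\<bar>ln (stirling_ratio (Suc k)) - ln (stirling_ratio k)\<bar> \<le> 1 / (real k)\<^sup>2"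
proof -
  define u where "u = 1 / real k"
  have u: "0 < u" "u \<le> 1" and ku: "real k = 1 / u" using k by (auto simp: u_def)
  have kp: "real k > 0" using k by simp
  have ln_sr: "ln (stirling_ratio k) = ln (pochhammer (1 / 2) k) + real k - real k * ln (real k)"
    if "k \<ge> 1" for k
  proof -
    have "pochhammer (1 / 2 :: real) k > 0" by (intro pochhammer_pos) auto
    then show ?thesis using that
      by (simp add: stirling_ratio_def ln_div ln_mult ln_realpow)
  qed
  have p: "ln (pochhammer (1 / 2 :: real) (Suc k)) = ln (pochhammer (1 / 2) k) + ln (real k + 1 / 2)"
  proof -
    have "pochhammer (1 / 2 :: real) k > 0" by (intro pochhammer_pos) auto
    then show ?thesis using kp by (simp add: pochhammer_rec' ln_mult add.commute)
  qed
  have "real k + 1 / 2 = real k * (1 + u / 2)" "real k + 1 = real k * (1 + u)"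
    using kp by (simp_all add: u_def field_simps)
  then have l: "ln (real k + 1 / 2) = ln (real k) + ln (1 + u / 2)" "ln (real k + 1) = ln (real k) + ln (1 + u)"
    using kp u by (simp_all add: ln_mult)
  have d: "ln (stirling_ratio (Suc k)) - ln (stirling_ratio k) = ln (1 + u / 2) + 1 - (real k + 1) * ln (1 + u)"
  proof -
    have "ln (stirling_ratio (Suc k)) =
        ln (pochhammer (1 / 2) (Suc k)) + (real k + 1) - (real k + 1) * ln (real k + 1)"
      using ln_sr[of "Suc k"] by (simp add: add.commute)
    then show ?thesis unfolding ln_sr[OF k] p l by (simp add: algebra_simps)
  qed
  have a: "ln (1 + u / 2) \<le> u / 2" using ln_add_one_self_le_self[of "u / 2"] u by simp
  have b: "u / 2 - (u / 2)\<^sup>2 / 2 \<le> ln (1 + u / 2)" by (rule ln_add_one_ge_quadratic) (use u in simp)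
  have "(real k + 1) * (u - u\<^sup>2 / 2) \<le> (real k + 1) * ln (1 + u)"
    by (intro mult_left_mono ln_add_one_ge_quadratic) (use u in auto)
  moreover have "(real k + 1) * (u - u\<^sup>2 / 2) = 1 + u / 2 - u\<^sup>2 / 2"
    unfolding ku using u by (simp add: field_simps power2_eq_square)
  ultimately have c: "1 + u / 2 - u\<^sup>2 / 2 \<le> (real k + 1) * ln (1 + u)" by simp
  have "(real k + 1) * ln (1 + u) \<le> (real k + 1) * (u - u\<^sup>2 / 2 + u ^ 3 / 3)"
    by (intro mult_left_mono ln_add_one_le_cubic) (use u in auto)
  also have "(real k + 1) * (u - u\<^sup>2 / 2 + u ^ 3 / 3) = 1 + u / 2 - u\<^sup>2 / 6 + u ^ 3 / 3"
    unfolding ku using u by (simp add: field_simps power2_eq_square power3_eq_cube)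
  also have "u ^ 3 \<le> u\<^sup>2" using u by (intro power_decreasing) auto
  finally have e: "(real k + 1) * ln (1 + u) \<le> 1 + u / 2 + u\<^sup>2 / 6" by simp
  have "1 / (real k)\<^sup>2 = u\<^sup>2" by (simp add: u_def power_divide)
  moreover have "(u / 2)\<^sup>2 = u\<^sup>2 / 4" by (simp add: power_divide)
  ultimately show ?thesis
    unfolding d using a b c e zero_le_power2[of u] by (intro abs_leI) linarith+
qed

lemma stirling_ratio_add:
  assumes k: "k \<ge> 1"
  shows "\<bar>ln (stirling_ratio (k + l)) - ln (stirling_ratio k)\<bar> \<le> real l / (real k)\<^sup>2"
proof (induction l)
  case (Suc l)
  have "\<bar>ln (stirling_ratio (Suc (k + l))) - ln (stirling_ratio (k + l))\<bar> \<le> 1 / (real (k + l))\<^sup>2"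
    by (rule stirling_ratio_Suc) (use k in simp)
  also have "\<dots> \<le> 1 / (real k)\<^sup>2"
    using k by (intro divide_left_mono power_mono mult_pos_pos) auto
  finally show ?case using Suc by (simp add: add_divide_distrib)
qed simp

text \<open>Write each factor as \<open>stirling_ratio k\<close> times (k / e)^k. The powers of h
  and e cancel because h (d + 1) + h (d - 1) = 2 h d. The ratio of the \<open>stirling_ratio\<close>
  terms telescopes into two runs of h increments, each at most 1 / (h (d - 1))^2.\<close>

lemma pochhammer_half_ratio:
  fixes h d :: nat
  assumes h: "h \<ge> 1" and d: "d \<ge> 2"
  shows "pochhammer (1 / 2 :: real) (h * (d + 1)) * pochhammer (1 / 2) (h * (d - 1)) /
          (pochhammer (1 / 2) (h * d))\<^sup>2 \<le>
         exp (2 / (real h * (real d - 1)\<^sup>2)) *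
           ((real d + 1) ^ (h * (d + 1)) * (real d - 1) ^ (h * (d - 1)) / real d ^ (2 * (h * d)))"
proof -
  let ?s = stirling_ratio
  have k: "h * (d - 1) \<ge> 1" "h * d \<ge> 1" using h d by simp_all
  have e1: "h * (d - 1) + h = h * d" "h * d + h = h * (d + 1)" using d
    by (simp_all add: algebra_simps)
  have q: "real h / (real (h * k))\<^sup>2 = 1 / (real h * (real k)\<^sup>2)" for k
    using h by (simp add: power2_eq_square)
  define q where "q = 1 / (real h * (real d - 1)\<^sup>2)"
  have "ln (?s (h * (d + 1))) - ln (?s (h * d)) \<le> 1 / (real h * (real d)\<^sup>2)"
    using stirling_ratio_add[OF k(2), of h] unfolding e1 q by linarith
  moreover have "1 / (real h * (real d)\<^sup>2) \<le> q"
    unfolding q_def using h d by (intro divide_left_mono mult_left_mono power_mono mult_pos_pos) auto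
  moreover have "ln (?s (h * (d - 1))) - ln (?s (h * d)) \<le> q"
    using stirling_ratio_add[OF k(1), of h] d unfolding e1 q q_def by (simp add: of_nat_diff)
  ultimately have "ln (?s (h * (d + 1))) + ln (?s (h * (d - 1))) - 2 * ln (?s (h * d))
      \<le> 2 * q" by linarith
  moreover have "ln (?s (h * (d + 1)) * ?s (h * (d - 1)) / (?s (h * d))\<^sup>2) =
      ln (?s (h * (d + 1))) + ln (?s (h * (d - 1))) - 2 * ln (?s (h * d))"
    using stirling_ratio_pos less_imp_neq[OF stirling_ratio_pos, symmetric]
    by (simp add: ln_div ln_mult ln_realpow)
  ultimately have "ln (?s (h * (d + 1)) * ?s (h * (d - 1)) / (?s (h * d))\<^sup>2)
      \<le> 2 / (real h * (real d - 1)\<^sup>2)" by (simp only: q_def)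
  then have "exp (ln (?s (h * (d + 1)) * ?s (h * (d - 1)) / (?s (h * d))\<^sup>2))
      \<le> exp (2 / (real h * (real d - 1)\<^sup>2))" by (subst exp_le_cancel_iff)
  moreover have "0 < ?s (h * (d + 1)) * ?s (h * (d - 1)) / (?s (h * d))\<^sup>2"
    by (intro divide_pos_pos mult_pos_pos zero_less_power stirling_ratio_pos)
  ultimately have S: "?s (h * (d + 1)) * ?s (h * (d - 1)) / (?s (h * d))\<^sup>2
      \<le> exp (2 / (real h * (real d - 1)\<^sup>2))" by (simp only: exp_ln)
  have p: "pochhammer (1 / 2) (h * k) = ?s (h * k) * (real h ^ (h * k) * real k ^ (h * k) * exp (- real (h * k)))"
    if "k \<ge> 1" for k
    using that h by (simp add: stirling_ratio_def exp_minus power_mult_distrib)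
  have hp: "real h ^ (h * (d + 1)) * real h ^ (h * (d - 1)) = (real h ^ (h * d))\<^sup>2"
    unfolding power_mult[symmetric] power_add[symmetric]
    using e1 by (intro arg_cong2[of _ _ _ _ power] refl) linarith
  have ex: "exp (- real (h * (d + 1))) * exp (- real (h * (d - 1))) = (exp (- real (h * d)))\<^sup>2"
  proof -
    have "real (h * (d + 1)) + real (h * (d - 1)) = 2 * real (h * d)" using e1 by linarith
    then show ?thesis by (simp add: exp_add[symmetric] exp_double[symmetric])
  qed
  have pos: "real h ^ (h * d) > 0" "exp (- real (h * d)) > 0" "real d ^ (h * d) > 0" "?s (h * d) > 0"
    using h d stirling_ratio_pos by auto
  have "pochhammer (1 / 2 :: real) (h * (d + 1)) * pochhammer (1 / 2) (h * (d - 1)) /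
          (pochhammer (1 / 2) (h * d))\<^sup>2 =
    (?s (h * (d + 1)) * ?s (h * (d - 1)) / (?s (h * d))\<^sup>2) *
    ((real h ^ (h * (d + 1)) * real h ^ (h * (d - 1))) / (real h ^ (h * d))\<^sup>2) *
    ((exp (- real (h * (d + 1))) * exp (- real (h * (d - 1)))) / (exp (- real (h * d)))\<^sup>2) *
    (real (d + 1) ^ (h * (d + 1)) * real (d - 1) ^ (h * (d - 1)) / (real d ^ (h * d))\<^sup>2)"
  proof -
    have "d + 1 \<ge> 1" "d - 1 \<ge> 1" "d \<ge> 1" using d by auto
    from this[THEN p] show ?thesis
      by (simp only: power_mult_distrib times_divide_times_eq mult_ac)
  qed
  also have "\<dots> = (?s (h * (d + 1)) * ?s (h * (d - 1)) / (?s (h * d))\<^sup>2) *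
    (real (d + 1) ^ (h * (d + 1)) * real (d - 1) ^ (h * (d - 1)) / (real d ^ (h * d))\<^sup>2)"
    unfolding hp ex using pos by simp
  also have "\<dots> \<le> exp (2 / (real h * (real d - 1)\<^sup>2)) *
    (real (d + 1) ^ (h * (d + 1)) * real (d - 1) ^ (h * (d - 1)) / (real d ^ (h * d))\<^sup>2)"
    by (rule mult_right_mono[OF S]) simp
  also have "real (d + 1) = real d + 1" by simp
  also have "real (d - 1) = real d - 1" using d by (simp add: of_nat_diff)
  also have "(real d ^ (h * d))\<^sup>2 = real d ^ (2 * (h * d))" by (simp add: power_mult[symmetric] mult.commute)
  finally show ?thesis .
qed


section \<open>Moments of the negative binomial law\<close>

text \<open>Unnormalised point masses of the negative binomial law.\<close>

definition nb_weight :: "real \<Rightarrow> real \<Rightarrow> nat \<Rightarrow> real" where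
  "nb_weight a z j = pochhammer a j / fact j * z ^ j"

lemma nb_weight_nonneg: "0 < a \<Longrightarrow> 0 \<le> z \<Longrightarrow> 0 \<le> nb_weight a z j"
  unfolding nb_weight_def by (intro mult_nonneg_nonneg divide_nonneg_nonneg pochhammer_nonneg) auto

text \<open>The binomial series with exponent - a at - z; the signs cancel in pairs.\<close>

lemma nb_weight_sums:
  assumes z: "0 \<le> z" "z < 1"
  shows "nb_weight a z sums (1 - z) powr (- a)"
proof -
  have "(\<lambda>n. ((- a) gchoose n) * (- z) ^ n) sums (1 + (- z)) powr (- a)"
    by (rule gen_binomial_real) (use z in simp)
  moreover have "((- a) gchoose n) * (- z) ^ n = nb_weight a z n" for n
  proof -
    have "(- 1 :: real) ^ n * (- 1) ^ n = 1" by (simp flip: power_mult_distrib)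
    moreover have "(- z) ^ n = (- 1) ^ n * z ^ n" by (simp flip: power_mult_distrib)
    ultimately show ?thesis
      by (simp add: gbinomial_pochhammer nb_weight_def mult_ac)
  qed
  ultimately show ?thesis by simp
qed

text \<open>Size biasing: a factor j shifts the parameter from a to a + 1, so factorial moments
  reduce to the total mass.\<close>

lemma nb_weight_Suc: "real (Suc j) * nb_weight a z (Suc j) = a * z * nb_weight (a + 1) z j"
  unfolding nb_weight_def pochhammer_rec fact_Suc by (simp add: field_simps del: of_nat_Suc)

lemma nb_weight_sums_mean:
  assumes z: "0 \<le> z" "z < 1"
  shows "(\<lambda>j. real j * nb_weight a z j) sums (a * (z / (1 - z)) * (1 - z) powr (- a))"
proof -
  have "(\<lambda>j. real (Suc j) * nb_weight a z (Suc j)) sums (a * z * (1 - z) powr (- (a + 1)))"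
    unfolding nb_weight_Suc by (rule sums_mult[OF nb_weight_sums[OF z]])
  then have "(\<lambda>j. real j * nb_weight a z j) sums (a * z * (1 - z) powr (- (a + 1)))"
    by (subst (asm) sums_Suc_iff) simp
  moreover have "(1 - z) powr (- (a + 1)) = (1 - z) powr (- a) / (1 - z)"
    using z powr_diff[of "1 - z" "- a" 1] by simp
  ultimately show ?thesis by simp
qed

lemma nb_weight_sums_factorial_moment:
  assumes z: "0 \<le> z" "z < 1"
  shows "(\<lambda>j. real j * (real j - 1) * nb_weight a z j) sums
           (a * (a + 1) * (z / (1 - z))\<^sup>2 * (1 - z) powr (- a))"
proof -
  have "(\<lambda>j. a * z * (real j * nb_weight (a + 1) z j)) sums
          (a * z * ((a + 1) * (z / (1 - z)) * (1 - z) powr (- (a + 1))))"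
    by (rule sums_mult[OF nb_weight_sums_mean[OF z]])
  moreover have "a * z * (real j * nb_weight (a + 1) z j) =
      real (Suc j) * (real (Suc j) - 1) * nb_weight a z (Suc j)" for j
    using nb_weight_Suc[of j a z] by (simp add: mult_ac)
  ultimately have "(\<lambda>j. real (Suc j) * (real (Suc j) - 1) * nb_weight a z (Suc j)) sums
          (a * z * ((a + 1) * (z / (1 - z)) * (1 - z) powr (- (a + 1))))"
    by (simp only:)
  from sums_Suc[OF this]
  have "(\<lambda>j. real j * (real j - 1) * nb_weight a z j) sums
          (a * z * ((a + 1) * (z / (1 - z)) * (1 - z) powr (- (a + 1))))"
    by simp
  moreover have "(1 - z) powr (- (a + 1)) = (1 - z) powr (- a) / (1 - z)"
    using z powr_diff[of "1 - z" "- a" 1] by simp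
  ultimately show ?thesis by (simp add: power2_eq_square mult_ac)
qed

text \<open>Expand (j - \<mu>)^2 = j (j - 1) + (1 - 2 \<mu>) j + \<mu>^2. The centre is left free
  because the application uses h / (d + 1), which differs slightly from the exact mean a w.\<close>

lemma nb_weight_sums_deviation:
  fixes a z \<mu> :: real
  assumes z: "0 \<le> z" "z < 1"
  defines "w \<equiv> z / (1 - z)"
  shows "(\<lambda>j. (real j - \<mu>)\<^sup>2 * nb_weight a z j) sums
           (((a * w - \<mu>)\<^sup>2 + a * w * (1 + w)) * (1 - z) powr (- a))"
proof -
  have "(\<lambda>j. real j * (real j - 1) * nb_weight a z j + ((1 - 2 * \<mu>) * (real j * nb_weight a z j) +
           \<mu>\<^sup>2 * nb_weight a z j)) sums
        (a * (a + 1) * w\<^sup>2 * (1 - z) powr (- a) + ((1 - 2 * \<mu>) * (a * w * (1 - z) powr (- a)) +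
           \<mu>\<^sup>2 * (1 - z) powr (- a)))"
    unfolding w_def
    by (intro sums_add sums_mult nb_weight_sums[OF z] nb_weight_sums_mean[OF z]
        nb_weight_sums_factorial_moment[OF z])
  then show ?thesis by (simp add: algebra_simps power2_eq_square)
qed

text \<open>For these a and z the mean is h / (d + 1) + 1 / (2 (d^2 - 1)) and the variance has order
  h / d. The quadratic term thus contributes order 1 / (d sqrt h), which is at most 1 / d^2 because
  d^2 \<le> h. The constant is 184 = 4 + 36 * 5.\<close>

lemma nb_weight_weighted_sum_le:
  fixes h d :: nat and G :: "nat \<Rightarrow> real"
  assumes d: "d \<ge> 3" and dh: "d\<^sup>2 \<le> h"
    and G: "\<And>j. j \<le> h \<Longrightarrow>
      G j \<le> 1 + 4 / (real d)\<^sup>2 + 36 * sqrt (real h) * (real j / real h - 1 / (real d + 1))\<^sup>2"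
  defines "a \<equiv> real h * (real d - 1) + 1 / 2" and "z \<equiv> 1 / (real d)\<^sup>2"
  shows "(\<Sum>j\<le>h. nb_weight a z j * G j) \<le> (1 - z) powr (- a) * (1 + 184 / (real d)\<^sup>2)"
proof -
  define D H where "D = real d" and "H = real h"
  define M where "M = (1 - z) powr (- a)"
  define \<mu> where "\<mu> = H / (D + 1)"
  define w where "w = z / (1 - z)"
  have D: "D \<ge> 3" using d by (simp add: D_def)
  have "real (d\<^sup>2) \<le> real h" using dh by (rule of_nat_mono)
  then have DH: "D\<^sup>2 \<le> H" by (simp add: D_def H_def)
  have D9: "9 \<le> D\<^sup>2" using power_mono[OF D, of 2] by simp
  have H: "H \<ge> 9" using D9 DH by simp
  have z: "0 \<le> z" "z < 1" using D9 D by (simp_all add: z_def D_def[symmetric] divide_less_eq)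
  have a: "0 < a" unfolding a_def using D D_def by (intro add_nonneg_pos mult_nonneg_nonneg) auto
  have w: "w = 1 / (D\<^sup>2 - 1)" unfolding w_def z_def D_def[symmetric] using D D9 by (simp add: field_simps)
  have DD: "D\<^sup>2 - 1 = (D + 1) * (D - 1)" by (simp add: power2_eq_square algebra_simps)
  have aw: "a * w = \<mu> + 1 / (2 * (D\<^sup>2 - 1))"
    unfolding w a_def \<mu>_def D_def[symmetric] H_def[symmetric] DD using D by (simp add: add_divide_distrib)
  have M: "0 \<le> M" by (simp add: M_def)
  have p: "0 \<le> nb_weight a z j" for j by (rule nb_weight_nonneg[OF a z(1)])
  have s0: "(\<Sum>j\<le>h. nb_weight a z j) \<le> M"
    using sum_le_suminf[OF sums_summable[OF nb_weight_sums[OF z]], of "{..h}"]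
      sums_unique[OF nb_weight_sums[OF z]] p by (simp add: M_def)
  have "(\<Sum>j\<le>h. (real j - \<mu>)\<^sup>2 * nb_weight a z j) \<le> ((a * w - \<mu>)\<^sup>2 + a * w * (1 + w)) * M"
    using sum_le_suminf[OF sums_summable[OF nb_weight_sums_deviation[OF z]], of "{..h}"]
      sums_unique[OF nb_weight_sums_deviation[OF z]] p by (simp add: M_def w_def)
  \<comment> \<open>The squared bias is at most 1 and a w (1 + w) at most 2 (H / D + 1); since H / D
    \<ge> 1, the total is at most 5 H / D.\<close>
  also have "\<dots> \<le> (5 * H / D) * M"
  proof (rule mult_right_mono[OF _ M])
    have HD: "1 \<le> H / D"
    proof -
      have "D \<le> D\<^sup>2" using D by (simp add: self_le_power)
      then have "D \<le> H" using DH by linarith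
      then show ?thesis using D by (simp add: pos_le_divide_eq)
    qed
    have w1: "0 \<le> w" "w \<le> 1" using D9 by (simp_all add: w field_simps)
    have e: "0 \<le> 1 / (2 * (D\<^sup>2 - 1))" "1 / (2 * (D\<^sup>2 - 1)) \<le> 1" using D9 by (simp_all add: field_simps)
    have m: "0 \<le> \<mu>" "\<mu> \<le> H / D" unfolding \<mu>_def using D H by (auto intro!: divide_left_mono)
    have "(a * w - \<mu>)\<^sup>2 \<le> 1"
      unfolding aw using e by (simp add: power_le_one)
    moreover have "a * w * (1 + w) \<le> (H / D + 1) * 2"
      unfolding aw using e m w1 by (intro mult_mono) auto
    ultimately show "(a * w - \<mu>)\<^sup>2 + a * w * (1 + w) \<le> 5 * H / D" using HD by simp
  qed
  finally have s2: "(\<Sum>j\<le>h. (real j - \<mu>)\<^sup>2 * nb_weight a z j) \<le> (5 * H / D) * M" .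
  have "(\<Sum>j\<le>h. nb_weight a z j * G j) \<le>
        (\<Sum>j\<le>h. (1 + 4 / D\<^sup>2) * nb_weight a z j + (36 * sqrt H / H\<^sup>2) * ((real j - \<mu>)\<^sup>2 * nb_weight a z j))"
  proof (rule sum_mono)
    fix j assume "j \<in> {..h}"
    then have "nb_weight a z j * G j \<le> nb_weight a z j *
       (1 + 4 / D\<^sup>2 + 36 * sqrt H * (real j / H - 1 / (D + 1))\<^sup>2)"
      unfolding D_def H_def by (intro mult_left_mono G p) auto
    also have "real j / H - 1 / (D + 1) = (real j - \<mu>) / H"
      unfolding \<mu>_def using H by (simp add: field_simps)
    finally show "nb_weight a z j * G j \<le> (1 + 4 / D\<^sup>2) * nb_weight a z j +
        (36 * sqrt H / H\<^sup>2) * ((real j - \<mu>)\<^sup>2 * nb_weight a z j)"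
      by (simp add: power_divide algebra_simps)
  qed
  also have "\<dots> = (1 + 4 / D\<^sup>2) * (\<Sum>j\<le>h. nb_weight a z j) +
      (36 * sqrt H / H\<^sup>2) * (\<Sum>j\<le>h. (real j - \<mu>)\<^sup>2 * nb_weight a z j)"
    by (simp add: sum.distrib sum_distrib_left)
  also have "\<dots> \<le> (1 + 4 / D\<^sup>2) * M + (36 * sqrt H / H\<^sup>2) * ((5 * H / D) * M)"
    using s0 s2 H by (intro add_mono mult_left_mono) auto
  also have "(36 * sqrt H / H\<^sup>2) * ((5 * H / D) * M) = 180 / (D * sqrt H) * M"
  proof -
    have "H\<^sup>2 = H * sqrt H * sqrt H" using H by (simp add: power2_eq_square)
    moreover have "sqrt H \<noteq> 0" "H \<noteq> 0" using H by auto
    ultimately show ?thesis by simp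
  qed
  also have "180 / (D * sqrt H) * M \<le> 180 / D\<^sup>2 * M"
  proof (rule mult_right_mono[OF _ M])
    have "D \<le> sqrt H" using DH by (rule real_le_rsqrt)
    then show "180 / (D * sqrt H) \<le> 180 / D\<^sup>2"
      unfolding power2_eq_square using D H by (intro divide_left_mono mult_left_mono mult_pos_pos) auto
  qed
  finally show ?thesis by (simp add: M_def D_def algebra_simps add_divide_distrib)
qed

section \<open>Ratios of central binomial coefficients\<close>

text \<open>This is (2 l choose l) / 4^l, of size about 1 / sqrt (pi l).\<close>

definition central_coeff :: "nat \<Rightarrow> real" where
  "central_coeff l = pochhammer (1 / 2) l / fact l"

lemma central_coeff_pos: "0 < central_coeff l"
  unfolding central_coeff_def by (intro divide_pos_pos pochhammer_pos) auto

text \<open>Passing from k to k + 1 multiplies the coefficient by (k + 1/2) / (k + 1), and k (k + 1)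
  \<le> (k + 1/2)^2.\<close>

lemma central_coeff_square_mono:
  assumes "1 \<le> l" "l \<le> h"
  shows "real l * (central_coeff l)\<^sup>2 \<le> real h * (central_coeff h)\<^sup>2"
  using assms(2)
proof (induction h rule: dec_induct)
  case (step k)
  have k: "real k \<ge> 1" using step assms by simp
  have "central_coeff (Suc k) = central_coeff k * ((real k + 1 / 2) / (real k + 1))"
    by (simp add: central_coeff_def pochhammer_rec' field_simps)
  then have "real (Suc k) * (central_coeff (Suc k))\<^sup>2 =
      (central_coeff k)\<^sup>2 * ((real k + 1) * ((real k + 1 / 2) / (real k + 1))\<^sup>2)"
    by (simp only: power_mult_distrib of_nat_Suc add.commute[of 1] mult_ac)
  moreover have "real k \<le> (real k + 1) * ((real k + 1 / 2) / (real k + 1))\<^sup>2"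
  proof -
    have "(real k + 1) * ((real k + 1 / 2) / (real k + 1))\<^sup>2 = (real k + 1 / 2)\<^sup>2 / (real k + 1)"
      using k by (simp add: power_divide power2_eq_square)
    moreover have "real k * (real k + 1) \<le> (real k + 1 / 2)\<^sup>2"
      by (simp add: power2_eq_square algebra_simps)
    ultimately show ?thesis using k by (simp add: pos_le_divide_eq)
  qed
  ultimately have "(central_coeff k)\<^sup>2 * real k \<le> real (Suc k) * (central_coeff (Suc k))\<^sup>2"
    by (metis mult_left_mono zero_le_power2)
  then show ?case using step.IH by (simp add: mult.commute)
qed simp

lemma central_coeff_ratio_less:
  assumes "j < h"
  shows "central_coeff (h - j) / central_coeff h \<le> sqrt (real h / (real h - real j))"
proof (rule real_le_rsqrt)
  have "real (h - j) * (central_coeff (h - j))\<^sup>2 \<le> real h * (central_coeff h)\<^sup>2"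
    by (rule central_coeff_square_mono) (use assms in auto)
  then show "(central_coeff (h - j) / central_coeff h)\<^sup>2 \<le> real h / (real h - real j)"
    using assms central_coeff_pos[of h]
    by (simp add: power_divide of_nat_diff field_simps)
qed

text \<open>At j = h the bound by sqrt (h / (h - j)) breaks down. There the coefficient at h is
  compared with \<open>central_coeff 1\<close>, which is 1/2; hence the factor 2.\<close>

lemma central_coeff_ratio_le:
  assumes "j \<le> h" "h \<ge> 1"
  shows "central_coeff (h - j) / central_coeff h \<le> 2 * sqrt (real h)"
proof (cases "j = h")
  case True
  have c1: "central_coeff 1 = 1 / 2" by (simp add: central_coeff_def)
  have "real 1 * (central_coeff 1)\<^sup>2 \<le> real h * (central_coeff h)\<^sup>2"
    by (rule central_coeff_square_mono) (use assms in auto)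
  then have "1 \<le> (2 * sqrt (real h) * central_coeff h)\<^sup>2"
    unfolding c1 by (simp add: power_mult_distrib power_divide)
  then have "1 \<le> 2 * sqrt (real h) * central_coeff h"
    using central_coeff_pos[of h]
    by (intro power2_le_imp_le[of 1]) auto
  then show ?thesis using True central_coeff_pos[of h] by (simp add: central_coeff_def[of 0] field_simps)
next
  case False
  then have "central_coeff (h - j) / central_coeff h \<le> sqrt (real h / (real h - real j))"
    using assms by (intro central_coeff_ratio_less) auto
  also have "\<dots> \<le> sqrt (real h)"
  proof (rule real_sqrt_le_mono)
    have "real h - real j \<ge> 1" using False assms by simp
    then show "real h / (real h - real j) \<le> real h" by (simp add: divide_le_eq)
  qed
  also have "\<dots> \<le> 2 * sqrt (real h)" by simp
  finally show ?thesis .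
qed

text \<open>Near the mean 1 / (d + 1) of x, where the ratio of central coefficients is close to
  (1 - x) powr (-1 / 2), the two factors cancel up to exp (x^2); the crude last term pays for
  x > 1 / 2.\<close>

lemma overlap_factor_le:
  fixes h d j :: nat
  assumes d: "d \<ge> 3" and h: "h \<ge> 1" and j: "j \<le> h"
  defines "x \<equiv> real j / real h"
  shows "central_coeff (h - j) / central_coeff h * exp (- (real d * x) / (2 * (real d - 1 + x))) \<le>
    1 + 4 / (real d)\<^sup>2 + 36 * sqrt (real h) * (x - 1 / (real d + 1))\<^sup>2"
proof -
  define y where "y = x - 1 / (real d + 1)"
  define E where "E = exp (- (real d * x) / (2 * (real d - 1 + x)))"
  have D: "real d \<ge> 3" using d by simp
  have x: "0 \<le> x" "x \<le> 1" using j h by (auto simp: x_def divide_le_eq)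
  have H: "1 \<le> sqrt (real h)" using h by simp
  have E: "0 \<le> E" "E \<le> 1" using D x by (auto simp: E_def intro!: divide_nonneg_pos)
  have x0: "1 / (real d + 1) \<le> 1 / real d" "1 / (real d + 1) \<le> 1 / 4" "0 \<le> 1 / (real d + 1)"
    using D by (auto simp: field_simps)
  show ?thesis
  proof (cases "x \<le> 1 / 2")
    case True
    have jh: "j < h" using True j h by (cases "j = h") (auto simp: x_def)
    have hx: "real h / (real h - real j) = 1 / (1 - x)"
      using jh by (simp add: x_def field_simps)
    have "sqrt (1 / (1 - x)) = exp (- ln (1 - x) / 2)"
    proof -
      have "exp (- ln (1 - x) / 2) = sqrt (exp (- ln (1 - x)))"
        by (rule real_sqrt_unique[symmetric]) (simp_all add: exp_double[symmetric])
      then show ?thesis using True by (simp add: exp_minus inverse_eq_divide)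
    qed
    moreover have "- ln (1 - x) \<le> x + 2 * x\<^sup>2"
      using ln_one_minus_pos_lower_bound[OF x(1) True] by simp
    ultimately have s: "sqrt (1 / (1 - x)) \<le> exp ((x + 2 * x\<^sup>2) / 2)" by simp
    have "x \<le> real d * x / (real d - 1 + x)"
      using D x mult_left_mono[of "real d - 1 + x" "real d" x] by (simp add: pos_le_divide_eq mult.commute)
    then have "- (real d * x / (real d - 1 + x)) / 2 \<le> - x / 2" by (intro divide_right_mono) auto
    moreover have "- (real d * x) / (2 * r) = - (real d * x / r) / 2" for r
      by (simp add: mult.commute)
    ultimately have e: "E \<le> exp (- x / 2)"
      unfolding E_def exp_le_cancel_iff by (simp only:)
    have "central_coeff (h - j) / central_coeff h * E \<le> exp ((x + 2 * x\<^sup>2) / 2) * exp (- x / 2)"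
      using central_coeff_ratio_less[OF jh] s e E
      unfolding hx by (intro mult_mono) auto
    also have "\<dots> = exp (x\<^sup>2)" by (simp add: exp_add[symmetric] add_divide_distrib)
    also have "\<dots> \<le> 1 + x\<^sup>2 + (x\<^sup>2)\<^sup>2"
      by (rule exp_bound) (use x in \<open>auto simp: power_le_one\<close>)
    also have "(x\<^sup>2)\<^sup>2 \<le> x\<^sup>2"
      using x power_decreasing[of 2 4 x] by simp
    also have "x\<^sup>2 \<le> 2 * (1 / real d)\<^sup>2 + 2 * y\<^sup>2"
    proof -
      have "x = 1 / (real d + 1) + y" by (simp add: y_def)
      then have "x\<^sup>2 \<le> 2 * (1 / (real d + 1))\<^sup>2 + 2 * y\<^sup>2"
        using zero_le_power2[of "1 / (real d + 1) - y"] by (simp add: power2_eq_square algebra_simps)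
      moreover have "(1 / (real d + 1))\<^sup>2 \<le> (1 / real d)\<^sup>2" by (intro power_mono x0)
      ultimately show ?thesis by linarith
    qed
    finally have "central_coeff (h - j) / central_coeff h * E \<le> 1 + 4 * (1 / real d)\<^sup>2 + 4 * y\<^sup>2" by linarith
    moreover have "4 * y\<^sup>2 \<le> 36 * sqrt (real h) * y\<^sup>2"
    proof (rule mult_right_mono)
      show "4 \<le> 36 * sqrt (real h)" using H by linarith
    qed simp
    ultimately show ?thesis by (simp add: E_def y_def power_divide)
  next
    case False
    have "central_coeff (h - j) / central_coeff h * E \<le> (2 * sqrt (real h)) * 1"
      using central_coeff_ratio_le[OF j h] E by (intro mult_mono) auto
    also have "\<dots> \<le> 36 * sqrt (real h) * y\<^sup>2"
    proof -
      \<comment> \<open>Here x > 1/2 while 1 / (d + 1) \<le> 1/4. So y^2 \<ge> 1/16, and 18 y^2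
        \<ge> 1 explains 36 = 2 * 18.\<close>
      have "1 / 4 \<le> y" using False x0 unfolding y_def by linarith
      then have "(1 / 4)\<^sup>2 \<le> y\<^sup>2" by (intro power_mono) auto
      then have "1 \<le> 18 * y\<^sup>2" by (simp add: power_divide)
      then have "(2 * sqrt (real h)) * 1 \<le> (2 * sqrt (real h)) * (18 * y\<^sup>2)"
        by (intro mult_left_mono) auto
      then show ?thesis by simp
    qed
    finally show ?thesis by (simp add: E_def y_def add_increasing)
  qed
qed

section \<open>Loop probabilities of the three pairing models\<close>

lemma real_choose_two: "real (k choose 2) = real k * (real k - 1) / 2"
  by (induction k) (simp_all add: numeral_2_eq_2 field_simps)

lemma quarter_square_le:
  fixes m :: real
  assumes "m \<ge> 8"
  shows "m\<^sup>2 / 4 \<le> (m - 1) * (m - 3)"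
proof -
  have "8 * m \<le> m * m" using assms by (intro mult_right_mono) auto
  moreover have "(m - 1) * (m - 3) = m * m - 4 * m + 3" by (simp add: algebra_simps)
  ultimately show ?thesis using assms unfolding power2_eq_square by linarith
qed

text \<open>Here B / m = d / 2. One d^2 / n comes from the squared binomial coefficients, the other
  from the 2 D in the denominators.\<close>

lemma card_pairings_Suc_le:
  fixes n d :: nat
  assumes n: "n \<ge> 12" and d: "d \<ge> 1"
  shows "real (card (pairings n (Suc d))) \<le>
    real (matching_count (n * Suc d)) * exp (- real d / 2 + 2 * (real d)\<^sup>2 / real n)"
proof -
  define D N m b where "D = real d" and "N = real n" and "m = real (n * Suc d)"
    and "b = real (Suc d choose 2)"
  have D: "D \<ge> 1" and N: "N \<ge> 12" using n d by (simp_all add: D_def N_def)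
  have m: "m = N * (D + 1)" by (simp add: m_def N_def D_def algebra_simps)
  have b: "b = D * (D + 1) / 2" by (simp add: b_def real_choose_two D_def algebra_simps)
  have m8: "m \<ge> 8" unfolding m using D N mult_mono[of 8 N 1 "D + 1"] by simp
  have "8 + 4 * Suc d \<le> n * Suc d"
    using mult_right_mono[of 12 n "Suc d"] n by simp
  then have "real (card (pairings n (Suc d))) \<le> real (matching_count (card (points n (Suc d)))) *
     exp (\<Sum>v\<in>{..<n}. (real (card (bin (points n (Suc d)) v) choose 2))\<^sup>2 /
         ((real (card (points n (Suc d))) - 1) * (real (card (points n (Suc d))) - 3)) -
        real (card (bin (points n (Suc d)) v) choose 2) / (real (card (points n (Suc d))) - 1 + 2 * real (Suc d)))"
    by (intro card_loopless_le) (auto simp: card_bin_points)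
  also have "(\<Sum>v\<in>{..<n}. (real (card (bin (points n (Suc d)) v) choose 2))\<^sup>2 /
         ((real (card (points n (Suc d))) - 1) * (real (card (points n (Suc d))) - 3)) -
        real (card (bin (points n (Suc d)) v) choose 2) / (real (card (points n (Suc d))) - 1 + 2 * real (Suc d)))
      = (\<Sum>v\<in>{..<n}. b\<^sup>2 / ((m - 1) * (m - 3)) - b / (m - 1 + 2 * (D + 1)))"
    by (intro sum.cong refl) (simp only: card_bin_points card_points lessThan_iff if_True m_def b_def D_def of_nat_Suc add.commute)
  also have "\<dots> = N * (b\<^sup>2 / ((m - 1) * (m - 3)) - b / (m - 1 + 2 * (D + 1)))"
    by (simp add: N_def)
  also have "\<dots> \<le> - D / 2 + 2 * D\<^sup>2 / N"
  proof -
    have "b\<^sup>2 / ((m - 1) * (m - 3)) \<le> b\<^sup>2 / (m\<^sup>2 / 4)"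
      using m8 by (intro divide_left_mono quarter_square_le mult_pos_pos) auto
    also have "\<dots> = D\<^sup>2 / N\<^sup>2"
      using D N unfolding b m by (simp add: power_divide power_mult_distrib)
    finally have 1: "N * (b\<^sup>2 / ((m - 1) * (m - 3))) \<le> D\<^sup>2 / N"
      using N mult_left_mono[of "b\<^sup>2 / ((m - 1) * (m - 3))" "D\<^sup>2 / N\<^sup>2" N] by (simp add: power2_eq_square)
    have "N * b / (m + 2 * (D + 1)) = D * (N * (D + 1)) / (2 * ((N + 2) * (D + 1)))"
      unfolding b m by (simp add: algebra_simps)
    also have "\<dots> = D * N / (2 * (N + 2))" using D by simp
    also have "\<dots> = D / 2 - D / (N + 2)" using N by (simp add: field_simps)
    finally have "D / 2 - D / N \<le> N * b / (m + 2 * (D + 1))"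
      using D N divide_left_mono[of N "N + 2" D] by simp
    also have "\<dots> \<le> N * b / (m - 1 + 2 * (D + 1))"
      using D N m8 by (intro divide_left_mono mult_nonneg_nonneg mult_pos_pos) (auto simp: b)
    finally have 2: "D / 2 - D / N \<le> N * (b / (m - 1 + 2 * (D + 1)))" by simp
    have "D / N \<le> D\<^sup>2 / N" using D N by (intro divide_right_mono) (auto simp: self_le_power)
    then show ?thesis using 1 2 by (simp add: right_diff_distrib)
  qed
  finally show ?thesis by (simp add: D_def N_def mult_left_mono)
qed

text \<open>Here B / m = (d - 1) / 2. One d^2 / n pays for m - 1 in place of m, two pay for ln (1 -
  y) \<ge> - y - 2 y^2, where d \<le> n ensures y \<le> 1/2.\<close>

lemma card_pairings_ge:
  fixes n d :: nat
  assumes n: "n \<ge> 12" and d: "d \<ge> 2" and dn: "d \<le> n"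
  shows "real (matching_count (n * d)) * exp (- (real d - 1) / 2 - 3 * (real d)\<^sup>2 / real n)
    \<le> real (card (pairings n d))"
proof -
  define D N m b where "D = real d" and "N = real n" and "m = real (n * d)"
    and "b = real (d choose 2)"
  have D: "D \<ge> 2" and N: "N \<ge> 12" and DN: "D \<le> N" using n d dn by (simp_all add: D_def N_def)
  have m: "m = N * D" by (simp add: m_def N_def D_def)
  have b: "b = D * (D - 1) / 2" by (simp add: b_def real_choose_two D_def)
  have m24: "m \<ge> 24" unfolding m using D N mult_mono[of 12 N 2 D] by simp
  define y where "y = b / (m - 1)"
  have y0: "0 \<le> y" unfolding y_def b using D m24 by simp
  have "y \<le> b / (m / 2)" unfolding y_def using m24 D by (intro divide_left_mono) (auto simp: b)
  also have "b / (m / 2) = (D - 1) / N" unfolding b m using D N by (simp add: field_simps)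
  finally have y1: "y \<le> (D - 1) / N" .
  have "D * (D - 1) \<le> D * N - D" using DN D by (simp add: algebra_simps)
  moreover have "2 * b = D * (D - 1)" by (simp add: b)
  ultimately have bm: "2 * b \<le> m - 1" using D by (simp add: m mult.commute)
  then have yh: "y \<le> 1 / 2" unfolding y_def using m24 by (simp add: field_simps)
  have Ny: "N * y \<le> (D - 1) / 2 + D\<^sup>2 / N"
  proof -
    have "N * y = (D - 1) / 2 * (m / (m - 1))" unfolding y_def b m by simp
    also have "m / (m - 1) = 1 + 1 / (m - 1)" using m24 by (simp add: field_simps)
    also have "(D - 1) / 2 * (1 + 1 / (m - 1)) = (D - 1) / 2 + (D - 1) / (2 * (m - 1))"
      by (simp add: distrib_left)
    also have "(D - 1) / (2 * (m - 1)) \<le> D\<^sup>2 / N"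
    proof (rule frac_le)
      show "D - 1 \<le> D\<^sup>2" using self_le_power[of D 2] D by simp
      have "N * 2 \<le> m" unfolding m using D N by (intro mult_left_mono) auto
      then show "N \<le> 2 * (m - 1)" using N by simp
    qed (use D N in auto)
    finally show ?thesis by simp
  qed
  have "N * (2 * y\<^sup>2) \<le> N * (2 * ((D - 1) / N)\<^sup>2)"
    using y0 y1 N by (intro mult_left_mono power_mono) auto
  also have "\<dots> = 2 * (D - 1)\<^sup>2 / N" using N by (simp add: power2_eq_square)
  also have "\<dots> \<le> 2 * D\<^sup>2 / N" using D N by (intro divide_right_mono mult_left_mono power_mono) auto
  finally have Ny2: "N * (2 * y\<^sup>2) \<le> 2 * D\<^sup>2 / N" .
  have "exp (- (D - 1) / 2 - 3 * D\<^sup>2 / N) \<le> exp (N * (- y - 2 * y\<^sup>2))"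
    unfolding exp_le_cancel_iff using Ny Ny2 by (simp add: algebra_simps add_divide_distrib diff_divide_distrib)
  also have "\<dots> = exp (- y - 2 * y\<^sup>2) ^ n" by (simp add: N_def exp_of_nat_mult)
  also have "\<dots> \<le> (1 - y) ^ n"
  proof (rule power_mono)
    have "exp (- y - 2 * y\<^sup>2) \<le> exp (ln (1 - y))"
      unfolding exp_le_cancel_iff by (rule ln_one_minus_pos_lower_bound[OF y0 yh])
    then show "exp (- y - 2 * y\<^sup>2) \<le> 1 - y" using yh by simp
  qed simp
  finally have "real (matching_count (n * d)) * exp (- (D - 1) / 2 - 3 * D\<^sup>2 / N)
      \<le> real (matching_count (n * d)) * (1 - y) ^ n" by (intro mult_left_mono) auto
  also have "(1 - y) ^ n = (\<Prod>v\<in>{..<n}. 1 - real (card (bin (points n d) v) choose 2) / (real (card (points n d)) - 1))"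
    by (simp add: card_bin_points y_def b_def m_def)
  also have "real (matching_count (n * d)) * \<dots> \<le> real (card (pairings n d))"
  proof -
    have "0 \<le> b" using D by (simp add: b)
    then have "b \<le> m - 1" using bm by linarith
    moreover have "2 \<le> n * d" using n d mult_le_mono[of 2 n 1 d] by simp
    ultimately show ?thesis
      using card_loopless_ge[of "points n d" "{..<n}"] by (simp add: card_bin_points b_def m_def)
  qed
  finally show ?thesis by (simp add: D_def N_def)
qed

text \<open>The k = x n bins of agreement keep d points and the others d - 1. So m = n (d - 1 + x)
  and B / m = (d - 2) / 2 + d x / (2 (d - 1 + x)). The squared terms and the denominators cost 4 d^2
  / n each.\<close>

lemma card_residual_loopless_le:
  fixes n d :: nat
  assumes n: "n \<ge> 16" and d: "d \<ge> 3"
    and c: "c \<in> colourings n (Suc d)" "c' \<in> colourings n (Suc d)"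
  defines "k \<equiv> card {v\<in>{..<n}. c v = c' v}"
  defines "x \<equiv> real k / real n"
  shows "real (card (loopless (points n (Suc d) - transversal n c - transversal n c') {..<n})) \<le>
    real (matching_count (n * (d - 1) + k)) *
      exp (- (real d - 2) / 2 - real d * x / (2 * (real d - 1 + x)) + 8 * (real d)\<^sup>2 / real n)"
proof -
  define S where "S = points n (Suc d) - transversal n c - transversal n c'"
  define D N m b1 b2 where "D = real d" and "N = real n" and "m = real (card S)"
    and "b1 = real (d choose 2)" and "b2 = real ((d - 1) choose 2)"
  have kn: "k \<le> n" unfolding k_def by (rule order_trans[OF card_mono[of "{..<n}"]]) auto
  have D: "D \<ge> 3" and N: "N \<ge> 16" using n d by (simp_all add: D_def N_def)
  have x: "0 \<le> x" "x \<le> 1" and kx: "real k = N * x" using kn n by (auto simp: x_def N_def divide_le_eq)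
  have cS: "card S = n * (d - 1) + k" unfolding S_def k_def using card_residual[OF c] d by simp
  then have "m = N * (D - 1) + real k" using d by (simp add: m_def N_def D_def of_nat_diff)
  then have m: "m = N * (D - 1 + x)" unfolding kx by (simp add: algebra_simps)
  have b1: "b1 = D * (D - 1) / 2" by (simp add: b1_def real_choose_two D_def)
  have b2: "b2 = (D - 1) * (D - 2) / 2" using d by (simp add: b2_def real_choose_two D_def of_nat_diff)
  have mN: "N * D / 2 \<le> m"
  proof -
    have "N * (D / 2) \<le> N * (D - 1 + x)" using D N x by (intro mult_left_mono) auto
    then show ?thesis by (simp add: m)
  qed
  have ND: "N * 3 \<le> N * D" using D N by (intro mult_left_mono) auto
  have m8: "m \<ge> 8" using mN ND N by linarith
  have fin: "finite S" by (simp add: S_def)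
  have bins: "card (bin S v) = (if v < n then if c v = c' v then d else d - 1 else 0)" for v
    unfolding S_def by (rule card_bin_residual[OF c])
  have "8 + 4 * d \<le> card S"
  proof -
    have "16 * (d - 1) \<le> n * (d - 1)" using n by (intro mult_right_mono) auto
    then show ?thesis using cS d by linarith
  qed
  then have "real (card (loopless S {..<n})) \<le> real (matching_count (card S)) *
     exp (\<Sum>v\<in>{..<n}. (real (card (bin S v) choose 2))\<^sup>2 / ((m - 1) * (m - 3)) -
        real (card (bin S v) choose 2) / (m - 1 + 2 * D))"
    unfolding m_def D_def by (intro card_loopless_le fin) (auto simp: bins)
  also have "(\<Sum>v\<in>{..<n}. (real (card (bin S v) choose 2))\<^sup>2 / ((m - 1) * (m - 3)) -
        real (card (bin S v) choose 2) / (m - 1 + 2 * D)) \<le>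
     - (D - 2) / 2 - D * x / (2 * (D - 1 + x)) + 8 * D\<^sup>2 / N"
  proof -
    have b: "0 \<le> b2" "b2 \<le> b1" "b1 \<le> D\<^sup>2 / 2"
      unfolding b1 b2 using D by (auto simp: power2_eq_square intro: mult_right_mono)
    have cb: "real (card (bin S v) choose 2) = (if c v = c' v then b1 else b2)" if "v < n" for v
      using that by (simp add: bins b1_def b2_def)
    have "(\<Sum>v<n. (real (card (bin S v) choose 2))\<^sup>2 / ((m - 1) * (m - 3))) \<le> (\<Sum>v<n. 4 * D\<^sup>2 / N\<^sup>2)"
    proof (rule sum_mono)
      fix v assume "v \<in> {..<n}"
      then have "real (card (bin S v) choose 2) \<le> D\<^sup>2 / 2" using cb b by auto
      then have "(real (card (bin S v) choose 2))\<^sup>2 \<le> (D\<^sup>2 / 2)\<^sup>2" by (intro power_mono) auto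
      moreover have "(N * D / 2)\<^sup>2 / 4 \<le> (m - 1) * (m - 3)"
      proof -
        have "(N * D / 2)\<^sup>2 \<le> m\<^sup>2" using mN N D by (intro power_mono) auto
        then show ?thesis using quarter_square_le[OF m8] by linarith
      qed
      ultimately have "(real (card (bin S v) choose 2))\<^sup>2 / ((m - 1) * (m - 3)) \<le> (D\<^sup>2 / 2)\<^sup>2 / ((N * D / 2)\<^sup>2 / 4)"
        using N D by (intro frac_le) auto
      also have "\<dots> = 4 * D\<^sup>2 / N\<^sup>2" using N D by (simp add: power_divide power_mult_distrib power2_eq_square)
      finally show "(real (card (bin S v) choose 2))\<^sup>2 / ((m - 1) * (m - 3)) \<le> 4 * D\<^sup>2 / N\<^sup>2" .
    qed
    also have "\<dots> = 4 * D\<^sup>2 / N" using N by (simp add: N_def[symmetric] power2_eq_square)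
    finally have 1: "(\<Sum>v<n. (real (card (bin S v) choose 2))\<^sup>2 / ((m - 1) * (m - 3))) \<le> 4 * D\<^sup>2 / N" .
    define B where "B = N * ((D - 1) * (D - 2 + 2 * x) / 2)"
    have "(\<Sum>v<n. real (card (bin S v) choose 2)) = (\<Sum>v<n. b2 + (if c v = c' v then b1 - b2 else 0))"
      by (intro sum.cong refl) (use cb in auto)
    also have "\<dots> = N * b2 + real k * (b1 - b2)"
      by (simp add: sum.distrib N_def k_def sum.inter_filter[symmetric])
    also have "\<dots> = B" unfolding B_def kx b1 b2 by (simp add: field_simps)
    finally have Bsum: "(\<Sum>v<n. real (card (bin S v) choose 2)) = B" .
    have B0: "0 \<le> B" unfolding B_def using D N x by simp
    have B1: "B \<le> N * D\<^sup>2 / 2"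
    proof -
      have "(D - 1) * (D - 2 + 2 * x) \<le> D * D" using D x by (intro mult_mono) auto
      then have "N * ((D - 1) * (D - 2 + 2 * x) / 2) \<le> N * (D * D / 2)"
        using N by (intro mult_left_mono) auto
      then show ?thesis by (simp add: B_def power2_eq_square)
    qed
    \<comment> \<open>First-order expansion of 1 / (m + 2 D), based on (1 + 2 D / m) (1 - 2 D / m)
      \<le> 1.\<close>
    have "B / m - 2 * D * B / m\<^sup>2 \<le> B / (m + 2 * D)"
    proof -
      have "(m + 2 * D) * (B / m - 2 * D * B / m\<^sup>2) = B - 4 * D\<^sup>2 * B / m\<^sup>2"
        using m8 by (simp add: field_simps power2_eq_square)
      also have "\<dots> \<le> B" using B0 by simp
      finally show ?thesis using m8 D by (simp add: pos_le_divide_eq mult.commute)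
    qed
    also have "\<dots> \<le> B / (m - 1 + 2 * D)" using B0 m8 D by (intro divide_left_mono mult_pos_pos) auto
    finally have 2: "B / m - 2 * D * B / m\<^sup>2 \<le> B / (m - 1 + 2 * D)" .
    have "2 * D * B / m\<^sup>2 \<le> 2 * D * (N * D\<^sup>2 / 2) / (N * D / 2)\<^sup>2"
    proof (rule frac_le)
      show "2 * D * B \<le> 2 * D * (N * D\<^sup>2 / 2)" using B1 D by (intro mult_left_mono) auto
      show "(N * D / 2)\<^sup>2 \<le> m\<^sup>2" using mN N D by (intro power_mono) auto
    qed (use N D in auto)
    also have "\<dots> = 4 * D / N" using N D by (simp add: power2_eq_square)
    also have "\<dots> \<le> 4 * D\<^sup>2 / N" using N D by (intro divide_right_mono) (auto simp: self_le_power)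
    finally have 3: "2 * D * B / m\<^sup>2 \<le> 4 * D\<^sup>2 / N" .
    have "B / m = ((D - 1) * (D - 2 + 2 * x)) / (2 * (D - 1 + x))"
      unfolding B_def m using N by simp
    also have "(D - 1) * (D - 2 + 2 * x) = (D - 2) * (D - 1 + x) + D * x" by (simp add: algebra_simps)
    also have "\<dots> / (2 * (D - 1 + x)) = (D - 2) / 2 + D * x / (2 * (D - 1 + x))"
    proof -
      have "((D - 2) * q + y) / (2 * q) = (D - 2) / 2 + y / (2 * q)" if "q \<noteq> 0" for q y :: real
        using that by (simp add: add_divide_distrib)
      moreover have "D - 1 + x \<noteq> 0" using D x by linarith
      ultimately show ?thesis by blast
    qed
    finally have 4: "B / m = (D - 2) / 2 + D * x / (2 * (D - 1 + x))" .
    have "(\<Sum>v<n. real (card (bin S v) choose 2) / (m - 1 + 2 * D)) = B / (m - 1 + 2 * D)"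
      unfolding Bsum[symmetric] by (rule sum_divide_distrib[symmetric])
    moreover have "8 * D\<^sup>2 / N = 4 * D\<^sup>2 / N + 4 * D\<^sup>2 / N" by simp
    ultimately show ?thesis unfolding sum_subtractf using 1 2 3 4 by linarith
  qed
  finally show ?thesis unfolding S_def[symmetric] cS D_def N_def by (simp add: mult_left_mono)
qed


section \<open>Assembling the second moment\<close>

text \<open>This is where the negative binomial law arises. The double factorial of the residual
  points yields the rising factorial of a, the powers of d yield z = 1 / d^2, and (h choose j)
  \<open>pochhammer (1 / 2) (h - j)\<close> yields 1 / j! and the ratio of central coefficients.
  \<open>E\<close> stands for the probability that the residual points have no loop.\<close>

lemma second_moment_summand_eq:
  fixes h d j :: nat and E :: real
  assumes d: "d \<ge> 3" and j: "j \<le> h"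
  defines "a \<equiv> real h * (real d - 1) + 1 / 2" and "z \<equiv> 1 / (real d)\<^sup>2"
  shows "real (2 * h choose (2 * j)) * (real d ^ (2 * h - 2 * j) *
      (real (matching_count (2 * j)) * (real (matching_count (2 * h - 2 * j)))\<^sup>2 *
        (real (matching_count (2 * h * (d - 1) + 2 * j)) * E))) =
    real (matching_count (2 * h)) * (real d ^ (2 * h) * 2 ^ (h * d) *
      pochhammer (1 / 2) h * pochhammer (1 / 2) (h * (d - 1))) *
      (nb_weight a z j * (central_coeff (h - j) / central_coeff h * E))"
proof -
  let ?p = "pochhammer (1 / 2 :: real)"
  have e: "2 * h - 2 * j = 2 * (h - j)" "2 * h * (d - 1) + 2 * j = 2 * (h * (d - 1) + j)" by simp_all
  have "1 / 2 + real (h * (d - 1)) = a" using d by (simp add: a_def of_nat_diff)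
  then have pa: "?p (h * (d - 1) + j) = ?p (h * (d - 1)) * pochhammer a j"
    unfolding pochhammer_product' by (simp only:)
  have "h - j + (h * (d - 1) + j) = h + h * (d - 1)" using j by simp
  also have "\<dots> = h * d" using d by (cases d) simp_all
  finally have p2: "(2 :: real) ^ (h - j) * 2 ^ (h * (d - 1) + j) = 2 ^ (h * d)"
    by (simp only: power_add[symmetric])
  have dz: "real d ^ (2 * (h - j)) = real d ^ (2 * h) * z ^ j"
  proof -
    have "real d ^ (2 * h) = real d ^ (2 * (h - j)) * (real d)\<^sup>2 ^ j"
      unfolding power_mult[symmetric] power_add[symmetric] using j
      by (intro arg_cong2[of _ _ _ _ power] refl) simp
    then show ?thesis using d by (simp add: z_def power_divide)
  qed
  have "?p h \<noteq> 0" using pochhammer_pos[of "1 / 2 :: real" h] by simp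
  then have cc: "real (h choose j) * ?p (h - j) = ?p h * (central_coeff (h - j) / central_coeff h) / fact j"
    unfolding binomial_fact[OF j, where 'a = real] central_coeff_def by (simp add: mult.commute)
  have "real (2 * h choose (2 * j)) * (real d ^ (2 * h - 2 * j) *
      (real (matching_count (2 * j)) * (real (matching_count (2 * h - 2 * j)))\<^sup>2 *
        (real (matching_count (2 * h * (d - 1) + 2 * j)) * E))) =
    (real (2 * h choose (2 * j)) * real (matching_count (2 * j)) * real (matching_count (2 * (h - j)))) *
    (real d ^ (2 * (h - j)) * real (matching_count (2 * (h - j))) *
      real (matching_count (2 * (h * (d - 1) + j))) * E)"
    unfolding e power2_eq_square by (simp only: mult_ac)
  also have "\<dots> = real (matching_count (2 * h)) * real (h choose j) *
    (real d ^ (2 * h) * z ^ j * (2 ^ (h - j) * ?p (h - j)) *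
      (2 ^ (h * (d - 1) + j) * (?p (h * (d - 1)) * pochhammer a j)) * E)"
    unfolding binomial_matching_count[OF j] unfolding dz matching_count_even pa ..
  also have "\<dots> = real (matching_count (2 * h)) * real d ^ (2 * h) *
     (2 ^ (h - j) * 2 ^ (h * (d - 1) + j)) * ?p (h * (d - 1)) *
     (real (h choose j) * ?p (h - j)) * (pochhammer a j * z ^ j) * E"
    by (simp only: mult_ac)
  also have "\<dots> = real (matching_count (2 * h)) * (real d ^ (2 * h) * 2 ^ (h * d) *
      ?p h * ?p (h * (d - 1))) *
      (nb_weight a z j * (central_coeff (h - j) / central_coeff h * E))"
    unfolding p2 cc nb_weight_def by (simp add: mult_ac)
  finally show ?thesis .
qed

lemma second_moment_sum_le:
  fixes h d :: nat
  assumes d: "d \<ge> 3" and dh: "d\<^sup>2 \<le> h" and h8: "h \<ge> 8"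
  defines "n \<equiv> 2 * h"
  defines "a \<equiv> real h * (real d - 1) + 1 / 2" and "z \<equiv> 1 / (real d)\<^sup>2"
  shows "real (\<Sum>c\<in>colourings n (Suc d). \<Sum>c'\<in>colourings n (Suc d).
            card (matched n (Suc d) c \<inter> matched n (Suc d) c')) \<le>
    real (Suc d) ^ n * (real (matching_count n) * (real d ^ (2 * h) * 2 ^ (h * d) *
      pochhammer (1 / 2) h * pochhammer (1 / 2) (h * (d - 1))) *
      (exp (- (real d - 2) / 2 + 8 * (real d)\<^sup>2 / real n) * ((1 - z) powr (- a) * (1 + 184 / (real d)\<^sup>2))))"
proof -
  define E0 where "E0 = exp (- (real d - 2) / 2 + 8 * (real d)\<^sup>2 / real n)"
  define E where "E = (\<lambda>x. exp (- (real d * x) / (2 * (real d - 1 + x))))"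
  define N where "N = (\<lambda>k. real (matching_count (n * (d - 1) + k)) * (E0 * E (real k / real n)))"
  define K where "K = real (matching_count n) * (real d ^ (2 * h) * 2 ^ (h * d) *
      pochhammer (1 / 2) h * pochhammer (1 / 2) (h * (d - 1)))"
  have K: "0 \<le> K" unfolding K_def by (intro mult_nonneg_nonneg pochhammer_nonneg) auto
  have E0: "0 \<le> E0" by (simp add: E0_def)
  let ?f = "\<lambda>k. real (n choose k) * (real d ^ (n - k) *
      (real (matching_count k) * (real (matching_count (n - k)))\<^sup>2 * N k))"
  have "real (\<Sum>c\<in>colourings n (Suc d). \<Sum>c'\<in>colourings n (Suc d).
            card (matched n (Suc d) c \<inter> matched n (Suc d) c')) \<le> real (Suc d) ^ n * (\<Sum>k\<le>n. ?f k)"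
  proof (rule second_moment_le)
    fix c c' assume c: "c \<in> colourings n (Suc d)" "c' \<in> colourings n (Suc d)"
    define x where "x = real (card {v \<in> {..<n}. c v = c' v}) / real n"
    have "exp (- (real d - 2) / 2 - real d * x / (2 * (real d - 1 + x)) + 8 * (real d)\<^sup>2 / real n) = E0 * E x"
      unfolding E0_def E_def exp_add[symmetric] by simp
    then show "real (card (loopless (points n (Suc d) - transversal n c - transversal n c') {..<n})) \<le>
        N (card {v \<in> {..<n}. c v = c' v})"
      using card_residual_loopless_le[OF _ d c] h8 by (simp add: N_def x_def n_def)
  qed
  \<comment> \<open>An odd overlap contributes 0, as the common points then have no perfect
    matching.\<close>
  also have "(\<Sum>k\<le>n. ?f k) = (\<Sum>j\<le>h. ?f (2 * j))"
    unfolding n_def by (rule sum_even_terms) (simp add: matching_count_odd)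
  also have "\<dots> = (\<Sum>j\<le>h. K * E0 * (nb_weight a z j *
      (central_coeff (h - j) / central_coeff h * E (real j / real h))))"
  proof (rule sum.cong[OF refl])
    fix j assume "j \<in> {..h}"
    then have j: "j \<le> h" by simp
    have x: "real (2 * j) / real n = real j / real h" by (simp add: n_def)
    show "?f (2 * j) = K * E0 * (nb_weight a z j *
        (central_coeff (h - j) / central_coeff h * E (real j / real h)))"
      unfolding N_def x unfolding n_def
        second_moment_summand_eq[OF d j, where E = "E0 * E (real j / real h)"]
      by (simp add: K_def n_def a_def z_def)
  qed
  also have "\<dots> = K * E0 * (\<Sum>j\<le>h. nb_weight a z j *
      (central_coeff (h - j) / central_coeff h * E (real j / real h)))"
    by (simp add: sum_distrib_left)
  also have "\<dots> \<le> K * E0 * ((1 - z) powr (- a) * (1 + 184 / (real d)\<^sup>2))"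
    unfolding a_def z_def
  proof (intro mult_left_mono nb_weight_weighted_sum_le[OF d dh] mult_nonneg_nonneg K E0)
    fix j assume "j \<le> h"
    then show "central_coeff (h - j) / central_coeff h * E (real j / real h) \<le>
        1 + 4 / (real d)\<^sup>2 + 36 * sqrt (real h) * (real j / real h - 1 / (real d + 1))\<^sup>2"
      unfolding E_def using h8 by (intro overlap_factor_le[OF d]) auto
  qed
  finally show ?thesis
    by (simp add: K_def E0_def mult_left_mono mult.assoc)
qed

text \<open>Since 1 - 1 / D^2 = (D - 1) (D + 1) / D^2, the mass (1 - z)^(- a) of the negative
  binomial law cancels all powers with exponents growing with h. What survives comes from the
  summand 1/2 in a.\<close>

lemma power_cancellation:
  fixes D :: real and h d :: nat
  assumes d: "d \<ge> 3" and D: "D = real d"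
  shows "((D + 1) ^ (h * (d + 1)) * (D - 1) ^ (h * (d - 1)) / D ^ (2 * (h * d))) *
     (D ^ (2 * h) / (D + 1) ^ (2 * h)) * (1 - 1 / D\<^sup>2) powr (- (real h * (D - 1) + 1 / 2)) =
     (1 - 1 / D\<^sup>2) powr (- (1 / 2))"
proof -
  define k where "k = h * (d - 1)"
  have D3: "D \<ge> 3" using d D by simp
  have k: "real k = real h * (D - 1)" using d D by (simp add: k_def of_nat_diff)
  have e: "h * (d + 1) = k + 2 * h" "2 * (h * d) = 2 * k + 2 * h"
    using d by (auto simp: k_def algebra_simps diff_mult_distrib2 Suc_diff_le)
  have sq: "1 - 1 / D\<^sup>2 = (D - 1) * (D + 1) / D\<^sup>2" using D3 by (simp add: field_simps power2_eq_square)
  have pos: "0 < 1 - 1 / D\<^sup>2" unfolding sq using D3 by simp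
  have "(1 - 1 / D\<^sup>2) powr (- (real h * (D - 1) + 1 / 2)) =
        (1 - 1 / D\<^sup>2) powr (- real k) * (1 - 1 / D\<^sup>2) powr (- (1 / 2))"
    unfolding k[symmetric] powr_add[symmetric] by simp
  also have "(1 - 1 / D\<^sup>2) powr (- real k) = inverse ((1 - 1 / D\<^sup>2) ^ k)"
    using pos by (simp add: powr_minus powr_realpow)
  also have "\<dots> = D ^ (2 * k) / ((D - 1) ^ k * (D + 1) ^ k)"
    unfolding sq by (simp add: power_divide power_mult_distrib power_mult)
  finally show ?thesis
    unfolding e k_def[symmetric] using D3 by (simp add: power_add)
qed


text \<open>In units of 1 / d^2, the constant is 203 = 16 + 2 + 1 + 184: loop probabilities,
  Stirling ratios, the factor (1 - z)^(-1/2), and the overlap sum. The hypothesis \<open>dn\<close>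
  turns d^2 / n into at most 1 / d^2.\<close>

lemma moment_ratio_le:
  fixes h d :: nat
  assumes d: "d \<ge> 15" and dn: "d ^ 4 \<le> 2 * h"
  defines "n \<equiv> 2 * h"
  defines "Z \<equiv> \<Sum>c\<in>colourings n (Suc d). \<Sum>c'\<in>colourings n (Suc d).
            card (matched n (Suc d) c \<inter> matched n (Suc d) c')"
  shows "real (card (pairings n (Suc d))) * real Z /
     (real (Suc d ^ n) * real (card (pairings n d)) * real (matching_count n))\<^sup>2 \<le> exp (203 / (real d)\<^sup>2)"
    and "pairings n d \<noteq> {}"
proof -
  define D H e where "D = real d" and "H = real h" and "e = D\<^sup>2 / real n"
  let ?p = "pochhammer (1 / 2 :: real)"
  let ?mc = "\<lambda>k. real (matching_count k)"
  have d3: "d \<ge> 3" and d1: "d \<ge> 1" "d \<ge> 2" using d by auto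
  have D: "D \<ge> 15" using d by (simp add: D_def)
  have d2: "d * 15 \<le> d\<^sup>2" using d unfolding power2_eq_square by (intro mult_left_mono) auto
  then have d225: "225 \<le> d\<^sup>2" using d by linarith
  have "d\<^sup>2 * 225 \<le> d\<^sup>2 * d\<^sup>2" using d225 by (intro mult_left_mono) auto
  also have "d\<^sup>2 * d\<^sup>2 = d ^ 4" by (simp flip: power_add)
  finally have "d\<^sup>2 * 225 \<le> 2 * h" using dn by simp
  then have dh: "d\<^sup>2 \<le> h" and h8: "h \<ge> 8" and n16: "n \<ge> 16" and n12: "n \<ge> 12" and dlen: "d \<le> n"
    using d225 d2 unfolding n_def by linarith+
  have D2: "D\<^sup>2 > 0" using D by simp
  have Dn: "D ^ 4 \<le> real n"
    using of_nat_mono[OF dn, where 'a = real] by (simp add: D_def n_def)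
  have e: "e \<le> 1 / D\<^sup>2"
  proof -
    have "e \<le> D\<^sup>2 / D ^ 4" unfolding e_def using Dn D n16 by (intro divide_left_mono mult_pos_pos) auto
    also have "D ^ 4 = D\<^sup>2 * D\<^sup>2" by (simp flip: power_add)
    also have "D\<^sup>2 / (D\<^sup>2 * D\<^sup>2) = 1 / D\<^sup>2"
      using D2 by (simp only: divide_divide_eq_left[symmetric]) simp
    finally show ?thesis .
  qed
  define z where "z = 1 / D\<^sup>2"
  define a where "a = H * (D - 1) + 1 / 2"
  define M where "M = (1 - z) powr (- a) * (1 + 184 * z)"
  define K where "K = D ^ (2 * h) * 2 ^ (h * d) * ?p h * ?p (h * (d - 1))"
  define e0 e1 e2 where "e0 = exp (- (D - 1) / 2 - 3 * e)" and "e1 = exp (- D / 2 + 2 * e)"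
    and "e2 = exp (- (D - 2) / 2 + 8 * e)"
  define A1 A0 where "A1 = real (card (pairings n (Suc d)))" and "A0 = real (card (pairings n d))"
  define W where "W = real (Suc d) ^ n"
  have W: "W > 0" by (simp add: W_def)
  have p_pos: "0 < ?p k" for k by (rule pochhammer_pos) simp
  have mc_even: "?mc (2 * h * k) = 2 ^ (h * k) * ?p (h * k)" for k
    using matching_count_even[of "h * k"] by (simp only: mult.assoc)
  have mcn: "?mc n = 2 ^ h * ?p h" unfolding n_def by (rule matching_count_even)
  have mc_pos: "?mc (n * k) > 0" "?mc n > 0" for k
    unfolding n_def mc_even matching_count_even using p_pos by (simp_all del: of_nat_mult)
  have A1: "A1 \<le> ?mc (n * Suc d) * e1"
    using card_pairings_Suc_le[OF n12 d1(1)] by (simp add: A1_def e1_def e_def D_def)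
  have A0: "?mc (n * d) * e0 \<le> A0"
    using card_pairings_ge[OF n12 d1(2) dlen] by (simp add: A0_def e0_def e_def D_def)
  have A00: "0 < ?mc (n * d) * e0" using mc_pos by (simp add: e0_def)
  have ZW: "real Z \<le> W * (?mc n * K * (e2 * M))"
    using second_moment_sum_le[OF d3 dh h8]
    unfolding Z_def n_def[symmetric] W_def K_def e2_def M_def a_def z_def e_def H_def D_def by simp
  have MK: "0 \<le> M" "0 \<le> K" "0 \<le> e2" "0 < e0" "0 \<le> e1"
    unfolding M_def K_def e2_def e0_def e1_def z_def using D less_imp_le[OF p_pos]
    by (auto intro!: mult_nonneg_nonneg)
  have "A1 * real Z / (W * A0 * ?mc n)\<^sup>2 \<le>
        (?mc (n * Suc d) * e1) * (W * (?mc n * K * (e2 * M))) / (W * (?mc (n * d) * e0) * ?mc n)\<^sup>2"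
    using A1 A0 ZW A00 MK W mc_pos
    by (intro frac_le mult_mono power_mono mult_nonneg_nonneg mult_pos_pos zero_less_power) (auto simp: A1_def A0_def)
  also have "\<dots> = (?mc (n * Suc d) * K / ((?mc (n * d))\<^sup>2 * ?mc n * W)) * (e1 * e2 / e0\<^sup>2) * M"
    using W mc_pos(2) by (simp add: power2_eq_square mult_ac)
  \<comment> \<open>The main terms - D/2 - (D - 2)/2 + (D - 1) cancel, and the errors add up to 2 +
    8 + 2 * 3 = 16.\<close>
  also have "e1 * e2 / e0\<^sup>2 = exp (16 * e)"
    unfolding e0_def e1_def e2_def by (simp add: exp_double[symmetric] exp_add[symmetric] exp_diff[symmetric]) (simp add: field_simps)
  also have "?mc (n * Suc d) * K / ((?mc (n * d))\<^sup>2 * ?mc n * W) =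
      (?p (h * (d + 1)) * ?p (h * (d - 1)) / (?p (h * d))\<^sup>2) * (D ^ (2 * h) / (D + 1) ^ (2 * h))"
  proof -
    have W': "W = (D + 1) ^ (2 * h)" by (simp add: W_def D_def n_def add.commute)
    have two: "(2 :: real) ^ (h * (d + 1)) = 2 ^ (h * d) * 2 ^ h" by (simp add: power_add[symmetric] algebra_simps)
    have m1: "?mc (n * Suc d) = 2 ^ (h * d) * 2 ^ h * ?p (h * (d + 1))"
      unfolding n_def mc_even two[symmetric] by simp
    have m2: "?mc (n * d) = 2 ^ (h * d) * ?p (h * d)" unfolding n_def by (rule mc_even)
    show ?thesis
      unfolding m1 m2 mcn W' K_def using p_pos[of h] by (simp add: power2_eq_square mult_ac)
  qed
  also have "(?p (h * (d + 1)) * ?p (h * (d - 1)) / (?p (h * d))\<^sup>2) * (D ^ (2 * h) / (D + 1) ^ (2 * h)) \<le>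
     (exp (2 / (H * (D - 1)\<^sup>2)) * ((D + 1) ^ (h * (d + 1)) * (D - 1) ^ (h * (d - 1)) / D ^ (2 * (h * d)))) *
       (D ^ (2 * h) / (D + 1) ^ (2 * h))"
    unfolding D_def H_def using h8 d by (intro mult_right_mono pochhammer_half_ratio) auto
  also have "(exp (2 / (H * (D - 1)\<^sup>2)) * ((D + 1) ^ (h * (d + 1)) * (D - 1) ^ (h * (d - 1)) / D ^ (2 * (h * d)))) *
       (D ^ (2 * h) / (D + 1) ^ (2 * h)) * exp (16 * e) * M =
     exp (16 * e) * exp (2 / (H * (D - 1)\<^sup>2)) *
      (((D + 1) ^ (h * (d + 1)) * (D - 1) ^ (h * (d - 1)) / D ^ (2 * (h * d))) *
     (D ^ (2 * h) / (D + 1) ^ (2 * h)) * (1 - 1 / D\<^sup>2) powr (- (real h * (D - 1) + 1 / 2))) * (1 + 184 * z)"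
    unfolding M_def a_def z_def H_def by (simp only: mult_ac)
  also have "\<dots> = exp (16 * e) * exp (2 / (H * (D - 1)\<^sup>2)) * (1 - z) powr (- (1 / 2)) * (1 + 184 * z)"
    unfolding power_cancellation[OF d3 D_def] z_def ..
  also have "\<dots> \<le> exp (16 * z) * exp (2 * z) * exp z * exp (184 * z)"
  proof (intro mult_mono)
    show "exp (16 * e) \<le> exp (16 * z)" using e by (simp add: z_def)
    have "D\<^sup>2 * 1 \<le> H * (D - 1)\<^sup>2"
    proof (intro mult_mono)
      show "D\<^sup>2 \<le> H" using of_nat_mono[OF dh, where 'a = real] by (simp add: D_def H_def)
      show "1 \<le> (D - 1)\<^sup>2" using D by (intro one_le_power) auto
    qed (use H_def in auto)
    then have "2 / (H * (D - 1)\<^sup>2) \<le> 2 / D\<^sup>2" using D2 by (intro frac_le) auto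
    then show "exp (2 / (H * (D - 1)\<^sup>2)) \<le> exp (2 * z)" by (simp add: z_def)
    have "225 \<le> D\<^sup>2" using of_nat_mono[OF d225, where 'a = real] by (simp add: D_def)
    then have z: "0 \<le> z" "z \<le> 1 / 2" unfolding z_def by (simp_all add: divide_le_eq)
    have "- ln (1 - z) \<le> z + 2 * z\<^sup>2" using ln_one_minus_pos_lower_bound[OF z] by simp
    also have "2 * z\<^sup>2 \<le> z" using z mult_right_mono[of "2 * z" 1 z] by (simp add: power2_eq_square)
    finally show "(1 - z) powr (- (1 / 2)) \<le> exp z"
      using z by (simp add: powr_def)
    show "1 + 184 * z \<le> exp (184 * z)" by (rule exp_ge_add_one_self)
    show "0 \<le> 1 + 184 * z" using z by simp
  qed auto
  also have "\<dots> = exp (203 / D\<^sup>2)" by (simp add: z_def exp_add[symmetric])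
  finally show "real (card (pairings n (Suc d))) * real Z /
     (real (Suc d ^ n) * real (card (pairings n d)) * real (matching_count n))\<^sup>2 \<le> exp (203 / (real d)\<^sup>2)"
    using MK(1) by (simp add: A1_def A0_def W_def D_def mult_right_mono)
  show "pairings n d \<noteq> {}" using A0 A00 by (auto simp: A0_def)
qed

text \<open>For d \<ge> 15 the exponent u = 203 / d^2 is at most 1, so exp u - 1 \<le> 2 u = 406 /
  d^2 \<le> (22 / d)^2. Half the root is 11 / d.\<close>

lemma coupling_even:
  fixes h d :: nat
  assumes d: "d \<ge> 15" and dn: "d ^ 4 \<le> 2 * h"
  shows "\<exists>\<mu>. is_coupling \<mu> (Pstar_plus_M1 (2 * h) d) (Pstar (2 * h) (Suc d)) \<and>
    1 - 11 / real d \<le> measure_pmf.prob \<mu> {(P, P'). multigraph P = multigraph P'}"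
proof -
  define u where "u = 203 / (real d)\<^sup>2"
  have "15\<^sup>2 \<le> (real d)\<^sup>2" using d by (intro power_mono) auto
  then have u: "0 \<le> u" "u \<le> 1" by (simp_all add: u_def divide_le_eq)
  have "real (matching_count (2 * h)) > 0"
    unfolding matching_count_even by (intro mult_pos_pos pochhammer_pos) auto
  then have ne: "perfect_matchings {..<2 * h} \<noteq> {}"
    using card_perfect_matchings[of "{..<2 * h}"] by auto
  obtain \<mu> where \<mu>: "is_coupling \<mu> (Pstar_plus_M1 (2 * h) d) (Pstar (2 * h) (Suc d))"
    "1 - sqrt (real (card (pairings (2 * h) (Suc d))) *
       real (\<Sum>c\<in>colourings (2 * h) (Suc d). \<Sum>c'\<in>colourings (2 * h) (Suc d).
         card (matched (2 * h) (Suc d) c \<inter> matched (2 * h) (Suc d) c')) /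
           (real (Suc d ^ (2 * h)) * real (card (pairings (2 * h) d)) * real (matching_count (2 * h)))\<^sup>2 - 1) / 2
       \<le> measure_pmf.prob \<mu> {(P, P'). multigraph P = multigraph P'}" (is "1 - sqrt (?R - 1) / 2 \<le> _")
    using coupling_second_moment[OF moment_ratio_le(2)[OF d dn] ne] by blast
  have "?R \<le> exp u" unfolding u_def by (rule moment_ratio_le(1)[OF d dn])
  also have "\<dots> \<le> 1 + u + u\<^sup>2" by (rule exp_bound[OF u])
  also have "u\<^sup>2 \<le> u" using u by (simp add: power2_eq_square mult_left_le)
  finally have "?R - 1 \<le> 406 / (real d)\<^sup>2" by (simp add: u_def)
  also have "\<dots> \<le> (22 / real d)\<^sup>2" using d by (simp add: power_divide divide_right_mono)
  finally have "sqrt (?R - 1) \<le> 22 / real d" by (intro real_le_lsqrt) auto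
  then show ?thesis using \<mu> by (intro exI[of _ \<mu>]) auto
qed

theorem mainTheorem5:
  fixes d :: "nat \<Rightarrow> nat"
  assumes "\<And>n. d n \<ge> 3"
    and "(\<lambda>n. real (d n)) \<in> o(\<lambda>n. real n powr (1/7) / ln (real n))"
  shows "\<exists>C::real. \<exists>N::nat. \<forall>n\<ge>N. even n \<longrightarrow>
           (\<exists>\<mu>. is_coupling \<mu> (Pstar_plus_M1 n (d n)) (Pstar n (d n + 1)) \<and>
                 measure_pmf.prob \<mu> {(P, P'). multigraph P = multigraph P'}
                   \<ge> 1 - C * ln (real (d n)) / real (d n))"
proof -
  have ln1: "ln (real k) \<ge> 1" if "k \<ge> 3" for k
    using that exp_le by (subst ln_ge_iff) (auto intro: order_trans)
  have "eventually (\<lambda>n. norm (real (d n)) \<le> 1 * norm (real n powr (1/7) / ln (real n))) at_top"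
    by (rule landau_o.smallD[OF assms(2)]) simp
  then obtain N0 where N0: "\<And>n. n \<ge> N0 \<Longrightarrow> real (d n) \<le> \<bar>real n powr (1/7) / ln (real n)\<bar>"
    unfolding eventually_at_top_linorder by auto
  have d4: "d n ^ 4 \<le> n" if n: "n \<ge> max 3 N0" for n
  proof -
    have l: "ln (real n) \<ge> 1" using n by (intro ln1) simp
    have "real (d n) \<le> \<bar>real n powr (1/7) / ln (real n)\<bar>" using n by (intro N0) simp
    also have "\<dots> \<le> real n powr (1/7)" using l by (simp add: divide_le_eq mult_le_cancel_left1)
    finally have "real (d n) ^ 7 \<le> (real n powr (1/7)) ^ 7" by (intro power_mono) auto
    also have "\<dots> = real n" using n by (simp flip: powr_numeral add: powr_powr)
    finally have "real (d n ^ 7) \<le> real n" by simp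
    then have "d n ^ 7 \<le> n" by (simp only: of_nat_le_iff)
    moreover have "d n ^ 4 \<le> d n ^ 7" using assms(1)[of n] by (intro power_increasing) auto
    ultimately show ?thesis by linarith
  qed
  show ?thesis
  \<comment> \<open>The constant 15 serves both cases, as ln d \<ge> 1: it dominates 11 for d \<ge>
    15, and for d < 15 it makes the required probability negative or zero, so that independent
    samples do.\<close>
  proof (rule exI[of _ "15 :: real"], rule exI[of _ "max 3 N0"], intro allI impI)
    fix n assume n: "n \<ge> max 3 N0" and "even n"
    then obtain h where h: "n = 2 * h" by (auto elim: evenE)
    have l: "ln (real (d n)) \<ge> 1" by (rule ln1) (rule assms(1))
    show "\<exists>\<mu>. is_coupling \<mu> (Pstar_plus_M1 n (d n)) (Pstar n (d n + 1)) \<and>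
                 1 - 15 * ln (real (d n)) / real (d n) \<le>
                   measure_pmf.prob \<mu> {(P, P'). multigraph P = multigraph P'}"
      (is "\<exists>\<mu>. ?coupling \<mu>")
    proof (cases "d n \<ge> 15")
      case True
      have le: "11 / real (d n) \<le> 15 * ln (real (d n)) / real (d n)"
        using l by (intro divide_right_mono) auto
      have dn: "d n ^ 4 \<le> 2 * h" using d4[OF n] unfolding h[symmetric] .
      obtain \<mu> where \<mu>: "is_coupling \<mu> (Pstar_plus_M1 n (d n)) (Pstar n (d n + 1))"
        "1 - 11 / real (d n) \<le> measure_pmf.prob \<mu> {(P, P'). multigraph P = multigraph P'}"
        using coupling_even[OF True dn] unfolding h[symmetric] by auto
      have "?coupling \<mu>" using \<mu> le by simp
      then show ?thesis by blast
    next
      case False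
      have "real (d n) \<le> 15 * ln (real (d n))" using False l by linarith
      then have "1 \<le> 15 * ln (real (d n)) / real (d n)"
        using assms(1)[of n] by (subst le_divide_eq_1_pos) auto
      then have "1 - 15 * ln (real (d n)) / real (d n) \<le> 0" by simp
      moreover have "is_coupling (pair_pmf (Pstar_plus_M1 n (d n)) (Pstar n (d n + 1)))
          (Pstar_plus_M1 n (d n)) (Pstar n (d n + 1))"
        by (simp add: is_coupling_def map_fst_pair_pmf map_snd_pair_pmf)
      ultimately show ?thesis by (meson measure_nonneg order_trans)
    qed
  qed
qed

end
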